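(* Let $(M^n,g)$ be a Riemannian manifold of dimension $n\geq 4$. The generalized Bach tensor $B_{\mathbb{T}}$ is a conformal invariant of weight $1$ on $M_{\mathcal{E}}$; that is, if $\psi:M\to(0,\infty)$ is smooth, $\overline{g}=\psi^{-2}g$, and $\overline{B}_{\overline{\mathbb{T}}}$ denotes the generalized Bach tensor of $\overline{g}$, then $\overline{B}_{\overline{\mathbb{T}}}=\psi^2B_{\mathbb{T}}$ on $M_{\mathcal{E}}$.
   Context: Let $(M^n,g)$ be a smooth Riemannian manifold, $n\ge 4$, with Levi-Civita connection $\nabla$. Curvature conventions: $R(X,Y,Z,T)=g(\nabla_X\nabla_YZ-\nabla_Y\nabla_XZ-\nabla_{[X,Y]}Z,T)$, $\mathrm{Ric}(X,Y)=\mathrm{trace}\{V\mapsto R_{V,X}Y\}$, $S=\mathrm{trace}(\mathrm{Ric})$, $\mathrm{Ric}^\circ=\mathrm{Ric}-\frac{S}{n}g$. The Kulkarni--Nomizu product is $(g\odot h)(X,Y,Z,T)=g(X,T)h(Y,Z)+g(Y,Z)h(X,T)-g(X,Z)h(Y,T)-g(Y,T)h(X,Z)$, the Schouten tensor is $\mathfrak{k}=\frac{1}{n-2}\left(\mathrm{Ric}-\frac{1}{2(n-1)}Sg\right)$ and the Weyl tensor is the $(0,4)$ tensor $W=R-g\odot\mathfrak{k}$. For a vector field or vector $Y$, $Y^*=g(Y,\cdot)$. The Weyl tensor acts on $(0,2)$ tensors by $\mathcal{W}(X^*\otimes Y^* )(Z,T)=W(Y,Z,T,X)$; in particular $\mathcal{W}$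 restricts to an endomorphism of $\Lambda^2(T^*M)$ with $\mathcal{W}(X^*\wedge Y^* )(Z,T)=W(X,Y,Z,T)$, where $X^*\wedge Y^*=X^*\otimes Y^*-Y^*\otimes X^*$. $X\llcorner\eta=\eta(X,\cdot)$ denotes contraction in the first slot. $\mathcal{E}_p=\{v\in T_pM : W(v,\cdot,\cdot,\cdot)=0\}$, and $M_{\mathcal{E}}$ is the set of all $p\in M$ at which $q\mapsto\dim\mathcal{E}_q$ is locally constant; it is open and dense in $M$. Both $\mathcal{E}$ and $M_{\mathcal{E}}$ are the same for $g$ and $\overline g$. $\mathfrak{w}:T^*M\to T^*M$ is the $g$-symmetric endomorphism $\mathfrak{w}(\theta)=\sum_{i=1}^n e_i\llcorner\mathcal{W}^2(e_i^*\wedge\theta)$, where $\mathcal{W}^2=\mathcal{W}\circ\mathcal{W}$ on $\Lambda^2(T^*M)$ and $e_1,\dots,e_n$ is a $g$-orthonormal basis of $T_pM$. $\mathfrak{w}^{\#}$ is its pointwise Moore--Penrose inverse (inverse of $\mathfrak{w}$ on $\mathrm{Im}(\mathfrak{w})$, zero on $\mathrm{Ker}(\mathfrak{w})$), which is smooth on $M_{\mathcal{E}}$. For a $(0,s+1)$ tensor $A$ and $r\le s+1$, $\delta_rA(X_1,\dots,X_s)=\sum_j(\nabla_{e_j}A)(X_1,\dots,X_{r-1},e_j,X_r,\dots,X_s)$; thus $\delta_1\delta_4W(X,Y)=\sum_j(\nabla_{e_j}(\delta_4W))(e_j,X,Y)$. Write $\delta W=\delta_4W$ and let $\delta W_Z$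 be the two-form $\delta W_Z(X,Y)=\delta W(X,Y,Z)$. The smooth vector field $\mathbb{T}$ on $M_{\mathcal{E}}$ is defined by $$g(\mathbb{T},\cdot)=\frac{1}{n-3}\,\mathfrak{w}^{\#}\Bigl(\sum_{i=1}^n e_i\llcorner\mathcal{W}(\delta W_{e_i})\Bigr).$$ For a symmetric $(0,2)$ tensor $b$, $\mathrm{d}^{\nabla}b(X,Y,Z)=(\nabla_Xb)(Y,Z)-(\nabla_Yb)(X,Z)$; for any $(0,2)$ tensor $b$, $\mathrm{sym}(b)(x,y)=b(x,y)+b(y,x)$. On $M_{\mathcal{E}}$ one sets $$C_{\mathbb{T}}=\mathrm{d}^{\nabla}\mathfrak{k}-W(\cdot,\cdot,\cdot,\mathbb{T}),$$ $$E_{\mathbb{T}}=\mathrm{Ric}^\circ+(n-2)\Bigl(\nabla \mathbb{T}^*+\mathbb{T}^*\otimes \mathbb{T}^*-\tfrac1n\bigl[\mathrm{div}(\mathbb{T})+g(\mathbb{T},\mathbb{T})\bigr]g\Bigr),\qquad \nabla \mathbb{T}^*(X,Y)=g(\nabla_X\mathbb{T},Y),$$ and the generalized Bach tensor is $$B_{\mathbb{T}}=\delta_1\delta_4W+\frac{n-3}{n-2}\mathcal{W}(\mathrm{Ric})-\frac{n-4}{n-2}\mathcal{W}(\mathrm{sym}(E_{\mathbb{T}}))-(n-3)(n-4)\bigl[\mathcal{W}(\mathbb{T}^*\otimes\mathbb{T}^* )+\mathrm{sym}(C_{\mathbb{T}}(\mathbb{T},\cdot,\cdot))\bigr].$$ Overlined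 symbols denote the objects defined in the same way from the metric $\overline g$. *)

theory Defs
  imports "HOL-Analysis.Analysis"
begin

text \<open>Iterated differentiability; only meaningful for open \<open>S\<close>.\<close>

primrec Ck_on :: "nat \<Rightarrow> ('b::real_normed_vector \<Rightarrow> 'c::real_normed_vector) \<Rightarrow> 'b set \<Rightarrow> bool" where
  "Ck_on 0 f S \<longleftrightarrow> continuous_on S f"
| "Ck_on (Suc k) f S \<longleftrightarrow>
     f differentiable_on S \<and> (\<forall>v. Ck_on k (\<lambda>x. frechet_derivative f (at x) v) S)"

definition smooth_on :: "('b::real_normed_vector \<Rightarrow> 'c::real_normed_vector) \<Rightarrow> 'b set \<Rightarrow> bool" where
  "smooth_on f S \<longleftrightarrow> (\<forall>k. Ck_on k f S)"

text \<open>A chart is a pair of its domain and its coordinate map. The manifold is the union of the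
  domains of an atlas, an open subset of a Hausdorff second countable type; its dimension is
  \<open>CARD('n)\<close>.\<close>

type_synonym ('a, 'n) chart = "'a set \<times> ('a \<Rightarrow> real ^ 'n)"

definition chart_inv :: "('a, 'n) chart \<Rightarrow> real ^ 'n \<Rightarrow> 'a" where
  "chart_inv c = inv_into (fst c) (snd c)"

definition is_chart :: "('a::topological_space, 'n::finite) chart \<Rightarrow> bool" where
  "is_chart c \<longleftrightarrow> open (fst c) \<and> open (snd c ` fst c) \<and>
     homeomorphism (fst c) (snd c ` fst c) (snd c) (chart_inv c)"

definition smooth_atlas :: "('a::topological_space, 'n::finite) chart set \<Rightarrow> bool" where
  "smooth_atlas A \<longleftrightarrow> (\<forall>c\<in>A. is_chart c) \<and>
     (\<forall>c\<in>A. \<forall>c'\<in>A. smooth_on (snd c' \<circ> chart_inv c) (snd c ` (fst c \<inter> fst c')))"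

definition points :: "('a, 'n) chart set \<Rightarrow> 'a set" where
  "points A = (\<Union>c\<in>A. fst c)"

definition smooth_fun :: "('a, 'n::finite) chart set \<Rightarrow> ('a \<Rightarrow> real) \<Rightarrow> bool" where
  "smooth_fun A f \<longleftrightarrow> (\<forall>c\<in>A. smooth_on (f \<circ> chart_inv c) (snd c ` fst c))"

text \<open>The tangent space at \<open>p\<close> is \<open>real ^ 'n\<close>, a vector being given by its components in a chart
  \<open>chart_at A p\<close> selected once and for all for the point \<open>p\<close>. As the selected chart may vary
  wildly with the point, all differentiation goes through the components in one fixed chart,
  obtained with the differential \<open>coord_change\<close> of the change of coordinates. A vector field is a
  function \<open>'a \<Rightarrow> real ^ 'n\<close>, and a covariant tensor field of order k is a function of a point
  and k tangent vectors at this point.\<close>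

type_synonym 'n tvec = "real ^ 'n"
type_synonym ('a, 'n) vfield = "'a \<Rightarrow> 'n tvec"
type_synonym 'n covec = "'n tvec \<Rightarrow> real"
type_synonym 'n form2 = "'n tvec \<Rightarrow> 'n tvec \<Rightarrow> real"
type_synonym ('a, 'n) tensor2 = "'a \<Rightarrow> 'n tvec \<Rightarrow> 'n tvec \<Rightarrow> real"
type_synonym ('a, 'n) tensor3 = "'a \<Rightarrow> 'n tvec \<Rightarrow> 'n tvec \<Rightarrow> 'n tvec \<Rightarrow> real"
type_synonym ('a, 'n) tensor4 = "'a \<Rightarrow> 'n tvec \<Rightarrow> 'n tvec \<Rightarrow> 'n tvec \<Rightarrow> 'n tvec \<Rightarrow> real"

definition chart_at :: "('a, 'n) chart set \<Rightarrow> 'a \<Rightarrow> ('a, 'n) chart" where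
  "chart_at A p = (SOME c. c \<in> A \<and> p \<in> fst c)"

definition coord_change ::
  "('a, 'n::finite) chart \<Rightarrow> ('a, 'n) chart \<Rightarrow> 'a \<Rightarrow> real ^ 'n \<Rightarrow> real ^ 'n" where
  "coord_change c c' q = frechet_derivative (snd c' \<circ> chart_inv c) (at (snd c q))"

definition components ::
  "('a, 'n::finite) chart set \<Rightarrow> ('a, 'n) chart \<Rightarrow> ('a \<Rightarrow> real ^ 'n) \<Rightarrow> 'a \<Rightarrow> real ^ 'n" where
  "components A c Y q = coord_change (chart_at A q) c q (Y q)"

text \<open>The vector field with constant components \<open>u\<close> in the chart \<open>c\<close>.\<close>

definition coord_field ::
  "('a, 'n::finite) chart set \<Rightarrow> ('a, 'n) chart \<Rightarrow> real ^ 'n \<Rightarrow> 'a \<Rightarrow> real ^ 'n" where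
  "coord_field A c u q = coord_change c (chart_at A q) q u"

text \<open>An extension of the tangent vector \<open>u\<close> at \<open>p\<close> to a smooth vector field near \<open>p\<close>. It is used
  below to evaluate at \<open>p\<close> expressions in vector fields that are tensorial.\<close>

definition vf_ext :: "('a, 'n::finite) chart set \<Rightarrow> 'a \<Rightarrow> real ^ 'n \<Rightarrow> 'a \<Rightarrow> real ^ 'n" where
  "vf_ext A p = coord_field A (chart_at A p)"

definition chart_deriv ::
  "('a, 'n::finite) chart set \<Rightarrow> 'a \<Rightarrow> ('a \<Rightarrow> 'b::real_normed_vector) \<Rightarrow> real ^ 'n \<Rightarrow> 'b" where
  "chart_deriv A p F = frechet_derivative (F \<circ> chart_inv (chart_at A p)) (at (snd (chart_at A p) p))"

definition vf_deriv ::
  "('a, 'n::finite) chart set \<Rightarrow> ('a \<Rightarrow> real ^ 'n) \<Rightarrow> ('a \<Rightarrow> real) \<Rightarrow> 'a \<Rightarrow> real" where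
  "vf_deriv A X f p = chart_deriv A p f (X p)"

definition lie_bracket ::
  "('a, 'n::finite) chart set \<Rightarrow> ('a \<Rightarrow> real ^ 'n) \<Rightarrow> ('a \<Rightarrow> real ^ 'n) \<Rightarrow> 'a \<Rightarrow> real ^ 'n" where
  "lie_bracket A X Y p =
     chart_deriv A p (components A (chart_at A p) Y) (X p) -
     chart_deriv A p (components A (chart_at A p) X) (Y p)"

definition riemannian_metric ::
  "('a, 'n::finite) chart set \<Rightarrow> ('a, 'n) tensor2 \<Rightarrow> bool" where
  "riemannian_metric A g \<longleftrightarrow>
     (\<forall>p\<in>points A. bilinear (g p) \<and> (\<forall>u v. g p u v = g p v u) \<and> (\<forall>u. u \<noteq> 0 \<longrightarrow> 0 < g p u u)) \<and>
     (\<forall>c\<in>A. \<forall>u v. smooth_on ((\<lambda>q. g q (coord_field A c u q) (coord_field A c v q)) \<circ> chart_inv c)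
        (snd c ` fst c))"

definition sharp :: "('a, 'n::finite) tensor2 \<Rightarrow> 'a \<Rightarrow> 'n covec \<Rightarrow> 'n tvec" where
  "sharp g p \<theta> = (THE v. \<forall>u. g p v u = \<theta> u)"

text \<open>A \<open>g\<close>-orthonormal basis of the tangent space at \<open>p\<close>. The choice does not matter: all sums over
  it below are metric contractions.\<close>

definition onb :: "('a, 'n::finite) tensor2 \<Rightarrow> 'a \<Rightarrow> 'n \<Rightarrow> 'n tvec" where
  "onb g p = (SOME e. \<forall>i j. g p (e i) (e j) = (if i = j then 1 else 0))"

text \<open>The right-hand side of the Koszul formula for \<open>2 g(\<nabla>\<^sub>X Y, Z)\<close>.\<close>

definition koszul ::
  "('a, 'n::finite) chart set \<Rightarrow> ('a, 'n) tensor2 \<Rightarrow>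
   ('a, 'n) vfield \<Rightarrow> ('a, 'n) vfield \<Rightarrow> ('a, 'n) vfield \<Rightarrow> 'a \<Rightarrow> real" where
  "koszul A g X Y Z p =
     vf_deriv A X (\<lambda>q. g q (Y q) (Z q)) p
   + vf_deriv A Y (\<lambda>q. g q (X q) (Z q)) p
   - vf_deriv A Z (\<lambda>q. g q (X q) (Y q)) p
   + g p (lie_bracket A X Y p) (Z p)
   - g p (lie_bracket A X Z p) (Y p)
   - g p (lie_bracket A Y Z p) (X p)"

definition nabla ::
  "('a, 'n::finite) chart set \<Rightarrow> ('a, 'n) tensor2 \<Rightarrow> ('a, 'n) vfield \<Rightarrow> ('a, 'n) vfield \<Rightarrow> ('a, 'n) vfield" where
  "nabla A g X Y p = sharp g p (\<lambda>w. koszul A g X Y (vf_ext A p w) p / 2)"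

text \<open>Covariant derivatives of tensor fields, with the direction as the first vector argument.\<close>

definition nabla2 ::
  "('a, 'n::finite) chart set \<Rightarrow> ('a, 'n) tensor2 \<Rightarrow> ('a, 'n) tensor2 \<Rightarrow> ('a, 'n) tensor3" where
  "nabla2 A g b p v x y =
     (let V = vf_ext A p v; X = vf_ext A p x; Y = vf_ext A p y in
      vf_deriv A V (\<lambda>q. b q (X q) (Y q)) p
      - b p (nabla A g V X p) y - b p x (nabla A g V Y p))"

definition nabla3 ::
  "('a, 'n::finite) chart set \<Rightarrow> ('a, 'n) tensor2 \<Rightarrow> ('a, 'n) tensor3 \<Rightarrow> ('a, 'n) tensor4" where
  "nabla3 A g b p v x y z =
     (let V = vf_ext A p v; X = vf_ext A p x; Y = vf_ext A p y; Z = vf_ext A p z in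
      vf_deriv A V (\<lambda>q. b q (X q) (Y q) (Z q)) p
      - b p (nabla A g V X p) y z - b p x (nabla A g V Y p) z - b p x y (nabla A g V Z p))"

definition nabla4 ::
  "('a, 'n::finite) chart set \<Rightarrow> ('a, 'n) tensor2 \<Rightarrow> ('a, 'n) tensor4 \<Rightarrow>
   'a \<Rightarrow> 'n tvec \<Rightarrow> 'n tvec \<Rightarrow> 'n tvec \<Rightarrow> 'n tvec \<Rightarrow> 'n tvec \<Rightarrow> real" where
  "nabla4 A g b p v x y z t =
     (let V = vf_ext A p v; X = vf_ext A p x; Y = vf_ext A p y; Z = vf_ext A p z; T = vf_ext A p t in
      vf_deriv A V (\<lambda>q. b q (X q) (Y q) (Z q) (T q)) p
      - b p (nabla A g V X p) y z t - b p x (nabla A g V Y p) z t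
      - b p x y (nabla A g V Z p) t - b p x y z (nabla A g V T p))"

definition delta4 ::
  "('a, 'n::finite) chart set \<Rightarrow> ('a, 'n) tensor2 \<Rightarrow> ('a, 'n) tensor4 \<Rightarrow> ('a, 'n) tensor3" where
  "delta4 A g b p x y z = (\<Sum>j\<in>UNIV. nabla4 A g b p (onb g p j) x y z (onb g p j))"

definition delta1 ::
  "('a, 'n::finite) chart set \<Rightarrow> ('a, 'n) tensor2 \<Rightarrow> ('a, 'n) tensor3 \<Rightarrow> ('a, 'n) tensor2" where
  "delta1 A g b p x y = (\<Sum>j\<in>UNIV. nabla3 A g b p (onb g p j) (onb g p j) x y)"

definition curv_op ::
  "('a, 'n::finite) chart set \<Rightarrow> ('a, 'n) tensor2 \<Rightarrow> 'a \<Rightarrow> 'n tvec \<Rightarrow> 'n tvec \<Rightarrow> 'n tvec \<Rightarrow> 'n tvec" where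
  "curv_op A g p x y z =
     (let X = vf_ext A p x; Y = vf_ext A p y; Z = vf_ext A p z in
      nabla A g X (nabla A g Y Z) p - nabla A g Y (nabla A g X Z) p
      - nabla A g (lie_bracket A X Y) Z p)"

definition Riem :: "('a, 'n::finite) chart set \<Rightarrow> ('a, 'n) tensor2 \<Rightarrow> ('a, 'n) tensor4" where
  "Riem A g p x y z t = g p (curv_op A g p x y z) t"

definition Ric :: "('a, 'n::finite) chart set \<Rightarrow> ('a, 'n) tensor2 \<Rightarrow> ('a, 'n) tensor2" where
  "Ric A g p x y = trace (matrix (\<lambda>v. curv_op A g p v x y))"

definition scal :: "('a, 'n::finite) chart set \<Rightarrow> ('a, 'n) tensor2 \<Rightarrow> 'a \<Rightarrow> real" where
  "scal A g p = (\<Sum>i\<in>UNIV. Ric A g p (onb g p i) (onb g p i))"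

definition Ric0 :: "('a, 'n::finite) chart set \<Rightarrow> ('a, 'n) tensor2 \<Rightarrow> ('a, 'n) tensor2" where
  "Ric0 A g p x y = Ric A g p x y - scal A g p / real CARD('n) * g p x y"

definition kulkarni_nomizu :: "('a, 'n) tensor2 \<Rightarrow> ('a, 'n) tensor2 \<Rightarrow> ('a, 'n) tensor4" where
  "kulkarni_nomizu g h p x y z t =
     g p x t * h p y z + g p y z * h p x t - g p x z * h p y t - g p y t * h p x z"

definition schouten :: "('a, 'n::finite) chart set \<Rightarrow> ('a, 'n) tensor2 \<Rightarrow> ('a, 'n) tensor2" where
  "schouten A g p x y = 1 / (real CARD('n) - 2) *
     (Ric A g p x y - 1 / (2 * (real CARD('n) - 1)) * scal A g p * g p x y)"

definition weyl :: "('a, 'n::finite) chart set \<Rightarrow> ('a, 'n) tensor2 \<Rightarrow> ('a, 'n) tensor4" where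
  "weyl A g p x y z t = Riem A g p x y z t - kulkarni_nomizu g (schouten A g) p x y z t"

text \<open>The linear extension of \<open>X\<^sup>* \<otimes> Y\<^sup>* \<mapsto> W(Y, \<cdot>, \<cdot>, X)\<close> to all (0,2) tensors, obtained from
  \<open>b = (\<Sum>i j. b(e\<^sub>i, e\<^sub>j) e\<^sub>i\<^sup>* \<otimes> e\<^sub>j\<^sup>*)\<close>.\<close>

definition weyl_act ::
  "('a, 'n::finite) chart set \<Rightarrow> ('a, 'n) tensor2 \<Rightarrow> 'a \<Rightarrow> 'n form2 \<Rightarrow> 'n form2" where
  "weyl_act A g p b z t =
     (\<Sum>i\<in>UNIV. \<Sum>j\<in>UNIV. b (onb g p i) (onb g p j) * weyl A g p (onb g p j) z t (onb g p i))"

definition weyl_nullity :: "('a, 'n::finite) chart set \<Rightarrow> ('a, 'n) tensor2 \<Rightarrow> 'a \<Rightarrow> 'n tvec set" where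
  "weyl_nullity A g p = {v. \<forall>x y z. weyl A g p v x y z = 0}"

definition M_E :: "('a::topological_space, 'n::finite) chart set \<Rightarrow> ('a, 'n) tensor2 \<Rightarrow> 'a set" where
  "M_E A g = {p \<in> points A. \<exists>U. open U \<and> p \<in> U \<and> U \<subseteq> points A \<and>
     (\<forall>q\<in>U. dim (weyl_nullity A g q) = dim (weyl_nullity A g p))}"

definition wedge :: "'n covec \<Rightarrow> 'n covec \<Rightarrow> 'n form2" where
  "wedge \<alpha> \<beta> x y = \<alpha> x * \<beta> y - \<beta> x * \<alpha> y"

definition w_endo ::
  "('a, 'n::finite) chart set \<Rightarrow> ('a, 'n) tensor2 \<Rightarrow> 'a \<Rightarrow> 'n covec \<Rightarrow> 'n covec" where
  "w_endo A g p \<theta> x =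
     (\<Sum>i\<in>UNIV. weyl_act A g p (weyl_act A g p (wedge (g p (onb g p i)) \<theta>)) (onb g p i) x)"

text \<open>For an endomorphism \<open>L\<close> of the dual space with \<open>Im L \<oplus> Ker L\<close> the whole space: the inverse of
  \<open>L\<close> on \<open>Im L\<close> and zero on \<open>Ker L\<close>.\<close>

definition endo_im :: "('n::finite covec \<Rightarrow> 'n covec) \<Rightarrow> 'n covec set" where
  "endo_im L = L ` {\<theta>. linear \<theta>}"

definition endo_ker :: "('n::finite covec \<Rightarrow> 'n covec) \<Rightarrow> 'n covec set" where
  "endo_ker L = {\<theta>. linear \<theta> \<and> L \<theta> = (\<lambda>_. 0)}"

definition moore_penrose :: "('n::finite covec \<Rightarrow> 'n covec) \<Rightarrow> 'n covec \<Rightarrow> 'n covec" where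
  "moore_penrose L \<theta> =
     (THE \<alpha>. \<alpha> \<in> endo_im L \<and> (\<exists>\<kappa>\<in>endo_ker L. \<forall>x. \<theta> x = L \<alpha> x + \<kappa> x))"

definition delta_W :: "('a, 'n::finite) chart set \<Rightarrow> ('a, 'n) tensor2 \<Rightarrow> ('a, 'n) tensor3" where
  "delta_W A g = delta4 A g (weyl A g)"

definition T_field :: "('a, 'n::finite) chart set \<Rightarrow> ('a, 'n) tensor2 \<Rightarrow> ('a, 'n) vfield" where
  "T_field A g p = sharp g p (\<lambda>x. 1 / (real CARD('n) - 3) *
     moore_penrose (w_endo A g p)
       (\<lambda>y. \<Sum>i\<in>UNIV. weyl_act A g p (\<lambda>u v. delta_W A g p u v (onb g p i)) (onb g p i) y) x)"

definition sym2 :: "'n form2 \<Rightarrow> 'n form2" where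
  "sym2 b x y = b x y + b y x"

definition d_nabla ::
  "('a, 'n::finite) chart set \<Rightarrow> ('a, 'n) tensor2 \<Rightarrow> ('a, 'n) tensor2 \<Rightarrow> ('a, 'n) tensor3" where
  "d_nabla A g b p x y z = nabla2 A g b p x y z - nabla2 A g b p y x z"

definition C_T :: "('a, 'n::finite) chart set \<Rightarrow> ('a, 'n) tensor2 \<Rightarrow> ('a, 'n) tensor3" where
  "C_T A g p x y z = d_nabla A g (schouten A g) p x y z - weyl A g p x y z (T_field A g p)"

definition nabla_dual ::
  "('a, 'n::finite) chart set \<Rightarrow> ('a, 'n) tensor2 \<Rightarrow> ('a, 'n) vfield \<Rightarrow> ('a, 'n) tensor2" where
  "nabla_dual A g V p x y = g p (nabla A g (vf_ext A p x) V p) y"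

definition divergence ::
  "('a, 'n::finite) chart set \<Rightarrow> ('a, 'n) tensor2 \<Rightarrow> ('a, 'n) vfield \<Rightarrow> 'a \<Rightarrow> real" where
  "divergence A g V p = trace (matrix (\<lambda>x. nabla A g (vf_ext A p x) V p))"

definition E_T :: "('a, 'n::finite) chart set \<Rightarrow> ('a, 'n) tensor2 \<Rightarrow> ('a, 'n) tensor2" where
  "E_T A g p x y = (let T = T_field A g in
     Ric0 A g p x y + (real CARD('n) - 2) *
       (nabla_dual A g T p x y + g p (T p) x * g p (T p) y
        - 1 / real CARD('n) * (divergence A g T p + g p (T p) (T p)) * g p x y))"

definition gen_bach :: "('a, 'n::finite) chart set \<Rightarrow> ('a, 'n) tensor2 \<Rightarrow> ('a, 'n) tensor2" where
  "gen_bach A g p x y = (let n = real CARD('n); T = T_field A g p in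
     delta1 A g (delta_W A g) p x y
     + (n - 3) / (n - 2) * weyl_act A g p (Ric A g p) x y
     - (n - 4) / (n - 2) * weyl_act A g p (sym2 (E_T A g p)) x y
     - (n - 3) * (n - 4) *
         (weyl_act A g p (\<lambda>u v. g p T u * g p T v) x y + sym2 (C_T A g p T) x y))"

end

theory Submission
  imports Defs
begin

text \<open>
  Write \<open>\<psi>\<^sup>-\<^sup>2 g = exp (2 f) g\<close>, \<open>\<phi> = df\<close>, and let \<open>F\<close> be the gradient of \<open>f\<close>. Two facts combine.

  First, for an arbitrary vector field \<open>T\<close>, the tensor \<open>B\<^sub>T\<close> of \<open>g\<close> and that of the new
  metric with the vector field \<open>exp (-2 f) (T + F)\<close> differ by the factor \<open>\<psi>\<^sup>2\<close>. This follows from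
  the transformation laws of the connection, of the Schouten tensor (\<open>k\<close> becomes
  \<open>k - \<nabla>\<phi> + \<phi>\<^sup>2 - |\<phi>|\<^sup>2 g / 2\<close>), of the Weyl tensor, and
  of its divergence (\<open>\<delta>W\<close> becomes \<open>\<delta>W + (n - 3) W(\<cdot>, \<cdot>, \<cdot>, F)\<close>). The
  Cotton tensor needs no separate computation, because \<open>\<delta>W = (n - 3) d\<^sup>\<nabla>k\<close> for both
  metrics by the second Bianchi identity.

  Second, \<open>B\<^sub>T\<close> does not change when a differentiable section \<open>\<nu>\<close> of the nullity of the Weyl tensor is
  added to \<open>T\<close>: differentiating \<open>W(\<nu>, \<cdot>, \<cdot>, \<cdot>) = 0\<close> turns the action of \<open>W\<close> on
  \<open>\<nabla>\<nu>\<close> into \<open>- \<delta>W(\<nu>, \<cdot>, \<cdot>)\<close>. The field \<open>T\<close> of the theorem satisfies a linear equation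
  that determines it modulo the nullity, so by the law for \<open>\<delta>W\<close> the field of the new metric equals
  \<open>exp (-2 f) (T + F)\<close> modulo the nullity.

  That \<open>T\<close> is differentiable where the dimension of the nullity is locally constant is proved by writing
  it as the solution of a uniquely solvable linear equation with smooth coefficients.
\<close>

section \<open>Smooth functions\<close>

text \<open>Tangent vectors at q are components in the chart selected for q, and this selection may
  jump from point to point, so no field can be differentiated as it stands. All analysis is
  therefore done for a metric on an open subset of Euclidean space, with the connection given by
  Christoffel symbols, and each object on the manifold is identified with its counterpart there at
  all points of one fixed chart. Orthonormal bases are also chosen pointwise and need not vary
  continuously. A contraction is therefore rewritten, before it is differentiated, as the trace of
  an endomorphism in the standard basis. The nullity cannot be avoided: the new field
  \<open>T\<close> is orthogonal to it, while exp (-2 f) (T + F) need not be, because F may have a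
  component in it. Since \<nabla>T enters the tensor, differentiability has to be known for the
  fields of both metrics, although they are given by a pointwise generalized inverse, an operation
  that is not continuous where the rank jumps.\<close>

definition dird :: "('b::real_normed_vector \<Rightarrow> 'c::real_normed_vector) \<Rightarrow> 'b \<Rightarrow> 'b \<Rightarrow> 'c" where
  "dird F x v = frechet_derivative F (at x) v"

lemma dird_eqI: "(F has_derivative F') (at x) \<Longrightarrow> dird F x v = F' v"
  unfolding dird_def by (metis frechet_derivative_at)

lemma has_derivative_dird: "F differentiable (at x) \<Longrightarrow> (F has_derivative dird F x) (at x)"
  unfolding dird_def using frechet_derivative_works by metis

lemma linear_dird: "F differentiable (at x) \<Longrightarrow> linear (dird F x)"
  using has_derivative_dird has_derivative_linear by blast

lemma has_derivative_cong_open: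
  assumes "open S" "x \<in> S" "\<And>y. y \<in> S \<Longrightarrow> F y = F' y"
  shows "(F has_derivative D) (at x) \<longleftrightarrow> (F' has_derivative D) (at x)"
  using assms by (metis has_derivative_transform_within_open)

lemma dird_cong_open:
  assumes "open S" "x \<in> S" "\<And>y. y \<in> S \<Longrightarrow> F y = F' y"
  shows "dird F x = dird F' x"
  unfolding dird_def frechet_derivative_def using has_derivative_cong_open[OF assms(1,2), of F F'] assms(3)
    by presburger

lemma differentiable_cong_open:
  assumes "open S" "x \<in> S" "\<And>y. y \<in> S \<Longrightarrow> F y = F' y"
  shows "F differentiable (at x) \<longleftrightarrow> F' differentiable (at x)"
  unfolding differentiable_def using has_derivative_cong_open[OF assms(1,2), of F F'] assms(3) by blast

lemma differentiable_transfer_open: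
  assumes "open S" "x \<in> S" "F' differentiable (at x)" "\<And>y. y \<in> S \<Longrightarrow> F y = F' y"
  shows "F differentiable (at x)"
  using differentiable_cong_open[OF assms(1,2), of F F'] assms(3,4) by blast

lemma Ck_on_Suc:
  "Ck_on (Suc k) f S \<longleftrightarrow> f differentiable_on S \<and> (\<forall>v. Ck_on k (\<lambda>x. dird f x v) S)"
  by (simp add: dird_def)

declare Ck_on.simps(2) [simp del]

lemma Ck_on_cong:
  assumes "open S" "\<And>y. y \<in> S \<Longrightarrow> f y = g y"
  shows "Ck_on k f S \<longleftrightarrow> Ck_on k g S"
  using assms(2)
proof (induction k arbitrary: f g)
  case 0 then show ?case by (auto cong: continuous_on_cong)
next
  case (Suc k)
  have "dird f x = dird g x" if "x \<in> S" for x
    by (rule dird_cong_open[OF assms(1) that]) (use Suc in auto)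
  then have "Ck_on k (\<lambda>x. dird f x v) S \<longleftrightarrow> Ck_on k (\<lambda>x. dird g x v) S" for v
    by (intro Suc.IH) auto
  moreover have "f differentiable_on S \<longleftrightarrow> g differentiable_on S"
    using differentiable_cong_open[OF assms(1), of _ f g] Suc.prems
    by (simp add: differentiable_on_eq_differentiable_at[OF assms(1)])
  ultimately show ?case unfolding Ck_on_Suc by blast
qed

lemma Ck_on_differentiable:
  "open S \<Longrightarrow> Ck_on (Suc k) f S \<Longrightarrow> x \<in> S \<Longrightarrow> f differentiable (at x)"
  by (simp add: Ck_on_Suc differentiable_on_eq_differentiable_at)

lemma Ck_on_SucI:
  assumes "open S" "\<And>x. x \<in> S \<Longrightarrow> (f has_derivative f' x) (at x)" "\<And>v. Ck_on k (\<lambda>x. f' x v) S"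
  shows "Ck_on (Suc k) f S"
proof -
  have "f differentiable_on S"
    using assms(2) by (auto simp: differentiable_on_eq_differentiable_at[OF assms(1)] differentiable_def)
  moreover have "Ck_on k (\<lambda>x. dird f x v) S" for v
    using assms(3)[of v] Ck_on_cong[OF assms(1), of "\<lambda>x. dird f x v" "\<lambda>x. f' x v"] dird_eqI assms(2) by metis
  ultimately show ?thesis unfolding Ck_on_Suc by blast
qed

lemma Ck_on_SucD: "Ck_on (Suc k) f S \<Longrightarrow> Ck_on k f S"
proof (induction k arbitrary: f)
  case 0 then show ?case by (simp add: Ck_on_Suc differentiable_imp_continuous_on)
next
  case (Suc k) then show ?case unfolding Ck_on_Suc[of k] Ck_on_Suc[of "Suc k"] by blast
qed

lemma Ck_on_const: "open S \<Longrightarrow> Ck_on k (\<lambda>x. c) S"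
proof (induction k arbitrary: c)
  case (Suc k) then show ?case by (intro Ck_on_SucI[where f'="\<lambda>x v. 0"]) auto
qed simp

lemma Ck_on_bounded_linear:
  assumes "open S" "bounded_linear L" "Ck_on k f S"
  shows "Ck_on k (\<lambda>x. L (f x)) S"
  using assms(3)
proof (induction k arbitrary: f)
  case 0 then show ?case
    using assms(2) by (auto intro: bounded_linear.continuous_on)
next
  case (Suc k)
  show ?case
    by (rule Ck_on_SucI[OF assms(1) bounded_linear.has_derivative[OF assms(2) has_derivative_dird]])
       (use Suc in \<open>auto simp: Ck_on_Suc Ck_on_differentiable[OF assms(1)]
        differentiable_on_eq_differentiable_at[OF assms(1)]\<close>)
qed

lemma Ck_on_add:
  assumes "open S" "Ck_on k f S" "Ck_on k g S"
  shows "Ck_on k (\<lambda>x. f x + g x) S"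
  using assms(2,3)
proof (induction k arbitrary: f g)
  case 0 then show ?case by (auto intro: continuous_on_add)
next
  case (Suc k)
  show ?case
    by (rule Ck_on_SucI[OF assms(1) has_derivative_add[OF has_derivative_dird has_derivative_dird]])
       (use Suc in \<open>auto simp: Ck_on_Suc differentiable_on_eq_differentiable_at[OF assms(1)]\<close>)
qed

lemma Ck_on_bilinear:
  assumes "open S" "bounded_bilinear bm" "Ck_on k f S" "Ck_on k g S"
  shows "Ck_on k (\<lambda>x. bm (f x) (g x)) S"
  using assms(3,4)
proof (induction k arbitrary: f g)
  case 0 then show ?case by (auto intro: bounded_bilinear.continuous_on[OF assms(2)])
next
  case (Suc k)
  show ?case
    by (rule Ck_on_SucI[OF assms(1) bounded_bilinear.FDERIV[OF assms(2) has_derivative_dird has_derivative_dird]])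
       (use Suc Ck_on_SucD[OF Suc.prems(1)] Ck_on_SucD[OF Suc.prems(2)] in
         \<open>auto simp: Ck_on_Suc differentiable_on_eq_differentiable_at[OF assms(1)] intro!: Ck_on_add assms(1)\<close>)
qed

lemma Ck_on_inverse:
  fixes f :: "'b::real_normed_vector \<Rightarrow> real"
  assumes "open S" "Ck_on k f S" "\<And>x. x \<in> S \<Longrightarrow> f x \<noteq> 0"
  shows "Ck_on k (\<lambda>x. inverse (f x)) S"
  using assms(2)
proof (induction k)
  case 0 then show ?case using assms(3) by (auto intro: continuous_on_inverse)
next
  case (Suc k)
  have f: "f differentiable (at x)" if "x \<in> S" for x using Ck_on_differentiable[OF assms(1) Suc.prems that] .
  \<comment> \<open>The derivative of 1/f contains 1/f itself, whose regularity of order k is the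
    induction hypothesis.\<close>
  have I: "Ck_on k (\<lambda>x. inverse (f x)) S" using Suc Ck_on_SucD by blast
  have m: "bounded_bilinear (\<lambda>a b::real. a * b)" by (rule bounded_bilinear_mult)
  show ?case
  proof (rule Ck_on_SucI[OF assms(1)])
    fix x assume x: "x \<in> S"
    show "((\<lambda>x. inverse (f x)) has_derivative (\<lambda>v. (-1) * (inverse (f x) * dird f x v * inverse (f x)))) (at x)"
      by (rule has_derivative_eq_rhs[OF Deriv.has_derivative_inverse[OF assms(3)[OF x]
        has_derivative_dird[OF f[OF x]]]]) auto
  next
    fix v
    have "Ck_on k (\<lambda>x. dird f x v) S" using Suc.prems unfolding Ck_on_Suc by blast
    then show "Ck_on k (\<lambda>x. (-1) * (inverse (f x) * dird f x v * inverse (f x))) S"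
      by (intro Ck_on_bilinear[OF assms(1) m] I Ck_on_const[OF assms(1)])
  qed
qed

lemma smooth_on_differentiable: "open S \<Longrightarrow> smooth_on f S \<Longrightarrow> x \<in> S \<Longrightarrow> f differentiable (at x)"
  unfolding smooth_on_def using Ck_on_differentiable by blast

lemma smooth_on_continuous: "smooth_on f S \<Longrightarrow> continuous_on S f"
  unfolding smooth_on_def by (metis Ck_on.simps(1))

lemma smooth_on_dird: "smooth_on f S \<Longrightarrow> smooth_on (\<lambda>x. dird f x v) S"
  unfolding smooth_on_def using Ck_on_Suc by blast

lemma smooth_onI_dird:
  assumes "open S" "\<And>x. x \<in> S \<Longrightarrow> f differentiable (at x)" "\<And>v. smooth_on (\<lambda>x. dird f x v) S"
  shows "smooth_on f S"
  unfolding smooth_on_def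
proof
  fix k show "Ck_on k f S"
    by (rule Ck_on_SucD, rule Ck_on_SucI[OF assms(1) has_derivative_dird])
       (use assms in \<open>auto simp: smooth_on_def\<close>)
qed

lemma smooth_on_cong:
  "open S \<Longrightarrow> (\<And>y. y \<in> S \<Longrightarrow> f y = g y) \<Longrightarrow> smooth_on f S \<longleftrightarrow> smooth_on g S"
  unfolding smooth_on_def using Ck_on_cong by blast

lemma smooth_on_const: "open S \<Longrightarrow> smooth_on (\<lambda>x. c) S"
  unfolding smooth_on_def using Ck_on_const by blast

lemma smooth_on_bounded_linear:
  "open S \<Longrightarrow> bounded_linear L \<Longrightarrow> smooth_on f S \<Longrightarrow> smooth_on (\<lambda>x. L (f x)) S"
  unfolding smooth_on_def using Ck_on_bounded_linear by blast

lemma smooth_on_add: "open S \<Longrightarrow> smooth_on f S \<Longrightarrow> smooth_on g S \<Longrightarrow> smooth_on (\<lambda>x. f x + g x) S"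
  unfolding smooth_on_def using Ck_on_add by blast

lemma smooth_on_minus: "open S \<Longrightarrow> smooth_on f S \<Longrightarrow> smooth_on (\<lambda>x. - f x) S"
  by (rule smooth_on_bounded_linear[OF _ bounded_linear_minus[OF bounded_linear_ident]])

lemma smooth_on_diff: "open S \<Longrightarrow> smooth_on f S \<Longrightarrow> smooth_on g S \<Longrightarrow> smooth_on (\<lambda>x. f x - g x) S"
  using smooth_on_add[of S f "\<lambda>x. - g x"] smooth_on_minus[of S g] by simp

lemma smooth_on_bilinear:
  "open S \<Longrightarrow> bounded_bilinear bm \<Longrightarrow> smooth_on f S \<Longrightarrow> smooth_on g S \<Longrightarrow> smooth_on (\<lambda>x. bm (f x) (g x)) S"
  unfolding smooth_on_def using Ck_on_bilinear by blast

lemma smooth_on_mult: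
  fixes f g :: "'b::real_normed_vector \<Rightarrow> real"
  shows "open S \<Longrightarrow> smooth_on f S \<Longrightarrow> smooth_on g S \<Longrightarrow> smooth_on (\<lambda>x. f x * g x) S"
  by (rule smooth_on_bilinear[OF _ bounded_bilinear_mult])

lemma smooth_on_scaleR: "open S \<Longrightarrow> smooth_on f S \<Longrightarrow> smooth_on g S \<Longrightarrow> smooth_on (\<lambda>x. f x *\<^sub>R g x) S"
  by (rule smooth_on_bilinear[OF _ bounded_bilinear_scaleR])

lemma smooth_on_divide:
  fixes f g :: "'b::real_normed_vector \<Rightarrow> real"
  assumes "open S" "smooth_on f S" "smooth_on g S" "\<And>x. x \<in> S \<Longrightarrow> g x \<noteq> 0"
  shows "smooth_on (\<lambda>x. f x / g x) S"
  unfolding divide_inverse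
proof (rule smooth_on_mult[OF assms(1,2)])
  show "smooth_on (\<lambda>x. inverse (g x)) S"
    using Ck_on_inverse[OF assms(1) _ assms(4)] assms(3) by (simp add: smooth_on_def)
qed

lemma smooth_on_sum: "open S \<Longrightarrow> (\<And>i. i \<in> I \<Longrightarrow> smooth_on (f i) S) \<Longrightarrow> smooth_on (\<lambda>x. \<Sum>i\<in>I. f i x) S"
  by (induction I rule: infinite_finite_induct) (auto intro: smooth_on_const smooth_on_add)

lemma smooth_on_prod:
  fixes f :: "'i \<Rightarrow> 'b::real_normed_vector \<Rightarrow> real"
  shows "open S \<Longrightarrow> (\<And>i. i \<in> I \<Longrightarrow> smooth_on (f i) S) \<Longrightarrow> smooth_on (\<lambda>x. \<Prod>i\<in>I. f i x) S"
  by (induction I rule: infinite_finite_induct) (auto intro: smooth_on_const smooth_on_mult)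

lemma vec_expand: "(v::real^'n::finite) = (\<Sum>i\<in>UNIV. (v $ i) *\<^sub>R axis i 1)"
  by (simp add: vec_eq_iff axis_def if_distrib[of "\<lambda>x. _ * x"] cong: if_cong)

lemma smooth_on_nth: "open S \<Longrightarrow> smooth_on f S \<Longrightarrow> smooth_on (\<lambda>x. f x $ i) S"
  by (rule smooth_on_bounded_linear[OF _ bounded_linear_vec_nth])

lemma smooth_on_vec:
  fixes f :: "'b::real_normed_vector \<Rightarrow> real^'n::finite"
  assumes "open S" "\<And>i. smooth_on (\<lambda>x. f x $ i) S"
  shows "smooth_on f S"
proof -
  have "smooth_on (\<lambda>x. \<Sum>i\<in>UNIV. (f x $ i) *\<^sub>R (axis i 1::real^'n)) S"
    by (intro smooth_on_sum smooth_on_scaleR assms smooth_on_const)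
  then show ?thesis by (simp only: vec_expand[symmetric])
qed

lemma smooth_on_subset:
  assumes "open S" "open T" "T \<subseteq> S" "smooth_on f S"
  shows "smooth_on f T"
  unfolding smooth_on_def
proof
  fix k
  have "Ck_on k f S \<Longrightarrow> Ck_on k f T" for f :: "'a \<Rightarrow> 'b"
  proof (induction k arbitrary: f)
    case 0 then show ?case using assms(3) by (auto intro: continuous_on_subset)
  next
    case (Suc k) then show ?case unfolding Ck_on_Suc
      using assms(3) by (auto intro: differentiable_on_subset)
  qed
  then show "Ck_on k f T" using assms(4) by (simp add: smooth_on_def)
qed

lemma smooth_on_exp: 
  assumes "open S" "smooth_on f S"
  shows "smooth_on (\<lambda>x. exp (f x :: real)) S"
  unfolding smooth_on_def
proof
  fix k show "Ck_on k (\<lambda>x. exp (f x)) S"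
  proof (induction k)
    case 0 show ?case using smooth_on_continuous[OF assms(2)] by (auto intro: continuous_on_exp)
  next
    case (Suc k)
    have fx: "(f has_derivative dird f x) (at x)" if "x \<in> S" for x
      using smooth_on_differentiable[OF assms that] has_derivative_dird by blast
    have d: "((\<lambda>x. exp (f x)) has_derivative (\<lambda>v. exp (f x) * dird f x v)) (at x)" if "x \<in> S" for x
      by (rule has_derivative_eq_rhs[OF has_derivative_exp[OF fx[OF that]]]) auto
    show ?case
      by (rule Ck_on_SucI[OF assms(1) d])
        (use Suc smooth_on_dird[OF assms(2)] in \<open>auto simp: smooth_on_def intro!: Ck_on_bilinear[OF assms(1)
        bounded_bilinear_mult]\<close>)
  qed
qed

lemma smooth_on_ln:
  assumes "open S" "smooth_on f S" "\<And>x. x \<in> S \<Longrightarrow> f x > (0::real)"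
  shows "smooth_on (\<lambda>x. ln (f x)) S"
proof -
  have d: "((\<lambda>x. ln (f x)) has_derivative (\<lambda>v. dird f x v / f x)) (at x)" if "x \<in> S" for x
    by (rule has_derivative_eq_rhs[OF has_derivative_ln[OF _ has_derivative_dird[OF
      smooth_on_differentiable[OF assms(1,2) that]]]])
       (use assms(3)[OF that] in \<open>auto simp: field_simps\<close>)
  show ?thesis
  proof (rule smooth_onI_dird[OF assms(1)])
    show "(\<lambda>x. ln (f x)) differentiable at x" if "x \<in> S" for x using d[OF that] differentiable_def by blast
    fix v
    have "smooth_on (\<lambda>x. dird f x v / f x) S"
      by (rule smooth_on_divide[OF assms(1) smooth_on_dird[OF assms(2)] assms(2)]) (use assms(3) in force)
    then show "smooth_on (\<lambda>x. dird (\<lambda>x. ln (f x)) x v) S"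
      using smooth_on_cong[OF assms(1), of "\<lambda>x. dird (\<lambda>x. ln (f x)) x v" "\<lambda>x. dird f x v / f x"] dird_eqI[OF
        d] by blast
  qed
qed

section \<open>Symmetry of second derivatives\<close>

text \<open>The mean value theorem is applied twice: in the direction u to the increment along t v,
  then in the direction v to the derivative so obtained. The second difference on the left is
  symmetric in u and v, whereas the right-hand side fixes an order of differentiation; comparing
  both orders yields the symmetry.\<close>

lemma second_difference_mvt:
  fixes F :: "'b::real_normed_vector \<Rightarrow> real"
  assumes S: "open S" "smooth_on F S" and t: "t > 0"
    and cb: "\<And>a b. 0 \<le> a \<Longrightarrow> a \<le> t \<Longrightarrow> 0 \<le> b \<Longrightarrow> b \<le> t \<Longrightarrow> x + a *\<^sub>R u + b *\<^sub>R v \<in> S"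
  obtains a b where "0 \<le> a" "a \<le> t" "0 \<le> b" "b \<le> t"
    "F (x + t *\<^sub>R u + t *\<^sub>R v) - F (x + t *\<^sub>R u) - F (x + t *\<^sub>R v) + F x
      = t * t * dird (\<lambda>y. dird F y u) (x + a *\<^sub>R u + b *\<^sub>R v) v"
proof -
  have curve: "((\<lambda>s. H (p + s *\<^sub>R w)) has_field_derivative dird H (p + s *\<^sub>R w) w) (at s)"
    if "smooth_on H S" "p + s *\<^sub>R w \<in> S" for H :: "'b \<Rightarrow> real" and p s w
  proof -
    have "(H has_derivative dird H (p + s *\<^sub>R w)) (at (p + s *\<^sub>R w))"
      using smooth_on_differentiable[OF S(1) that] has_derivative_dird by blast
    then have "((\<lambda>s. H (p + s *\<^sub>R w)) has_derivative (\<lambda>d. dird H (p + s *\<^sub>R w) (d *\<^sub>R w))) (at s)"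
      by (rule has_derivative_compose[rotated]) (auto intro!: derivative_eq_intros)
    moreover have "dird H (p + s *\<^sub>R w) (d *\<^sub>R w) = dird H (p + s *\<^sub>R w) w * d" for d
      using linear_dird[OF smooth_on_differentiable[OF S(1) that]] by (simp add: linear_cmul mult.commute)
    ultimately show ?thesis by (simp add: has_field_derivative_def)
  qed
  let ?h = "\<lambda>s. F ((x + t *\<^sub>R v) + s *\<^sub>R u) - F (x + s *\<^sub>R u)"
  have d1: "(?h has_field_derivative (dird F ((x + t *\<^sub>R v) + s *\<^sub>R u) u - dird F (x + s *\<^sub>R u) u)) (at s)"
    if "0 \<le> s" "s \<le> t" for s
    using cb[of s t] cb[of s 0] that t
    by (intro DERIV_diff curve S(2)) (auto simp: algebra_simps)
  obtain a where a: "0 < a" "a < t"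
    "?h t - ?h 0 = (t - 0) * (dird F ((x + t *\<^sub>R v) + a *\<^sub>R u) u - dird F (x + a *\<^sub>R u) u)"
    using MVT2[OF t d1] by blast
  have d2: "((\<lambda>s. dird F ((x + a *\<^sub>R u) + s *\<^sub>R v) u) has_field_derivative
      dird (\<lambda>y. dird F y u) ((x + a *\<^sub>R u) + s *\<^sub>R v) v) (at s)" if "0 \<le> s" "s \<le> t" for s
    using cb[of a s] that a by (intro curve[of "\<lambda>y. dird F y u"] smooth_on_dird S(2)) auto
  obtain b where b: "0 < b" "b < t"
    "dird F ((x + a *\<^sub>R u) + t *\<^sub>R v) u - dird F ((x + a *\<^sub>R u) + 0 *\<^sub>R v) u
       = (t - 0) * dird (\<lambda>y. dird F y u) ((x + a *\<^sub>R u) + b *\<^sub>R v) v"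
    using MVT2[OF t d2] by blast
  show thesis
  proof (rule that[of a b])
    have *: "x + t *\<^sub>R v + a *\<^sub>R u = x + a *\<^sub>R u + t *\<^sub>R v" "x + t *\<^sub>R v + t *\<^sub>R u = x + t *\<^sub>R u + t *\<^sub>R v"
      by (auto simp: algebra_simps)
    show "F (x + t *\<^sub>R u + t *\<^sub>R v) - F (x + t *\<^sub>R u) - F (x + t *\<^sub>R v) + F x
      = t * t * dird (\<lambda>y. dird F y u) (x + a *\<^sub>R u + b *\<^sub>R v) v"
      using a(3) b(3) unfolding * by (simp add: algebra_simps)
  qed (use a b in auto)
qed

lemma dird_commute_real:
  fixes F :: "'b::real_normed_vector \<Rightarrow> real"
  assumes S: "open S" "smooth_on F S" and x: "x \<in> S"
  shows "dird (\<lambda>y. dird F y u) x v = dird (\<lambda>y. dird F y v) x u"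
proof (rule ccontr)
  define P where "P = (\<lambda>y. dird (\<lambda>y. dird F y u) y v)"
  define Q where "Q = (\<lambda>y. dird (\<lambda>y. dird F y v) y u)"
  assume "\<not> ?thesis"
  then have ne: "dist (P x) (Q x) > 0" by (simp add: P_def Q_def)
  \<comment> \<open>Near x each iterated derivative stays within e of its value at x, while the
    second difference forces the two to agree at a pair of nearby points. This contradicts a gap of
    2 e.\<close>
  define e where "e = dist (P x) (Q x) / 2"
  have e: "e > 0" using ne by (simp add: e_def)
  have "isCont P x" "isCont Q x"
    using smooth_on_continuous[OF smooth_on_dird[OF smooth_on_dird[OF S(2)]]] S(1) x
    unfolding P_def Q_def by (metis continuous_on_eq_continuous_at)+
  then obtain d1 d2 where d12: "d1 > 0" "d2 > 0" "\<And>y. dist y x < d1 \<Longrightarrow> dist (P y) (P x) < e" "\<And>y. dist y x <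
    d2 \<Longrightarrow> dist (Q y) (Q x) < e"
    using e unfolding continuous_at_eps_delta by metis
  obtain d3 where d3: "d3 > 0" "ball x d3 \<subseteq> S" using S(1) x open_contains_ball by blast
  define d where "d = min d1 (min d2 d3)"
  have d: "d > 0" using d12 d3 by (simp add: d_def)
  \<comment> \<open>A step so short that the parallelogram spanned by t u and t v stays within
    distance d of x. The summand 1 keeps the quotient meaningful for u = v = 0 and the estimate
    strict.\<close>
  define t where "t = d / (norm u + norm v + 1)"
  have np: "norm u + norm v + 1 > 0" by (smt (verit) norm_ge_zero)
  have t: "t > 0" using d np by (simp add: t_def)
  have near: "dist (x + a *\<^sub>R u + b *\<^sub>R v) x < d" "dist (x + b *\<^sub>R v + a *\<^sub>R u) x < d"
    if "0 \<le> a" "a \<le> t" "0 \<le> b" "b \<le> t" for a b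
  proof -
    have "norm (a *\<^sub>R u + b *\<^sub>R v) \<le> a * norm u + b * norm v"
      using norm_triangle_ineq[of "a *\<^sub>R u" "b *\<^sub>R v"] that by simp
    also have "\<dots> \<le> t * norm u + t * norm v" using that by (intro add_mono mult_right_mono) auto
    also have "\<dots> < t * (norm u + norm v + 1)" using t by (simp add: algebra_simps)
    also have "\<dots> = d" using np by (simp add: t_def)
    finally show "dist (x + a *\<^sub>R u + b *\<^sub>R v) x < d" "dist (x + b *\<^sub>R v + a *\<^sub>R u) x < d"
      by (auto simp: dist_norm algebra_simps)
  qed
  have inS: "y \<in> S" if "dist y x < d" for y using d3 that by (auto simp: d_def dist_commute subset_iff)
  obtain a b where ab: "0 \<le> a" "a \<le> t" "0 \<le> b" "b \<le> t"
    "F (x + t *\<^sub>R u + t *\<^sub>R v) - F (x + t *\<^sub>R u) - F (x + t *\<^sub>R v) + F x = t * t * P (x + a *\<^sub>R u + b *\<^sub>R v)"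
    using second_difference_mvt[OF S t, of x u v] inS near(1) unfolding P_def by metis
  obtain a' b' where ab': "0 \<le> a'" "a' \<le> t" "0 \<le> b'" "b' \<le> t"
    "F (x + t *\<^sub>R v + t *\<^sub>R u) - F (x + t *\<^sub>R v) - F (x + t *\<^sub>R u) + F x = t * t * Q (x + a' *\<^sub>R v + b' *\<^sub>R u)"
    using second_difference_mvt[OF S t, of x v u] inS near(2) unfolding Q_def by metis
  have "x + t *\<^sub>R v + t *\<^sub>R u = x + t *\<^sub>R u + t *\<^sub>R v" by (simp add: algebra_simps)
  then have "t * t * P (x + a *\<^sub>R u + b *\<^sub>R v) = t * t * Q (x + a' *\<^sub>R v + b' *\<^sub>R u)"
    using ab(5) ab'(5) by (simp only: algebra_simps)
  then have eq: "P (x + a *\<^sub>R u + b *\<^sub>R v) = Q (x + a' *\<^sub>R v + b' *\<^sub>R u)" using t by simp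
  have "dist (P (x + a *\<^sub>R u + b *\<^sub>R v)) (P x) < e" using near(1)[OF ab(1-4)] d12(3) by (simp add: d_def)
  moreover have "dist (Q (x + a' *\<^sub>R v + b' *\<^sub>R u)) (Q x) < e" using near(2)[OF ab'(3,4,1,2)] d12(4) by
    (simp add: d_def)
  ultimately have "dist (P x) (Q x) < e + e" unfolding eq
    by (smt (verit) dist_commute dist_triangle)
  then show False by (simp add: e_def)
qed

lemma dird_nth: "F differentiable (at x) \<Longrightarrow> dird (\<lambda>y. F y $ i) x v = dird F x v $ i"
  by (rule dird_eqI[OF bounded_linear.has_derivative[OF bounded_linear_vec_nth has_derivative_dird]])

text \<open>The mean value theorem concerns real functions, so vector values are treated
  componentwise.\<close>

lemma dird_commute:
  fixes F :: "'b::real_normed_vector \<Rightarrow> real^'n::finite"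
  assumes S: "open S" "smooth_on F S" and x: "x \<in> S"
  shows "dird (\<lambda>y. dird F y u) x v = dird (\<lambda>y. dird F y v) x u"
proof -
  have "dird (\<lambda>y. dird F y u) x v $ i = dird (\<lambda>y. dird (\<lambda>z. F z $ i) y u) x v" for i u v
  proof -
    have "dird (\<lambda>y. dird F y u) x v $ i = dird (\<lambda>y. dird F y u $ i) x v"
      using smooth_on_differentiable[OF S(1) smooth_on_dird[OF S(2)] x] by (simp add: dird_nth)
    also have "\<dots> = dird (\<lambda>y. dird (\<lambda>z. F z $ i) y u) x v"
      by (rule fun_cong[OF dird_cong_open[OF S(1) x]]) (simp add: dird_nth smooth_on_differentiable[OF S])
    finally show ?thesis .
  qed
  then show ?thesis
    using dird_commute_real[OF S(1) smooth_on_nth[OF S] x] by (simp add: vec_eq_iff)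
qed

section \<open>Calculus of directional derivatives\<close>

lemma dird_add: "F differentiable (at x) \<Longrightarrow> H differentiable (at x) \<Longrightarrow> dird (\<lambda>y. F y + H y) x v = dird F x v +
  dird H x v"
  by (rule dird_eqI[OF has_derivative_add[OF has_derivative_dird has_derivative_dird]])

lemma dird_diff: "F differentiable (at x) \<Longrightarrow> H differentiable (at x) \<Longrightarrow> dird (\<lambda>y. F y - H y) x v = dird F x v
  - dird H x v"
  by (rule dird_eqI[OF has_derivative_diff[OF has_derivative_dird has_derivative_dird]])

lemma dird_scaleR: "F differentiable (at x) \<Longrightarrow> H differentiable (at x) \<Longrightarrow>
    dird (\<lambda>y. F y *\<^sub>R H y) x v = F x *\<^sub>R dird H x v + dird F x v *\<^sub>R H x"
  by (rule dird_eqI[OF has_derivative_scaleR[OF has_derivative_dird has_derivative_dird]])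

lemma dird_mult:
  fixes F H :: "'b::real_normed_vector \<Rightarrow> real"
  shows "F differentiable (at x) \<Longrightarrow> H differentiable (at x) \<Longrightarrow>
    dird (\<lambda>y. F y * H y) x v = F x * dird H x v + dird F x v * H x"
  by (rule dird_eqI[OF has_derivative_mult[OF has_derivative_dird has_derivative_dird]])

lemma dird_const: "dird (\<lambda>y. c) x v = 0"
  by (rule dird_eqI) simp

lemma dird_cmult:
  fixes F :: "'b::real_normed_vector \<Rightarrow> real"
  shows "F differentiable (at x) \<Longrightarrow> dird (\<lambda>y. c * F y) x v = c * dird F x v"
  by (simp add: dird_mult dird_const)

lemma dird_sum: "(\<And>i. i \<in> I \<Longrightarrow> F i differentiable (at x)) \<Longrightarrow> dird (\<lambda>y. \<Sum>i\<in>I. F i y) x v = (\<Sum>i\<in>I. dird (F i) x v)"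
  by (rule dird_eqI[OF has_derivative_sum]) (auto intro: has_derivative_dird)

lemma dird_exp: "F differentiable (at x) \<Longrightarrow> dird (\<lambda>y. exp (F y :: real)) x v = exp (F x) * dird F x v"
  by (rule dird_eqI[OF has_derivative_eq_rhs[OF has_derivative_exp[OF has_derivative_dird]]]) auto

text \<open>Differentiability of \<open>b\<close> is assumed for each fixed argument only. Expanding
  the argument in the standard basis leaves finitely many products, so the product rule holds
  without a norm on the space of linear maps.\<close>

lemma slot_derivative:
  fixes b :: "'b::real_normed_vector \<Rightarrow> real^'n::finite \<Rightarrow> 'c::real_normed_vector"
  assumes S: "open S" "x \<in> S" and lin: "\<And>y. y \<in> S \<Longrightarrow> linear (b y)"
    and b: "\<And>u. (\<lambda>y. b y u) differentiable (at x)" and Y: "Y differentiable (at x)"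
  shows "((\<lambda>y. b y (Y y)) has_derivative (\<lambda>v. dird (\<lambda>y. b y (Y x)) x v + b x (dird Y x v))) (at x)"
proof -
  have exp: "b y w = (\<Sum>i\<in>UNIV. (w $ i) *\<^sub>R b y (axis i 1))" if "y \<in> S" for y w
    by (subst vec_expand[of w]) (simp add: linear_sum[OF lin[OF that]] linear_cmul[OF lin[OF that]])
  have Yi: "(\<lambda>y. Y y $ i) differentiable (at x)" for i
    using bounded_linear.has_derivative[OF bounded_linear_vec_nth has_derivative_dird[OF Y]]
      differentiable_def by blast
  have d: "((\<lambda>y. \<Sum>i\<in>UNIV. (Y y $ i) *\<^sub>R b y (axis i 1)) has_derivative
     (\<lambda>v. \<Sum>i\<in>UNIV. (Y x $ i) *\<^sub>R dird (\<lambda>y. b y (axis i 1)) x v + dird (\<lambda>y. Y y $ i) x v *\<^sub>R b x (axis i 1)))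
       (at x)"
    by (intro has_derivative_sum has_derivative_scaleR has_derivative_dird Yi b)
  have e1: "dird (\<lambda>y. b y (Y x)) x v = (\<Sum>i\<in>UNIV. (Y x $ i) *\<^sub>R dird (\<lambda>y. b y (axis i 1)) x v)" for v
  proof -
    have "dird (\<lambda>y. b y (Y x)) x v = dird (\<lambda>y. \<Sum>i\<in>UNIV. (Y x $ i) *\<^sub>R b y (axis i 1)) x v"
      by (rule fun_cong[OF dird_cong_open[OF S]]) (rule exp)
    also have "\<dots> = (\<Sum>i\<in>UNIV. (Y x $ i) *\<^sub>R dird (\<lambda>y. b y (axis i 1)) x v)"
      by (rule dird_eqI, intro has_derivative_sum has_derivative_scaleR_right has_derivative_dird b)
    finally show ?thesis .
  qed
  have e2: "b x (dird Y x v) = (\<Sum>i\<in>UNIV. dird (\<lambda>y. Y y $ i) x v *\<^sub>R b x (axis i 1))" for v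
    by (subst exp[OF S(2)]) (simp add: dird_nth[OF Y])
  have "((\<lambda>y. \<Sum>i\<in>UNIV. (Y y $ i) *\<^sub>R b y (axis i 1)) has_derivative
     (\<lambda>v. dird (\<lambda>y. b y (Y x)) x v + b x (dird Y x v))) (at x)"
    by (rule has_derivative_eq_rhs[OF d]) (simp add: e1 e2 sum.distrib)
  then show ?thesis
    using has_derivative_cong_open[OF S, of "\<lambda>y. b y (Y y)", OF exp] by blast
qed

lemma slot_differentiable:
  fixes b :: "'b::real_normed_vector \<Rightarrow> real^'n::finite \<Rightarrow> 'c::real_normed_vector"
  assumes "open S" "x \<in> S" "\<And>y. y \<in> S \<Longrightarrow> linear (b y)"
    "\<And>u. (\<lambda>y. b y u) differentiable (at x)" "Y differentiable (at x)"
  shows "(\<lambda>y. b y (Y y)) differentiable (at x)"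
  using slot_derivative[OF assms] differentiable_def by blast

lemma slot_dird:
  fixes b :: "'b::real_normed_vector \<Rightarrow> real^'n::finite \<Rightarrow> 'c::real_normed_vector"
  assumes "open S" "x \<in> S" "\<And>y. y \<in> S \<Longrightarrow> linear (b y)"
    "\<And>u. (\<lambda>y. b y u) differentiable (at x)" "Y differentiable (at x)"
  shows "dird (\<lambda>y. b y (Y y)) x v = dird (\<lambda>y. b y (Y x)) x v + b x (dird Y x v)"
  using dird_eqI[OF slot_derivative[OF assms]] .

lemma slot_smooth:
  fixes b :: "'b::real_normed_vector \<Rightarrow> real^'n::finite \<Rightarrow> 'c::real_normed_vector"
  assumes S: "open S" and lin: "\<And>y. y \<in> S \<Longrightarrow> linear (b y)"
    and b: "\<And>u. smooth_on (\<lambda>y. b y u) S" and Y: "smooth_on Y S"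
  shows "smooth_on (\<lambda>y. b y (Y y)) S"
proof -
  have exp: "b y w = (\<Sum>i\<in>UNIV. (w $ i) *\<^sub>R b y (axis i 1))" if "y \<in> S" for y w
    by (subst vec_expand[of w]) (simp add: linear_sum[OF lin[OF that]] linear_cmul[OF lin[OF that]])
  have "smooth_on (\<lambda>y. \<Sum>i\<in>UNIV. (Y y $ i) *\<^sub>R b y (axis i 1)) S"
    by (intro smooth_on_sum smooth_on_scaleR S smooth_on_nth Y b)
  then show ?thesis using smooth_on_cong[OF S, of "\<lambda>y. b y (Y y)", OF exp] by blast
qed

lemma dird_linear_param:
  fixes b :: "'b::real_normed_vector \<Rightarrow> 'd::real_normed_vector \<Rightarrow> 'c::real_normed_vector"
  assumes S: "open S" "x \<in> S" and lin: "\<And>y. y \<in> S \<Longrightarrow> linear (b y)"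
    and b: "\<And>u. (\<lambda>y. b y u) differentiable (at x)"
  shows "linear (\<lambda>u. dird (\<lambda>y. b y u) x v)"
proof (rule linearI)
  fix u w
  have "dird (\<lambda>y. b y (u + w)) x v = dird (\<lambda>y. b y u + b y w) x v"
    by (rule fun_cong[OF dird_cong_open[OF S]]) (simp add: linear_add lin)
  then show "dird (\<lambda>y. b y (u + w)) x v = dird (\<lambda>y. b y u) x v + dird (\<lambda>y. b y w) x v"
    by (simp add: dird_add b)
next
  fix c :: real and u
  have "dird (\<lambda>y. b y (c *\<^sub>R u)) x v = dird (\<lambda>y. c *\<^sub>R b y u) x v"
    by (rule fun_cong[OF dird_cong_open[OF S]]) (simp add: linear_cmul lin)
  then show "dird (\<lambda>y. b y (c *\<^sub>R u)) x v = c *\<^sub>R dird (\<lambda>y. b y u) x v"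
    by (simp add: dird_scaleR b dird_const)
qed

section \<open>Inner products and orthonormal bases\<close>

definition metric_form :: "'n::finite form2 \<Rightarrow> bool" where
  "metric_form h \<longleftrightarrow> bilinear h \<and> (\<forall>u v. h u v = h v u) \<and> (\<forall>u. u \<noteq> 0 \<longrightarrow> 0 < h u u)"

definition is_onb :: "'n::finite form2 \<Rightarrow> ('n \<Rightarrow> real^'n) \<Rightarrow> bool" where
  "is_onb h e \<longleftrightarrow> (\<forall>i j. h (e i) (e j) = (if i = j then 1 else 0))"

lemma metric_form_linear:
  assumes "metric_form h"
  shows "linear (h u)" "linear (\<lambda>u. h u v)"
  using assms by (auto simp: metric_form_def bilinear_def)

lemma metric_form_sym: "metric_form h \<Longrightarrow> h u v = h v u"
  by (auto simp: metric_form_def)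

lemmas metric_form_simps =
  linear_add[OF metric_form_linear(1)] linear_add[OF metric_form_linear(2)]
  linear_diff[OF metric_form_linear(1)] linear_diff[OF metric_form_linear(2)]
  linear_cmul[OF metric_form_linear(1)] linear_cmul[OF metric_form_linear(2)]
  linear_neg[OF metric_form_linear(1)] linear_neg[OF metric_form_linear(2)]
  linear_0[OF metric_form_linear(1)] linear_0[OF metric_form_linear(2)]

lemmas metric_form_sums =
  linear_sum[OF metric_form_linear(1)] linear_sum[OF metric_form_linear(2)]

lemma metric_form_nondegenerate:
  assumes h: "metric_form h" and "\<And>w. h u w = h v w"
  shows "u = v"
proof (rule ccontr)
  assume "u \<noteq> v"
  then have "h (u - v) (u - v) > 0" using h by (auto simp: metric_form_def)
  then show False using assms by (simp add: metric_form_simps)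
qed

text \<open>Gram-Schmidt by induction on the set of indices already served: as long as one index is
  missing, the vectors found so far span a proper subspace.\<close>

lemma ex_onb:
  fixes h :: "'n::finite form2"
  assumes h: "metric_form h"
  shows "\<exists>e. is_onb h e"
proof -
  have "finite I \<Longrightarrow> \<exists>e. \<forall>i\<in>I. \<forall>j\<in>I. h (e i) (e j) = (if i = j then 1 else 0)" for I :: "'n set"
  proof (induction I rule: finite_induct)
    case (insert k I)
    then obtain e where e: "\<And>i j. i \<in> I \<Longrightarrow> j \<in> I \<Longrightarrow> h (e i) (e j) = (if i = j then 1 else 0)" by blast
    have "dim (span (e ` I)) \<le> card I"
      using dim_le_card'[of "e ` I"] insert(1) card_image_le[OF insert(1), of e] by simp
    also have "\<dots> < CARD('n)"
      using insert by (intro psubset_card_mono) auto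
    finally have "span (e ` I) \<noteq> (UNIV :: (real^'n) set)" by (metis dim_UNIV dim_span DIM_cart DIM_real
      mult.right_neutral nat_less_le)
    then obtain y where y: "y \<notin> span (e ` I)" by blast
    define v where "v = y - (\<Sum>i\<in>I. h y (e i) *\<^sub>R e i)"
    have "v \<noteq> 0"
    proof
      assume "v = 0"
      then have "y = (\<Sum>i\<in>I. h y (e i) *\<^sub>R e i)" by (simp add: v_def)
      moreover have "\<dots> \<in> span (e ` I)" by (intro span_sum span_scale span_base imageI)
      ultimately show False using y by simp
    qed
    then have p: "h v v > 0" using h by (auto simp: metric_form_def)
    have ve: "h v (e j) = 0" if "j \<in> I" for j
    proof -
      have "(\<Sum>i\<in>I. h y (e i) * h (e i) (e j)) = h y (e j)"
        using insert(1) that e by (simp add: if_distrib[of "\<lambda>x. _ * x"] sum.delta cong: if_cong sum.cong)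
      then show ?thesis by (simp add: v_def metric_form_simps[OF h] metric_form_sums[OF h])
    qed
    let ?e = "e(k := (1 / sqrt (h v v)) *\<^sub>R v)"
    have "h (?e i) (?e j) = (if i = j then 1 else 0)" if "i \<in> insert k I" "j \<in> insert k I" for i j
      using that e insert(2) ve p metric_form_sym[OF h]
      by (auto simp: metric_form_simps[OF h] real_sqrt_mult_self)
    then show ?case by blast
  qed simp
  from this[of UNIV] show ?thesis by (auto simp: is_onb_def)
qed

lemma is_onb_onb: "metric_form (g p) \<Longrightarrow> is_onb (g p) (onb g p)"
  unfolding onb_def is_onb_def using ex_onb[of "g p"] unfolding is_onb_def by (rule someI_ex)

text \<open>Orthonormality recovers the coefficients of a combination, so the combination map is
  injective and, by dimension, surjective. Thus spanning follows from orthonormality.\<close>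

lemma onb_expand:
  fixes e :: "'n::finite \<Rightarrow> real^'n"
  assumes h: "metric_form h" and e: "is_onb h e"
  shows "v = (\<Sum>j\<in>UNIV. h v (e j) *\<^sub>R e j)"
proof -
  define f where "f = (\<lambda>c::real^'n. \<Sum>j\<in>UNIV. (c $ j) *\<^sub>R e j)"
  have lf: "linear f" unfolding f_def
    by (rule linearI) (auto simp: scaleR_add_left sum.distrib scaleR_sum_right)
  have c: "h (f c) (e j) = c $ j" for c j
    using e unfolding f_def is_onb_def by (simp add: metric_form_simps[OF h] metric_form_sums[OF h]
      if_distrib[of "\<lambda>x. _ * x"] cong: if_cong)
  have "inj f" by (rule injI) (metis c vec_eq_iff)
  then have "surj f" using linear_injective_imp_surjective lf by blast
  then obtain c where "v = f c" by blast
  then show ?thesis using c unfolding f_def by simp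
qed

lemma onb_sum:
  assumes "metric_form h" "is_onb h e" "linear f"
  shows "(\<Sum>j\<in>UNIV. h v (e j) *\<^sub>R f (e j)) = f v" "(\<Sum>j\<in>UNIV. h (e j) v *\<^sub>R f (e j)) = f v"
proof -
  show 1: "(\<Sum>j\<in>UNIV. h v (e j) *\<^sub>R f (e j)) = f v"
    by (subst (2) onb_expand[OF assms(1,2), of v]) (simp add: linear_sum[OF assms(3)] linear_cmul[OF assms(3)])
  show "(\<Sum>j\<in>UNIV. h (e j) v *\<^sub>R f (e j)) = f v"
    unfolding 1[symmetric] by (simp add: metric_form_sym[OF assms(1), of v])
qed

lemma onb_sum_real:
  fixes f :: "real^'n::finite \<Rightarrow> real"
  assumes "metric_form h" "is_onb h e" "linear f"
  shows "(\<Sum>j\<in>UNIV. h v (e j) * f (e j)) = f v" "(\<Sum>j\<in>UNIV. h (e j) v * f (e j)) = f v"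
    "(\<Sum>j\<in>UNIV. f (e j) * h v (e j)) = f v" "(\<Sum>j\<in>UNIV. f (e j) * h (e j) v) = f v"
  using onb_sum[OF assms] by (simp_all add: mult.commute)

lemma onb_card: "is_onb h (e::'n::finite \<Rightarrow> _) \<Longrightarrow> (\<Sum>j\<in>UNIV. h (e j) (e j)) = real CARD('n)"
  by (simp add: is_onb_def)

text \<open>The Ricci tensor and the divergence are defined by traces in the standard basis, the
  other contractions by an orthonormal basis; this identity connects the two.\<close>

lemma trace_eq_onb_sum:
  fixes e :: "'n::finite \<Rightarrow> real^'n"
  assumes h: "metric_form h" and e: "is_onb h e" and L: "linear L"
  shows "trace (matrix L) = (\<Sum>j\<in>UNIV. h (L (e j)) (e j))"
proof -
  have "trace (matrix L) = (\<Sum>a\<in>UNIV. L (axis a 1) $ a)" by (simp add: trace_def matrix_def)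
  also have "\<dots> = (\<Sum>a\<in>UNIV. \<Sum>j\<in>UNIV. h (axis a 1) (e j) * L (e j) $ a)"
  proof (rule sum.cong)
    fix a :: 'n
    have "linear (\<lambda>v. L v $ a)" using L by (auto intro!: linearI simp: linear_add linear_cmul)
    from onb_sum_real(1)[OF h e this, of "axis a 1"]
    show "L (axis a 1) $ a = (\<Sum>j\<in>UNIV. h (axis a 1) (e j) * L (e j) $ a)" by simp
  qed simp
  also have "\<dots> = (\<Sum>j\<in>UNIV. \<Sum>a\<in>UNIV. h (axis a 1) (e j) * L (e j) $ a)" by (rule sum.swap)
  also have "\<dots> = (\<Sum>j\<in>UNIV. h (L (e j)) (e j))"
  proof (rule sum.cong)
    fix j
    have "h (L (e j)) (e j) = h (\<Sum>a\<in>UNIV. (L (e j) $ a) *\<^sub>R axis a 1) (e j)" by (simp only: vec_expand[symmetric])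
    also have "\<dots> = (\<Sum>a\<in>UNIV. h (axis a 1) (e j) * L (e j) $ a)"
      by (simp add: metric_form_sums[OF h] metric_form_simps[OF h] mult.commute)
    finally show "(\<Sum>a\<in>UNIV. h (axis a 1) (e j) * L (e j) $ a) = h (L (e j)) (e j)" ..
  qed simp
  finally show ?thesis .
qed

lemma sharp_eqI:
  assumes "metric_form (g p)" "\<And>u. g p v u = \<theta> u"
  shows "sharp g p \<theta> = v"
  unfolding sharp_def
  using assms metric_form_nondegenerate[OF assms(1)] by (intro the_equality) auto

lemma metric_sharp:
  assumes h: "metric_form (g p)" and "linear \<theta>"
  shows "g p (sharp g p \<theta>) u = \<theta> u"
proof -
  let ?v = "\<Sum>j\<in>UNIV. \<theta> (onb g p j) *\<^sub>R onb g p j"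
  have "g p ?v u = \<theta> u" for u
    using onb_sum_real(4)[OF h is_onb_onb[of g p, OF h] assms(2)]
    by (simp add: metric_form_sums[OF h] metric_form_simps[OF h])
  then show ?thesis using sharp_eqI[of g p ?v \<theta>] h by simp
qed

lemma linear_sharp:
  assumes h: "metric_form (g p)" and b: "\<And>u. linear (b u)" "\<And>v. linear (\<lambda>u. b u v)"
  shows "linear (\<lambda>u. sharp g p (b u))"
  by (rule linearI; rule sharp_eqI[of g p, OF h])
     (simp_all add: metric_form_simps[OF h] metric_sharp[of g p, OF h b(1)] linear_add[OF b(2)]
       linear_cmul[OF b(2)])

lemma onb_sum_eq_trace:
  assumes h: "metric_form (g p)" and e: "is_onb (g p) e"
    and b: "\<And>u. linear (b u)" "\<And>v. linear (\<lambda>u. b u v)"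
  shows "(\<Sum>j\<in>UNIV. b (e j) (e j)) = trace (matrix (\<lambda>u. sharp g p (b u)))"
  using trace_eq_onb_sum[OF h e linear_sharp[of g p b, OF h b]] by (simp add: metric_sharp[of g p, OF h b(1)])

text \<open>Both sums equal the trace of the endomorphism obtained by raising an index, in which no
  orthonormal basis occurs.\<close>

lemma onb_sum_indep:
  assumes h: "metric_form h" and e: "is_onb h e" "is_onb h e'"
    and b: "\<And>u. linear (b u)" "\<And>v. linear (\<lambda>u. b u v)"
  shows "(\<Sum>j\<in>UNIV. b (e j) (e j)) = (\<Sum>j\<in>UNIV. b (e' j) (e' j) :: real)"
  using onb_sum_eq_trace[of "\<lambda>_. h" "()", OF h _ b] e by metis

section \<open>Linear equations with smooth coefficients\<close>

lemma smooth_on_det: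
  fixes M :: "'b::real_normed_vector \<Rightarrow> real^'n^'n::finite"
  assumes "open S" "\<And>i j. smooth_on (\<lambda>x. M x $ i $ j) S"
  shows "smooth_on (\<lambda>x. det (M x)) S"
  unfolding det_def
  by (intro smooth_on_sum smooth_on_mult smooth_on_const smooth_on_prod assms)

text \<open>Cramer's rule exhibits the solution as a quotient of determinants. Whatever is given
  only implicitly gets its smoothness from here: raised indices, coordinate fields read in a second
  chart, and the field \<open>T\<close>.\<close>

lemma smooth_on_solution:
  fixes M :: "'b::real_normed_vector \<Rightarrow> real^'n::finite \<Rightarrow> real^'n"
  assumes S: "open S" and lin: "\<And>x. x \<in> S \<Longrightarrow> linear (M x)" and inj: "\<And>x. x \<in> S \<Longrightarrow> inj (M x)"
    and sm: "\<And>u. smooth_on (\<lambda>x. M x u) S" and b: "smooth_on b S"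
    and y: "\<And>x. x \<in> S \<Longrightarrow> M x (y x) = b x"
  shows "smooth_on y S"
proof -
  have entries: "smooth_on (\<lambda>x. matrix (M x) $ i $ j) S" for i j
    unfolding matrix_def by (simp add: smooth_on_nth[OF S sm])
  have nz: "det (matrix (M x)) \<noteq> 0" if "x \<in> S" for x
    using det_nz_iff_inj[OF lin[OF that]] inj[OF that] by simp
  have "y x = (\<chi> k. det (\<chi> i j. if j = k then b x $ i else matrix (M x) $ i $ j) / det (matrix (M x)))" if
    "x \<in> S" for x
    using cramer[OF nz[OF that], of "y x" "b x"] matrix_works[of "M x"] lin[OF that, folded
      linear_matrix_vector_mul_eq] y[OF that] by simp
  moreover have "smooth_on (\<lambda>x. (\<chi> k. det (\<chi> i j. if j = k then b x $ i else matrix (M x) $ i $ j) / det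
    (matrix (M x)))) S"
  proof (rule smooth_on_vec[OF S], simp, rule smooth_on_divide[OF S])
    fix k
    show "smooth_on (\<lambda>x. det (\<chi> i j. if j = k then b x $ i else matrix (M x) $ i $ j)) S"
    proof (rule smooth_on_det[OF S])
      fix i j show "smooth_on (\<lambda>x. (\<chi> i j. if j = k then b x $ i else matrix (M x) $ i $ j) $ i $ j) S"
        by (cases "j = k") (simp_all add: entries smooth_on_nth[OF S b])
    qed
  qed (use smooth_on_det[OF S entries] nz in auto)
  ultimately show ?thesis using smooth_on_cong[OF S] by (metis (no_types, lifting))
qed

text \<open>Injectivity of an endomorphism is the nonvanishing of its determinant, an open
  condition.\<close>

lemma open_inj_set:
  fixes M :: "'b::real_normed_vector \<Rightarrow> real^'n::finite \<Rightarrow> real^'n"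
  assumes S: "open S" and lin: "\<And>x. x \<in> S \<Longrightarrow> linear (M x)"
    and sm: "\<And>u. smooth_on (\<lambda>x. M x u) S"
  shows "open {x \<in> S. inj (M x)}"
proof -
  have entries: "smooth_on (\<lambda>x. matrix (M x) $ i $ j) S" for i j
    unfolding matrix_def by (simp add: smooth_on_nth[OF S sm])
  have "continuous_on S (\<lambda>x. det (matrix (M x)))" by (rule smooth_on_continuous[OF smooth_on_det[OF S entries]])
  then have "open (S \<inter> (\<lambda>x. det (matrix (M x))) -` (- {0}))"
    using S by (intro continuous_open_preimage) auto
  moreover have "S \<inter> (\<lambda>x. det (matrix (M x))) -` (- {0}) = {x \<in> S. inj (M x)}"
    using det_nz_iff_inj[OF lin] by auto
  ultimately show ?thesis by simp
qed

lemma smooth_on_sharp: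
  assumes S: "open S" and h: "\<And>x. x \<in> S \<Longrightarrow> metric_form (g x)" and g: "\<And>u v. smooth_on (\<lambda>x. g x u v) S"
    and lin: "\<And>x. x \<in> S \<Longrightarrow> linear (\<theta> x)" and \<theta>: "\<And>u. smooth_on (\<lambda>x. \<theta> x u) S"
  shows "smooth_on (\<lambda>x. sharp g x (\<theta> x)) S"
proof (rule smooth_on_solution[OF S, where M="\<lambda>x v. \<chi> i. g x v (axis i 1)" and b = "\<lambda>x. \<chi> i. \<theta> x (axis i 1)"])
  fix x assume x: "x \<in> S"
  show "linear (\<lambda>v. \<chi> i. g x v (axis i 1))"
    by (rule linearI) (simp_all add: vec_eq_iff metric_form_simps[OF h[OF x]])
  show "inj (\<lambda>v. \<chi> i. g x v (axis i 1))"
  proof (rule injI)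
    fix u v assume "(\<chi> i. g x u (axis i 1)) = (\<chi> i. g x v (axis i 1))"
    then have a: "g x u (axis i 1) = g x v (axis i 1)" for i by (simp add: vec_eq_iff)
    have "g x u w = g x v w" for w
      by (subst (1 2) vec_expand[of w]) (simp add: metric_form_sums[OF h[OF x]] metric_form_simps[OF h[OF x]] a)
    then show "u = v" using metric_form_nondegenerate[OF h[OF x]] by blast
  qed
  show "(\<chi> i. g x (sharp g x (\<theta> x)) (axis i 1)) = (\<chi> i. \<theta> x (axis i 1))"
    using metric_sharp[of g x, OF h[OF x] lin[OF x]] by simp
qed (auto intro!: smooth_on_vec[OF S] g \<theta>)

section \<open>Tensor fields on open subsets of Euclidean space\<close>

definition mlin3 :: "('b::real_vector \<Rightarrow> 'b \<Rightarrow> 'b \<Rightarrow> 'c::real_vector) \<Rightarrow> bool" where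
  "mlin3 b \<longleftrightarrow> (\<forall>u. bilinear (b u)) \<and> (\<forall>v w. linear (\<lambda>u. b u v w))"

definition mlin4 :: "('b::real_vector \<Rightarrow> 'b \<Rightarrow> 'b \<Rightarrow> 'b \<Rightarrow> 'c::real_vector) \<Rightarrow> bool" where
  "mlin4 b \<longleftrightarrow> (\<forall>u. mlin3 (b u)) \<and> (\<forall>v w t. linear (\<lambda>u. b u v w t))"

lemma bilinear_linear:
  assumes "bilinear b"
  shows "linear (b u)" "linear (\<lambda>u. b u v)"
  using assms by (auto simp: bilinear_def)

lemma mlin3_linear:
  assumes "mlin3 b"
  shows "linear (b u v)" "linear (\<lambda>v. b u v w)" "linear (\<lambda>u. b u v w)"
  using assms by (auto simp: mlin3_def bilinear_def)

lemma mlin4_linear: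
  assumes "mlin4 b"
  shows "linear (b u v w)" "linear (\<lambda>w. b u v w t)" "linear (\<lambda>v. b u v w t)" "linear (\<lambda>u. b u v w t)"
  using assms by (auto simp: mlin4_def mlin3_linear)

lemmas linear_rules = linear_add linear_diff linear_cmul linear_neg linear_0

lemmas bilinear_simps = linear_rules[OF bilinear_linear(1)] linear_rules[OF bilinear_linear(2)]
lemmas mlin3_simps = linear_rules[OF mlin3_linear(1)] linear_rules[OF mlin3_linear(2)] linear_rules[OF
  mlin3_linear(3)]
lemmas mlin4_simps = linear_rules[OF mlin4_linear(1)] linear_rules[OF mlin4_linear(2)]
  linear_rules[OF mlin4_linear(3)] linear_rules[OF mlin4_linear(4)]

lemma bilinearI2: "(\<And>u. linear (b u)) \<Longrightarrow> (\<And>v. linear (\<lambda>u. b u v)) \<Longrightarrow> bilinear b"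
  by (auto simp: bilinear_def)

lemma mlin3I: "(\<And>u v. linear (b u v)) \<Longrightarrow> (\<And>u w. linear (\<lambda>v. b u v w)) \<Longrightarrow> (\<And>v w. linear (\<lambda>u. b u v w)) \<Longrightarrow> mlin3 b"
  by (auto simp: mlin3_def bilinear_def)

lemma mlin4I: "(\<And>u v w. linear (b u v w)) \<Longrightarrow> (\<And>u v t. linear (\<lambda>w. b u v w t)) \<Longrightarrow>
    (\<And>u w t. linear (\<lambda>v. b u v w t)) \<Longrightarrow> (\<And>v w t. linear (\<lambda>u. b u v w t)) \<Longrightarrow> mlin4 b"
  by (auto simp: mlin4_def intro: mlin3I)

text \<open>Multilinearity and smoothness only, with no condition on changes of coordinates and with
  arbitrary values, so that Christoffel symbols also count.\<close>

definition tensor2 :: "'b::real_normed_vector set \<Rightarrow> ('b \<Rightarrow> 'b \<Rightarrow> 'b \<Rightarrow> 'c::real_normed_vector) \<Rightarrow> bool" where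
  "tensor2 S b \<longleftrightarrow> (\<forall>x\<in>S. bilinear (b x)) \<and> (\<forall>u v. smooth_on (\<lambda>x. b x u v) S)"

definition tensor3 :: "'b::real_normed_vector set \<Rightarrow> ('b \<Rightarrow> 'b \<Rightarrow> 'b \<Rightarrow> 'b \<Rightarrow> 'c::real_normed_vector) \<Rightarrow> bool" where
  "tensor3 S b \<longleftrightarrow> (\<forall>x\<in>S. mlin3 (b x)) \<and> (\<forall>u v w. smooth_on (\<lambda>x. b x u v w) S)"

definition tensor4 :: "'b::real_normed_vector set \<Rightarrow> ('b \<Rightarrow> 'b \<Rightarrow> 'b \<Rightarrow> 'b \<Rightarrow> 'b \<Rightarrow> 'c::real_normed_vector) \<Rightarrow> bool" where
  "tensor4 S b \<longleftrightarrow> (\<forall>x\<in>S. mlin4 (b x)) \<and> (\<forall>u v w t. smooth_on (\<lambda>x. b x u v w t) S)"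

lemma tensor2D:
  assumes "tensor2 S b"
  shows "x \<in> S \<Longrightarrow> bilinear (b x)" "smooth_on (\<lambda>x. b x u v) S"
  using assms by (auto simp: tensor2_def)

lemma tensor3D:
  assumes "tensor3 S b"
  shows "x \<in> S \<Longrightarrow> mlin3 (b x)" "smooth_on (\<lambda>x. b x u v w) S"
  using assms by (auto simp: tensor3_def)

lemma tensor4D:
  assumes "tensor4 S b"
  shows "x \<in> S \<Longrightarrow> mlin4 (b x)" "smooth_on (\<lambda>x. b x u v w t) S"
  using assms by (auto simp: tensor4_def)

lemma tensor3_fix3: "tensor3 S b \<Longrightarrow> tensor2 S (\<lambda>x u v. b x u v w)"
  by (auto simp: tensor3_def tensor2_def mlin3_def bilinear_def)

lemma tensor4_fix4: "tensor4 S b \<Longrightarrow> tensor3 S (\<lambda>x u v w. b x u v w t)"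
  by (auto simp: tensor4_def tensor3_def mlin4_def mlin3_def bilinear_def)

lemma tensor2_differentiable:
  fixes b :: "real^'n::finite \<Rightarrow> real^'n \<Rightarrow> real^'n \<Rightarrow> 'c::real_normed_vector"
  assumes S: "open S" "x \<in> S" and b: "tensor2 S b"
    and X: "X differentiable (at x)" and Y: "Y differentiable (at x)"
  shows "(\<lambda>y. b y (X y) (Y y)) differentiable (at x)"
    "dird (\<lambda>y. b y (X y) (Y y)) x v = dird (\<lambda>y. b y (X x) (Y x)) x v + b x (dird X x v) (Y x) + b x (X x)
      (dird Y x v)"
proof -
  have l: "linear (b y u)" "linear (\<lambda>u. b y u w)" if "y \<in> S" for y u w
    using tensor2D(1)[OF b that] by (auto simp: bilinear_def)
  have c: "(\<lambda>y. b y u w) differentiable (at x)" for u w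
    by (rule smooth_on_differentiable[OF S(1) tensor2D(2)[OF b] S(2)])
  have 1: "(\<lambda>y. b y (X y) w) differentiable (at x)" for w
    by (rule slot_differentiable[OF S l(2) c X])
  show "(\<lambda>y. b y (X y) (Y y)) differentiable (at x)"
    by (rule slot_differentiable[OF S l(1) 1 Y])
  have "dird (\<lambda>y. b y (X y) (Y y)) x v = dird (\<lambda>y. b y (X y) (Y x)) x v + b x (X x) (dird Y x v)"
    by (rule slot_dird[OF S l(1) 1 Y])
  also have "dird (\<lambda>y. b y (X y) (Y x)) x v = dird (\<lambda>y. b y (X x) (Y x)) x v + b x (dird X x v) (Y x)"
    by (rule slot_dird[OF S l(2) c X])
  finally show "dird (\<lambda>y. b y (X y) (Y y)) x v = dird (\<lambda>y. b y (X x) (Y x)) x v + b x (dird X x v) (Y x) + b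
    x (X x) (dird Y x v)" .
qed

lemma tensor3_differentiable:
  fixes b :: "real^'n::finite \<Rightarrow> real^'n \<Rightarrow> real^'n \<Rightarrow> real^'n \<Rightarrow> 'c::real_normed_vector"
  assumes S: "open S" "x \<in> S" and b: "tensor3 S b"
    and X: "X differentiable (at x)" and Y: "Y differentiable (at x)" and Z: "Z differentiable (at x)"
  shows "(\<lambda>y. b y (X y) (Y y) (Z y)) differentiable (at x)"
    "dird (\<lambda>y. b y (X y) (Y y) (Z y)) x v = dird (\<lambda>y. b y (X x) (Y x) (Z x)) x v
       + b x (dird X x v) (Y x) (Z x) + b x (X x) (dird Y x v) (Z x) + b x (X x) (Y x) (dird Z x v)"
proof -
  have l: "linear (\<lambda>u. b y u w z)" if "y \<in> S" for y w z
    using tensor3D(1)[OF b that] by (rule mlin3_linear)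
  have l': "linear (b y u w)" if "y \<in> S" for y u w
    using tensor3D(1)[OF b that] by (rule mlin3_linear)
  have c: "(\<lambda>y. b y u w z) differentiable (at x)" for u w z
    by (rule smooth_on_differentiable[OF S(1) tensor3D(2)[OF b] S(2)])
  have 2: "(\<lambda>y. b y (X y) (Y y) w) differentiable (at x)" for w
  proof -
    from tensor2_differentiable(1)[OF S tensor3_fix3[OF b] X Y] show ?thesis .
  qed
  show "(\<lambda>y. b y (X y) (Y y) (Z y)) differentiable (at x)"
    by (rule slot_differentiable[OF S l' 2 Z])
  have "dird (\<lambda>y. b y (X y) (Y y) (Z y)) x v = dird (\<lambda>y. b y (X y) (Y y) (Z x)) x v + b x (X x) (Y x) (dird Z x v)"
    by (rule slot_dird[OF S l' 2 Z])
  also have "dird (\<lambda>y. b y (X y) (Y y) (Z x)) x v = dird (\<lambda>y. b y (X x) (Y x) (Z x)) x v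
       + b x (dird X x v) (Y x) (Z x) + b x (X x) (dird Y x v) (Z x)"
  proof -
    from tensor2_differentiable(2)[OF S tensor3_fix3[OF b] X Y] show ?thesis .
  qed
  finally show "dird (\<lambda>y. b y (X y) (Y y) (Z y)) x v = dird (\<lambda>y. b y (X x) (Y x) (Z x)) x v
       + b x (dird X x v) (Y x) (Z x) + b x (X x) (dird Y x v) (Z x) + b x (X x) (Y x) (dird Z x v)" .
qed

lemma tensor4_differentiable:
  fixes b :: "real^'n::finite \<Rightarrow> real^'n \<Rightarrow> real^'n \<Rightarrow> real^'n \<Rightarrow> real^'n \<Rightarrow> 'c::real_normed_vector"
  assumes S: "open S" "x \<in> S" and b: "tensor4 S b"
    and X: "X differentiable (at x)" and Y: "Y differentiable (at x)" and Z: "Z differentiable (at x)"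
    and T: "T differentiable (at x)"
  shows "(\<lambda>y. b y (X y) (Y y) (Z y) (T y)) differentiable (at x)"
    "dird (\<lambda>y. b y (X y) (Y y) (Z y) (T y)) x v = dird (\<lambda>y. b y (X x) (Y x) (Z x) (T x)) x v
       + b x (dird X x v) (Y x) (Z x) (T x) + b x (X x) (dird Y x v) (Z x) (T x)
       + b x (X x) (Y x) (dird Z x v) (T x) + b x (X x) (Y x) (Z x) (dird T x v)"
proof -
  have l': "linear (b y u w z)" if "y \<in> S" for y u w z
    using tensor4D(1)[OF b that] by (rule mlin4_linear)
  note t3 = tensor4_fix4[OF b]
  have 3: "(\<lambda>y. b y (X y) (Y y) (Z y) w) differentiable (at x)" for w
    using tensor3_differentiable(1)[OF S t3 X Y Z] .
  show "(\<lambda>y. b y (X y) (Y y) (Z y) (T y)) differentiable (at x)"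
    by (rule slot_differentiable[OF S l' 3 T])
  have "dird (\<lambda>y. b y (X y) (Y y) (Z y) (T y)) x v = dird (\<lambda>y. b y (X y) (Y y) (Z y) (T x)) x v + b x (X x)
    (Y x) (Z x) (dird T x v)"
    by (rule slot_dird[OF S l' 3 T])
  then show "dird (\<lambda>y. b y (X y) (Y y) (Z y) (T y)) x v = dird (\<lambda>y. b y (X x) (Y x) (Z x) (T x)) x v
       + b x (dird X x v) (Y x) (Z x) (T x) + b x (X x) (dird Y x v) (Z x) (T x)
       + b x (X x) (Y x) (dird Z x v) (T x) + b x (X x) (Y x) (Z x) (dird T x v)"
    using tensor3_differentiable(2)[OF S t3 X Y Z] by simp
qed

lemma tensor2_vec_linear_dird:
  assumes "open S" "x \<in> S" "tensor2 S b"
  shows "mlin3 (\<lambda>v u w. dird (\<lambda>y. b y u w) x v)"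
proof (rule mlin3I)
  have l: "linear (b y u)" "linear (\<lambda>u. b y u w)" if "y \<in> S" for y u w
    using tensor2D(1)[OF assms(3) that] by (auto simp: bilinear_def)
  have c: "(\<lambda>y. b y u w) differentiable (at x)" for u w
    by (rule smooth_on_differentiable[OF assms(1) tensor2D(2)[OF assms(3)] assms(2)])
  show "linear (\<lambda>w. dird (\<lambda>y. b y u w) x v)" for u v by (rule dird_linear_param[OF assms(1,2) l(1) c])
  show "linear (\<lambda>u. dird (\<lambda>y. b y u w) x v)" for w v by (rule dird_linear_param[OF assms(1,2) l(2) c])
  show "linear (\<lambda>v. dird (\<lambda>y. b y u w) x v)" for u w by (rule linear_dird[OF c, unfolded eta_contract_eq])
qed

section \<open>Riemannian geometry in one coordinate system\<close>

text \<open>The covariant derivative of constant fields, by the Koszul formula, whose bracket terms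
  vanish for them.\<close>

definition christoffel :: "(real^'n::finite \<Rightarrow> 'n form2) \<Rightarrow> real^'n \<Rightarrow> real^'n \<Rightarrow> real^'n \<Rightarrow> real^'n" where
  "christoffel G x u v = sharp G x (\<lambda>w. (dird (\<lambda>y. G y v w) x u + dird (\<lambda>y. G y u w) x v - dird (\<lambda>y. G y u
    v) x w) / 2)"

text \<open>The commutator of covariant derivatives on constant fields, for which the bracket term
  is absent.\<close>

definition lcurv :: "(real^'n::finite \<Rightarrow> 'n form2) \<Rightarrow> real^'n \<Rightarrow> real^'n \<Rightarrow> real^'n \<Rightarrow> real^'n \<Rightarrow> real^'n" where
  "lcurv G x u v w = dird (\<lambda>y. christoffel G y v w) x u - dird (\<lambda>y. christoffel G y u w) x v
     + christoffel G x u (christoffel G x v w) - christoffel G x v (christoffel G x u w)"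

definition lRiem :: "(real^'n::finite \<Rightarrow> 'n form2) \<Rightarrow> real^'n \<Rightarrow> real^'n \<Rightarrow> real^'n \<Rightarrow> real^'n \<Rightarrow> real^'n \<Rightarrow> real" where
  "lRiem G x u v w t = G x (lcurv G x u v w) t"

definition lRic :: "(real^'n::finite \<Rightarrow> 'n form2) \<Rightarrow> real^'n \<Rightarrow> 'n form2" where
  "lRic G x u v = (\<Sum>j\<in>UNIV. lRiem G x (onb G x j) u v (onb G x j))"

definition lscal :: "(real^'n::finite \<Rightarrow> 'n form2) \<Rightarrow> real^'n \<Rightarrow> real" where
  "lscal G x = (\<Sum>j\<in>UNIV. lRic G x (onb G x j) (onb G x j))"

definition lschouten :: "(real^'n::finite \<Rightarrow> 'n form2) \<Rightarrow> real^'n \<Rightarrow> 'n form2" where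
  "lschouten G x u v = 1 / (real CARD('n) - 2) *
     (lRic G x u v - 1 / (2 * (real CARD('n) - 1)) * lscal G x * G x u v)"

definition lweyl :: "(real^'n::finite \<Rightarrow> 'n form2) \<Rightarrow> real^'n \<Rightarrow> real^'n \<Rightarrow> real^'n \<Rightarrow> real^'n \<Rightarrow> real^'n \<Rightarrow> real" where
  "lweyl G x u v w t = lRiem G x u v w t - kulkarni_nomizu G (lschouten G) x u v w t"

definition lcov2 :: "(real^'n::finite \<Rightarrow> 'n form2) \<Rightarrow> (real^'n \<Rightarrow> 'n form2) \<Rightarrow> real^'n \<Rightarrow> real^'n \<Rightarrow> 'n form2" where
  "lcov2 G b x v u w = dird (\<lambda>y. b y u w) x v - b x (christoffel G x v u) w - b x u (christoffel G x v w)"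

definition lcov3 :: "(real^'n::finite \<Rightarrow> 'n form2) \<Rightarrow> (real^'n \<Rightarrow> real^'n \<Rightarrow> 'n form2) \<Rightarrow> real^'n \<Rightarrow> real^'n \<Rightarrow>
  real^'n \<Rightarrow> 'n form2" where
  "lcov3 G b x v u w z = dird (\<lambda>y. b y u w z) x v - b x (christoffel G x v u) w z
     - b x u (christoffel G x v w) z - b x u w (christoffel G x v z)"

definition lcov4 :: "(real^'n::finite \<Rightarrow> 'n form2) \<Rightarrow> (real^'n \<Rightarrow> real^'n \<Rightarrow> real^'n \<Rightarrow> 'n form2) \<Rightarrow>
    real^'n \<Rightarrow> real^'n \<Rightarrow> real^'n \<Rightarrow> real^'n \<Rightarrow> 'n form2" where
  "lcov4 G b x v u w z t = dird (\<lambda>y. b y u w z t) x v - b x (christoffel G x v u) w z t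
     - b x u (christoffel G x v w) z t - b x u w (christoffel G x v z) t - b x u w z (christoffel G x v t)"

definition ldelta4 :: "(real^'n::finite \<Rightarrow> 'n form2) \<Rightarrow> (real^'n \<Rightarrow> real^'n \<Rightarrow> real^'n \<Rightarrow> 'n form2) \<Rightarrow>
    real^'n \<Rightarrow> real^'n \<Rightarrow> 'n form2" where
  "ldelta4 G b x u v w = (\<Sum>j\<in>UNIV. lcov4 G b x (onb G x j) u v w (onb G x j))"

definition ldelta1 :: "(real^'n::finite \<Rightarrow> 'n form2) \<Rightarrow> (real^'n \<Rightarrow> real^'n \<Rightarrow> 'n form2) \<Rightarrow> real^'n \<Rightarrow> 'n form2" where
  "ldelta1 G b x u v = (\<Sum>j\<in>UNIV. lcov3 G b x (onb G x j) (onb G x j) u v)"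

locale local_metric =
  fixes S :: "(real^'n::finite) set" and G :: "real^'n \<Rightarrow> 'n form2"
  assumes open_S: "open S" and metric: "\<And>x. x \<in> S \<Longrightarrow> metric_form (G x)"
    and smooth_metric: "\<And>u v. smooth_on (\<lambda>x. G x u v) S"
begin

lemma tensor2_metric: "tensor2 S G"
  using metric smooth_metric by (auto simp: tensor2_def metric_form_def)

lemma metric_sym: "x \<in> S \<Longrightarrow> G x u v = G x v u"
  using metric metric_form_sym by blast

lemmas G_simps = metric_form_simps[OF metric]

lemma onb_at: "x \<in> S \<Longrightarrow> is_onb (G x) (onb G x)"
  using is_onb_onb[of G x] metric by blast

lemma dird_metric_mlin3: "x \<in> S \<Longrightarrow> mlin3 (\<lambda>v u w. dird (\<lambda>y. G y u w) x v)"
  by (rule tensor2_vec_linear_dird[OF open_S _ tensor2_metric])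

lemmas dG_simps = mlin3_simps[OF dird_metric_mlin3]

lemma dird_metric_sym: "x \<in> S \<Longrightarrow> dird (\<lambda>y. G y u w) x v = dird (\<lambda>y. G y w u) x v"
  by (rule fun_cong[OF dird_cong_open[OF open_S]]) (auto simp: metric_sym)

lemma christoffel_form_linear:
  assumes "x \<in> S"
  shows "linear (\<lambda>w. (dird (\<lambda>y. G y v w) x u + dird (\<lambda>y. G y u w) x v - dird (\<lambda>y. G y u v) x w) / 2)"
  by (rule linearI) (simp_all add: dG_simps[OF assms] field_simps)

lemma metric_christoffel:
  assumes "x \<in> S"
  shows "G x (christoffel G x u v) w = (dird (\<lambda>y. G y v w) x u + dird (\<lambda>y. G y u w) x v - dird (\<lambda>y. G y u v)
    x w) / 2"
  unfolding christoffel_def by (rule metric_sharp[of G x, OF metric[OF assms] christoffel_form_linear[OF assms]])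

lemma christoffel_eqI:
  assumes "x \<in> S" "\<And>w. G x z w = (dird (\<lambda>y. G y v w) x u + dird (\<lambda>y. G y u w) x v - dird (\<lambda>y. G y u v) x w) / 2"
  shows "christoffel G x u v = z"
  unfolding christoffel_def by (rule sharp_eqI[of G x, OF metric[OF assms(1)] assms(2)])

lemma bilinear_christoffel: "x \<in> S \<Longrightarrow> bilinear (christoffel G x)"
  by (rule bilinearI2; rule linearI; rule christoffel_eqI; (assumption)?)
     (simp_all add: G_simps metric_christoffel dG_simps field_simps)

lemmas chr_simps = bilinear_simps[OF bilinear_christoffel]

lemma christoffel_sym: "x \<in> S \<Longrightarrow> christoffel G x u v = christoffel G x v u"
  by (rule christoffel_eqI) (simp_all add: metric_christoffel dird_metric_sym[of _ u v])

lemma tensor2_christoffel: "tensor2 S (christoffel G)"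
proof -
  have "smooth_on (\<lambda>x. christoffel G x u v) S" for u v
    unfolding christoffel_def
    by (rule smooth_on_sharp[OF open_S metric smooth_metric])
      (auto intro!: christoffel_form_linear smooth_on_divide smooth_on_diff smooth_on_add smooth_on_dird
        smooth_metric smooth_on_const open_S)
  then show ?thesis using bilinear_christoffel by (simp add: tensor2_def)
qed

lemmas smooth_christoffel = tensor2D(2)[OF tensor2_christoffel]

lemma metric_compat:
  assumes "x \<in> S"
  shows "dird (\<lambda>y. G y v w) x u = G x (christoffel G x u v) w + G x v (christoffel G x u w)"
  unfolding metric_sym[OF assms, of v] metric_christoffel[OF assms]
  by (simp add: dird_metric_sym[OF assms, of _ w] dird_metric_sym[OF assms, of u v] field_simps)

lemma smooth_diff: "smooth_on F S \<Longrightarrow> x \<in> S \<Longrightarrow> F differentiable (at x)"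
  by (rule smooth_on_differentiable[OF open_S])

lemma dird_christoffel_mlin3: "x \<in> S \<Longrightarrow> mlin3 (\<lambda>v u w. dird (\<lambda>y. christoffel G y u w) x v)"
  by (rule tensor2_vec_linear_dird[OF open_S _ tensor2_christoffel])

lemmas dchr_simps = mlin3_simps[OF dird_christoffel_mlin3]

lemma dird_christoffel_sym: "x \<in> S \<Longrightarrow> dird (\<lambda>y. christoffel G y u w) x v = dird (\<lambda>y. christoffel G y w u) x v"
  by (rule fun_cong[OF dird_cong_open[OF open_S]]) (auto simp: christoffel_sym)

lemma mlin3_lcurv:
  assumes "x \<in> S"
  shows "mlin3 (lcurv G x)"
  by (rule mlin3I; rule linearI)
    (simp_all add: lcurv_def chr_simps[OF assms] dchr_simps[OF assms] algebra_simps)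

lemmas lcurv_simps = mlin3_simps[OF mlin3_lcurv]

lemma smooth_christoffel2: "smooth_on (\<lambda>y. christoffel G y u (christoffel G y v w)) S"
  by (rule slot_smooth[OF open_S bilinear_linear(1)[OF bilinear_christoffel] smooth_christoffel
    smooth_christoffel])

lemma tensor3_lcurv: "tensor3 S (lcurv G)"
  unfolding tensor3_def
  by (auto simp: mlin3_lcurv) (auto simp: lcurv_def intro!: smooth_on_diff smooth_on_add open_S
    smooth_on_dird smooth_christoffel smooth_christoffel2)

lemma mlin4_lRiem: "x \<in> S \<Longrightarrow> mlin4 (lRiem G x)"
  by (rule mlin4I; rule linearI) (simp_all add: lRiem_def lcurv_simps G_simps)

lemma tensor4_lRiem: "tensor4 S (lRiem G)"
proof -
  have "smooth_on (\<lambda>y. G y (lcurv G y u v w) t) S" for u v w t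
    by (rule slot_smooth[OF open_S metric_form_linear(2)[OF metric] smooth_metric tensor3D(2)[OF tensor3_lcurv]])
  then show ?thesis unfolding tensor4_def by (auto simp: mlin4_lRiem lRiem_def)
qed

lemma lcurv_antisym: "lcurv G x u v w = - lcurv G x v u w"
  by (simp add: lcurv_def)

lemma lcurv_bianchi: "x \<in> S \<Longrightarrow> lcurv G x u v w + lcurv G x v w u + lcurv G x w u v = 0"
  by (simp add: lcurv_def dird_christoffel_sym[of x u v] dird_christoffel_sym[of x u w]
    dird_christoffel_sym[of x v w]
      christoffel_sym[of x u v] christoffel_sym[of x u w] christoffel_sym[of x v w])

text \<open>The second derivatives of G(w, t) along u and v commute. Expanded by metric
  compatibility, their difference is G(R(u, v) w, t) + G(w, R(u, v) t).\<close>

lemma lRiem_antisym34: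
  assumes x: "x \<in> S"
  shows "lRiem G x u v w t = - lRiem G x u v t w"
proof -
  have d2: "dird (\<lambda>y. dird (\<lambda>z. G z w t) y v) x u =
      G x (christoffel G x u (christoffel G x v w)) t + G x (christoffel G x v w) (christoffel G x u t)
      + G x (dird (\<lambda>y. christoffel G y v w) x u) t
      + (G x (christoffel G x u w) (christoffel G x v t) + G x w (christoffel G x u (christoffel G x v t))
      + G x w (dird (\<lambda>y. christoffel G y v t) x u))" for u v
  proof -
    have "dird (\<lambda>y. dird (\<lambda>z. G z w t) y v) x u =
      dird (\<lambda>y. G y (christoffel G y v w) t + G y w (christoffel G y v t)) x u"
      by (rule fun_cong[OF dird_cong_open[OF open_S x]]) (simp add: metric_compat)
    also have "\<dots> = dird (\<lambda>y. G y (christoffel G y v w) t) x u + dird (\<lambda>y. G y w (christoffel G y v t)) x u"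
      by (intro dird_add tensor2_differentiable(1)[OF open_S x tensor2_metric] smooth_diff
        smooth_christoffel x differentiable_const)
    also have "dird (\<lambda>y. G y (christoffel G y v w) t) x u = dird (\<lambda>y. G y (christoffel G x v w) t) x u + G x
      (dird (\<lambda>y. christoffel G y v w) x u) t"
      using tensor2_differentiable(2)[OF open_S x tensor2_metric smooth_diff[OF smooth_christoffel x], of "\<lambda>_. t"]
      by (simp add: dird_const G_simps[OF x])
    also have "dird (\<lambda>y. G y w (christoffel G y v t)) x u = dird (\<lambda>y. G y w (christoffel G x v t)) x u + G x
      w (dird (\<lambda>y. christoffel G y v t) x u)"
      using tensor2_differentiable(2)[OF open_S x tensor2_metric _ smooth_diff[OF smooth_christoffel x], of
        "\<lambda>_. w"]
      by (simp add: dird_const G_simps[OF x])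
    finally show ?thesis by (simp add: metric_compat[OF x])
  qed
  have "dird (\<lambda>y. dird (\<lambda>z. G z w t) y v) x u = dird (\<lambda>y. dird (\<lambda>z. G z w t) y u) x v"
    by (rule dird_commute_real[OF open_S smooth_metric x])
  then show ?thesis unfolding d2 lRiem_def lcurv_def metric_sym[OF x, of w]
    by (simp add: G_simps[OF x] metric_sym[OF x, of "christoffel G x v w"] metric_sym[OF x, of "christoffel
      G x u w"])
qed

end

section \<open>Algebraic curvature tensors\<close>

text \<open>A property at a single point, so that it applies alike to the curvature, to the Weyl
  tensor and to their covariant derivatives in a fixed direction.\<close>

definition curvlike :: "(real^'n::finite \<Rightarrow> real^'n \<Rightarrow> 'n form2) \<Rightarrow> bool" where
  "curvlike K \<longleftrightarrow> mlin4 K \<and> (\<forall>u v w t. K u v w t = - K v u w t) \<and> (\<forall>u v w t. K u v w t = - K u v t w) \<and>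
     (\<forall>u v w t. K u v w t + K v w u t + K w u v t = 0)"

lemma curvlikeD:
  assumes "curvlike K"
  shows "mlin4 K" "K u v w t = - K v u w t" "K u v w t = - K u v t w" "K u v w t + K v w u t + K w u v t = 0"
  using assms unfolding curvlike_def by blast+

text \<open>The four cyclic identities in which u, v, w and t take turns in the last slot are
  combined; the remaining facts only bring the slots into a common order for linear
  arithmetic.\<close>

lemma curvlike_pair:
  assumes K: "curvlike K"
  shows "K u v w t = K w t u v"
  using curvlikeD(4)[OF K, of u v w t] curvlikeD(4)[OF K, of v w t u] curvlikeD(4)[OF K, of w t u v]
    curvlikeD(4)[OF K, of t u v w]
    curvlikeD(2)[OF K, of u v w t] curvlikeD(3)[OF K, of v w u t] curvlikeD(3)[OF K, of w u v t]
    curvlikeD(2)[OF K, of w t v u] curvlikeD(3)[OF K, of t v w u] curvlikeD(2)[OF K, of v t w u]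
      curvlikeD(3)[OF K, of v t u w]
    curvlikeD(3)[OF K, of w t u v] curvlikeD(2)[OF K, of t u w v] curvlikeD(3)[OF K, of u t v w]
      curvlikeD(3)[OF K, of u w t v]
    curvlikeD(2)[OF K, of t v u w] curvlikeD(3)[OF K, of u v t w] curvlikeD(2)[OF K, of u w v t]
      curvlikeD(3)[OF K, of t u v w]
    curvlikeD(3)[OF K, of v t w u]
  by linarith

lemma curvlike_diff:
  assumes K: "curvlike K" and L: "curvlike L"
  shows "curvlike (\<lambda>u v w t. K u v w t - L u v w t)"
  unfolding curvlike_def
proof (intro conjI allI)
  show "mlin4 (\<lambda>u v w t. K u v w t - L u v w t)"
    by (rule mlin4I; rule linearI;
        simp add: mlin4_simps[OF curvlikeD(1)[OF K]] mlin4_simps[OF curvlikeD(1)[OF L]] algebra_simps)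
  fix u v w t
  show "K u v w t - L u v w t = - (K v u w t - L v u w t)"
    using curvlikeD(2)[OF K, of u v w t] curvlikeD(2)[OF L, of u v w t] by simp
  show "K u v w t - L u v w t = - (K u v t w - L u v t w)"
    using curvlikeD(3)[OF K, of u v w t] curvlikeD(3)[OF L, of u v w t] by simp
  show "K u v w t - L u v w t + (K v w u t - L v w u t) + (K w u v t - L w u v t) = 0"
    using curvlikeD(4)[OF K, of u v w t] curvlikeD(4)[OF L, of u v w t] by simp
qed

lemma curvlike_kulkarni_nomizu:
  assumes g: "bilinear (g p)" "\<And>u v. g p u v = g p v u" and h: "bilinear (h p)" "\<And>u v. h p u v = h p v u"
  shows "curvlike (kulkarni_nomizu g h p)"
  unfolding curvlike_def kulkarni_nomizu_def
proof (intro conjI allI)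
  show "mlin4 (\<lambda>x y z t. g p x t * h p y z + g p y z * h p x t - g p x z * h p y t - g p y t * h p x z)"
    by (rule mlin4I; rule linearI; simp add: bilinear_simps[OF g(1)] bilinear_simps[OF h(1)] algebra_simps)
qed (simp_all add: g(2) h(2) algebra_simps)

context local_metric
begin

lemma curvlike_lRiem: 
  assumes x: "x \<in> S"
  shows "curvlike (lRiem G x)"
  unfolding curvlike_def
proof (intro conjI allI mlin4_lRiem[OF x] lRiem_antisym34[OF x])
  fix u v w t
  show "lRiem G x u v w t = - lRiem G x v u w t"
    unfolding lRiem_def by (subst lcurv_antisym) (simp add: G_simps[OF x])
  show "lRiem G x u v w t + lRiem G x v w u t + lRiem G x w u v t = 0"
    unfolding lRiem_def G_simps(2)[OF x, symmetric] lcurv_bianchi[OF x] by (simp add: G_simps[OF x])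
qed

lemma dird_lcurv:
  assumes x: "x \<in> S"
  shows "dird (\<lambda>y. lcurv G y v w z) x u =
    dird (\<lambda>y. dird (\<lambda>q. christoffel G q w z) y v) x u - dird (\<lambda>y. dird (\<lambda>q. christoffel G q v z) y w) x u
    + (dird (\<lambda>y. christoffel G y v (christoffel G x w z)) x u + christoffel G x v (dird (\<lambda>y. christoffel G y
      w z) x u))
    - (dird (\<lambda>y. christoffel G y w (christoffel G x v z)) x u + christoffel G x w (dird (\<lambda>y. christoffel G y
      v z) x u))"
proof -
  have s: "dird (\<lambda>y. christoffel G y a (christoffel G y b z)) x u =
     dird (\<lambda>y. christoffel G y a (christoffel G x b z)) x u + christoffel G x a (dird (\<lambda>y. christoffel G y b
       z) x u)" for a b
    by (rule slot_dird[OF open_S x bilinear_linear(1)[OF bilinear_christoffel] smooth_diff[OF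
      smooth_christoffel x] smooth_diff[OF smooth_christoffel x]])
  have d: "(\<lambda>y. dird (\<lambda>q. christoffel G q a z) y b) differentiable (at x)"
    "(\<lambda>y. christoffel G y a (christoffel G y b z)) differentiable (at x)" for a b
    by (intro smooth_diff[OF _ x] smooth_on_dird smooth_christoffel smooth_christoffel2)+
  show ?thesis unfolding lcurv_def s[symmetric]
    by (simp add: dird_diff dird_add differentiable_diff differentiable_add d)
qed

text \<open>The metric is parallel, so the derivative passes to the curvature operator. Derivatives
  of the metric thereby disappear before the second Bianchi identity is attacked.\<close>

lemma lcov4_lRiem:
  assumes x: "x \<in> S"
  shows "lcov4 G (lRiem G) x u v w z t = G x (dird (\<lambda>y. lcurv G y v w z) x u + christoffel G x u (lcurv G x v w z)
     - lcurv G x (christoffel G x u v) w z - lcurv G x v (christoffel G x u w) z - lcurv G x v w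
       (christoffel G x u z)) t"
proof -
  have "dird (\<lambda>y. G y (lcurv G y v w z) t) x u = dird (\<lambda>y. G y (lcurv G x v w z) t) x u + G x (dird (\<lambda>y.
    lcurv G y v w z) x u) t"
    using tensor2_differentiable(2)[OF open_S x tensor2_metric smooth_diff[OF tensor3D(2)[OF tensor3_lcurv]
      x], of "\<lambda>_. t"]
      by (simp add: dird_const G_simps[OF x])
  then show ?thesis unfolding lcov4_def lRiem_def by (simp add: metric_compat[OF x] G_simps[OF x])
qed

text \<open>The terms with derivatives of the curvature form a Jacobi identity,
  and those with \<open>\<nabla>\<^sub>u v\<close> cancel because the connection is torsion-free.\<close>

lemma second_bianchi:
  assumes x: "x \<in> S"
  shows "lcov4 G (lRiem G) x u v w z t + lcov4 G (lRiem G) x v w u z t + lcov4 G (lRiem G) x w u v z t = 0"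
proof -
  note as = lcurv_antisym[of x w "christoffel G x u v" z] lcurv_antisym[of x u "christoffel G x v w" z]
    lcurv_antisym[of x v "christoffel G x w u" z]
  note sy = christoffel_sym[OF x, of v u] christoffel_sym[OF x, of w v] christoffel_sym[OF x, of u w]
  have dd: "dird (\<lambda>y. dird (\<lambda>q. christoffel G q c z) y a) x b = dird (\<lambda>y. dird (\<lambda>q. christoffel G q c z) y
    b) x a" for a b c
    by (rule dird_commute[OF open_S smooth_christoffel x])
  let ?A = "(dird (\<lambda>y. lcurv G y v w z) x u + christoffel G x u (lcurv G x v w z) - lcurv G x v w
    (christoffel G x u z))
      + (dird (\<lambda>y. lcurv G y w u z) x v + christoffel G x v (lcurv G x w u z) - lcurv G x w u (christoffel G
        x v z))
      + (dird (\<lambda>y. lcurv G y u v z) x w + christoffel G x w (lcurv G x u v z) - lcurv G x u v (christoffel G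
        x w z))"
  let ?B = "lcurv G x (christoffel G x u v) w z + lcurv G x v (christoffel G x u w) z
      + (lcurv G x (christoffel G x v w) u z + lcurv G x w (christoffel G x v u) z)
      + (lcurv G x (christoffel G x w u) v z + lcurv G x u (christoffel G x w v) z)"
  have "?A = 0"
    unfolding dird_lcurv[OF x] dd[where a=v and b=u] dd[where a=w and b=u] dd[where a=w and b=v] by (simp
      add: lcurv_def chr_simps[OF x])
  moreover have "?B = 0"
    unfolding sy as by simp
  ultimately have "(dird (\<lambda>y. lcurv G y v w z) x u + christoffel G x u (lcurv G x v w z)
     - lcurv G x (christoffel G x u v) w z - lcurv G x v (christoffel G x u w) z - lcurv G x v w
       (christoffel G x u z))
     + (dird (\<lambda>y. lcurv G y w u z) x v + christoffel G x v (lcurv G x w u z)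
     - lcurv G x (christoffel G x v w) u z - lcurv G x w (christoffel G x v u) z - lcurv G x w u
       (christoffel G x v z))
     + (dird (\<lambda>y. lcurv G y u v z) x w + christoffel G x w (lcurv G x u v z)
     - lcurv G x (christoffel G x w u) v z - lcurv G x u (christoffel G x w v) z - lcurv G x u v
       (christoffel G x w z)) = 0"
    (is "?L = 0")
  proof -
    assume "?A = 0" "?B = 0"
    then have "?A - ?B = 0" by (simp only: diff_self)
    moreover have "?A - ?B = ?L" by (simp only: algebra_simps)
    ultimately show "?L = 0" by (rule subst[rotated])
  qed
  then have "G x ?L t = 0" using G_simps(10)[OF x] by metis
  then show ?thesis unfolding lcov4_lRiem[OF x] by (simp only: G_simps(2)[OF x])
qed

end

section \<open>Contractions and their derivatives\<close>

lemma tensor4_fix23: "tensor4 S b \<Longrightarrow> tensor2 S (\<lambda>x p q. b x p u v q)"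
  by (auto simp: tensor4_def tensor2_def mlin4_def mlin3_def bilinear_def)

lemma onb_trace_commute:
  fixes e :: "'n::finite \<Rightarrow> real^'n"
  assumes h: "metric_form h" and e: "is_onb h e" and A: "linear A" and B: "linear B"
  shows "(\<Sum>j\<in>UNIV. h (A (B (e j))) (e j)) = (\<Sum>j\<in>UNIV. h (B (A (e j))) (e j))"
proof -
  have "trace (matrix (A \<circ> B)) = trace (matrix (B \<circ> A))"
    using matrix_compose[OF B A] matrix_compose[OF A B] trace_mul_sym by metis
  then show ?thesis
    using trace_eq_onb_sum[OF h e linear_compose[OF B A]] trace_eq_onb_sum[OF h e linear_compose[OF A B]] by simp
qed

context local_metric
begin

lemma onb_contract:
  fixes f :: "real^'n \<Rightarrow> real"
  assumes "x \<in> S" "linear f"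
  shows "(\<Sum>j\<in>UNIV. G x v (onb G x j) * f (onb G x j)) = f v"
    "(\<Sum>j\<in>UNIV. G x (onb G x j) v * f (onb G x j)) = f v"
    "(\<Sum>j\<in>UNIV. f (onb G x j) * G x v (onb G x j)) = f v"
    "(\<Sum>j\<in>UNIV. f (onb G x j) * G x (onb G x j) v) = f v"
  using onb_sum_real[OF metric onb_at assms(2)] assms(1) by auto

lemma trace_endomorphism:
  assumes b: "tensor2 S b"
  shows "tensor2 S (\<lambda>x u w. G x (sharp G x (b x u)) w)"
    "x \<in> S \<Longrightarrow> linear (\<lambda>u. sharp G x (b x u))"
    "smooth_on (\<lambda>x. sharp G x (b x u)) S"
    "x \<in> S \<Longrightarrow> G x (sharp G x (b x u)) w = b x u w"
proof -
  have l: "linear (b x u)" "linear (\<lambda>u. b x u w)" if "x \<in> S" for x u w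
    using tensor2D(1)[OF b that] by (auto simp: bilinear_def)
  show s: "G x (sharp G x (b x u)) w = b x u w" if "x \<in> S" for x u w
    by (rule metric_sharp[of G x, OF metric[OF that] l(1)[OF that]])
  show "x \<in> S \<Longrightarrow> linear (\<lambda>u. sharp G x (b x u))"
    using linear_sharp[of G x "b x", OF metric l] .
  show "smooth_on (\<lambda>x. sharp G x (b x u)) S"
    by (rule smooth_on_sharp[OF open_S metric smooth_metric l(1) tensor2D(2)[OF b]])
  have "smooth_on (\<lambda>x. G x (sharp G x (b x u)) w) S \<longleftrightarrow> smooth_on (\<lambda>x. b x u w) S" for u w
    by (rule smooth_on_cong[OF open_S s])
  moreover have "G x (sharp G x (b x u)) = b x u" if "x \<in> S" for x u using s[OF that] by auto
  ultimately show "tensor2 S (\<lambda>x u w. G x (sharp G x (b x u)) w)"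
    using b by (simp add: tensor2_def)
qed

text \<open>On the right the basis is constant in x. This is the form in which a contraction can be
  differentiated, as \<open>onb G x\<close> is an arbitrary choice at each point.\<close>

lemma onb_trace_eq:
  fixes b :: "real^'n \<Rightarrow> 'n form2"
  assumes b: "tensor2 S b" and x: "x \<in> S"
  shows "(\<Sum>j\<in>UNIV. b x (onb G x j) (onb G x j)) = (\<Sum>a\<in>UNIV. sharp G x (b x (axis a 1)) $ a)"
proof -
  have l: "linear (b x u)" "linear (\<lambda>u. b x u w)" for u w
    using tensor2D(1)[OF b x] by (auto simp: bilinear_def)
  show ?thesis
    using onb_sum_eq_trace[of G x, OF metric[OF x] onb_at[OF x], of "b x", OF l] by (simp add: trace_def
      matrix_def)
qed

lemma smooth_onb_trace:
  fixes b :: "real^'n \<Rightarrow> 'n form2"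
  assumes b: "tensor2 S b"
  shows "smooth_on (\<lambda>x. \<Sum>j\<in>UNIV. b x (onb G x j) (onb G x j)) S"
proof -
  have "smooth_on (\<lambda>x. \<Sum>a\<in>UNIV. sharp G x (b x (axis a 1)) $ a) S"
    by (intro smooth_on_sum open_S smooth_on_nth trace_endomorphism(3)[OF b])
  then show ?thesis
    using smooth_on_cong[OF open_S, of "\<lambda>x. \<Sum>j\<in>UNIV. b x (onb G x j) (onb G x j)", OF onb_trace_eq[OF b]] by blast
qed

text \<open>In terms of the endomorphism associated with \<open>b\<close>, the two terms with Christoffel symbols form
  the trace of a commutator.\<close>

lemma dird_onb_trace:
  fixes b :: "real^'n \<Rightarrow> 'n form2"
  assumes b: "tensor2 S b" and x: "x \<in> S"
  shows "dird (\<lambda>y. \<Sum>j\<in>UNIV. b y (onb G y j) (onb G y j)) x v = (\<Sum>j\<in>UNIV. lcov2 G b x v (onb G x j) (onb G x j))"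
proof -
  define L where "L = (\<lambda>y u. sharp G y (b y u))"
  define D where "D = (\<lambda>u. dird (\<lambda>y. L y u) x v)"
  define A where "A = christoffel G x v"
  let ?e = "onb G x"
  have L2: "linear (L y)" if "y \<in> S" for y
    unfolding L_def by (rule trace_endomorphism(2)[OF b that])
  have L4: "G y (L y u) w = b y u w" if "y \<in> S" for y u w
    unfolding L_def by (rule trace_endomorphism(4)[OF b that])
  have L3: "smooth_on (\<lambda>y. L y u) S" for u
    unfolding L_def by (rule trace_endomorphism(3)[OF b])
  have Ld: "(\<lambda>y. L y u) differentiable (at x)" for u
    by (rule smooth_diff[OF L3 x])
  have lD: "linear D" unfolding D_def
    by (rule dird_linear_param[OF open_S x L2 Ld])
  have lA: "linear A" unfolding A_def by (rule bilinear_linear(1)[OF bilinear_christoffel[OF x]])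
  have "dird (\<lambda>y. \<Sum>j\<in>UNIV. b y (onb G y j) (onb G y j)) x v = dird (\<lambda>y. \<Sum>a\<in>UNIV. L y (axis a 1) $ a) x v"
    unfolding L_def by (rule fun_cong[OF dird_cong_open[OF open_S x onb_trace_eq[OF b]]])
  also have "\<dots> = (\<Sum>a\<in>UNIV. D (axis a 1) $ a)"
    unfolding D_def by (subst dird_sum) (auto simp: dird_nth Ld intro: smooth_diff[OF smooth_on_nth[OF
      open_S L3] x])
  also have "\<dots> = (\<Sum>j\<in>UNIV. G x (D (?e j)) (?e j))"
    using trace_eq_onb_sum[OF metric[OF x] onb_at[OF x] lD] by (simp add: trace_def matrix_def)
  also have "\<dots> = (\<Sum>j\<in>UNIV. lcov2 G b x v (?e j) (?e j) + (G x (L x (A (?e j))) (?e j) - G x (A (L x (?e j)))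
    (?e j)))"
  proof (rule sum.cong)
    fix j
    have "dird (\<lambda>y. b y (?e j) (?e j)) x v = dird (\<lambda>y. G y (L y (?e j)) (?e j)) x v"
      by (rule fun_cong[OF dird_cong_open[OF open_S x]]) (simp add: L4)
    also have "\<dots> = dird (\<lambda>y. G y (L x (?e j)) (?e j)) x v + G x (D (?e j)) (?e j)"
      using tensor2_differentiable(2)[OF open_S x tensor2_metric Ld[of "?e j"], of "\<lambda>_. ?e j" v] x
      by (simp add: dird_const G_simps D_def)
    also have "dird (\<lambda>y. G y (L x (?e j)) (?e j)) x v = G x (A (L x (?e j))) (?e j) + G x (L x (?e j)) (A (?e j))"
      unfolding A_def by (rule metric_compat[OF x])
    finally show "G x (D (?e j)) (?e j) = lcov2 G b x v (?e j) (?e j) + (G x (L x (A (?e j))) (?e j) - G x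
      (A (L x (?e j))) (?e j))"
      unfolding lcov2_def L4[OF x] A_def by simp
  qed simp
  also have "\<dots> = (\<Sum>j\<in>UNIV. lcov2 G b x v (?e j) (?e j))"
    using onb_trace_commute[OF metric[OF x] onb_at[OF x] L2[OF x] lA] by (simp add: sum.distrib sum_subtractf)
  finally show ?thesis .
qed

lemma mlin3_lcov2:
  assumes b: "tensor2 S b" and x: "x \<in> S"
  shows "mlin3 (lcov2 G b x)"
  by (rule mlin3I; rule linearI; simp add: lcov2_def mlin3_simps[OF tensor2_vec_linear_dird[OF open_S x b]]
      bilinear_simps[OF tensor2D(1)[OF b x]] chr_simps[OF x] algebra_simps)

lemma tensor4_dird_linear:
  fixes b :: "real^'n \<Rightarrow> real^'n \<Rightarrow> real^'n \<Rightarrow> 'n form2"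
  assumes b: "tensor4 S b" and x: "x \<in> S"
  shows "mlin4 (\<lambda>u w z t. dird (\<lambda>y. b y u w z t) x v)" "linear (\<lambda>v. dird (\<lambda>y. b y u w z t) x v)"
proof -
  have c: "(\<lambda>y. b y u w z t) differentiable (at x)" for u w z t
    by (rule smooth_diff[OF tensor4D(2)[OF b] x])
  show "linear (\<lambda>v. dird (\<lambda>y. b y u w z t) x v)" by (rule linear_dird[OF c, unfolded eta_contract_eq])
  show "mlin4 (\<lambda>u w z t. dird (\<lambda>y. b y u w z t) x v)"
    by (rule mlin4I; rule dird_linear_param[OF open_S x _ c]; rule mlin4_linear[OF tensor4D(1)[OF b]]; assumption)
qed

lemma tensor3_dird_linear:
  fixes b :: "real^'n \<Rightarrow> real^'n \<Rightarrow> 'n form2"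
  assumes b: "tensor3 S b" and x: "x \<in> S"
  shows "mlin3 (\<lambda>u w z. dird (\<lambda>y. b y u w z) x v)" "linear (\<lambda>v. dird (\<lambda>y. b y u w z) x v)"
proof -
  have c: "(\<lambda>y. b y u w z) differentiable (at x)" for u w z
    by (rule smooth_diff[OF tensor3D(2)[OF b] x])
  show "linear (\<lambda>v. dird (\<lambda>y. b y u w z) x v)" by (rule linear_dird[OF c, unfolded eta_contract_eq])
  show "mlin3 (\<lambda>u w z. dird (\<lambda>y. b y u w z) x v)"
    by (rule mlin3I; rule dird_linear_param[OF open_S x _ c]; rule mlin3_linear[OF tensor3D(1)[OF b]]; assumption)
qed

lemma mlin3_lcov3:
  assumes b: "tensor3 S b" and x: "x \<in> S"
  shows "mlin3 (lcov3 G b x v)" "linear (\<lambda>v. lcov3 G b x v u w z)"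
proof -
  note s = mlin3_simps[OF tensor3_dird_linear(1)[OF b x]] linear_rules[OF tensor3_dird_linear(2)[OF b x]]
      mlin3_simps[OF tensor3D(1)[OF b x]] chr_simps[OF x]
  show "mlin3 (lcov3 G b x v)"
    by (rule mlin3I; rule linearI; simp add: lcov3_def s algebra_simps)
  show "linear (\<lambda>v. lcov3 G b x v u w z)"
    by (rule linearI; simp add: lcov3_def s algebra_simps)
qed

lemma mlin4_lcov4:
  assumes b: "tensor4 S b" and x: "x \<in> S"
  shows "mlin4 (lcov4 G b x v)" "linear (\<lambda>v. lcov4 G b x v u w z t)"
proof -
  note s = mlin4_simps[OF tensor4_dird_linear(1)[OF b x]] linear_rules[OF tensor4_dird_linear(2)[OF b x]]
      mlin4_simps[OF tensor4D(1)[OF b x]] chr_simps[OF x]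
  show "mlin4 (lcov4 G b x v)"
    by (rule mlin4I; rule linearI; simp add: lcov4_def s algebra_simps)
  show "linear (\<lambda>v. lcov4 G b x v u w z t)"
    by (rule linearI; simp add: lcov4_def s algebra_simps)
qed

lemma smooth_lcov4:
  assumes b: "tensor4 S b"
  shows "smooth_on (\<lambda>x. lcov4 G b x v u w z t) S"
proof -
  have "smooth_on (\<lambda>y. b y (christoffel G y v u) w z t) S" "smooth_on (\<lambda>y. b y u (christoffel G y v w) z t) S"
     "smooth_on (\<lambda>y. b y u w (christoffel G y v z) t) S" "smooth_on (\<lambda>y. b y u w z (christoffel G y v t)) S" 
    by (rule slot_smooth[OF open_S mlin4_linear(4)[OF tensor4D(1)[OF b]] tensor4D(2)[OF b] smooth_christoffel]
       slot_smooth[OF open_S mlin4_linear(3)[OF tensor4D(1)[OF b]] tensor4D(2)[OF b] smooth_christoffel]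
       slot_smooth[OF open_S mlin4_linear(2)[OF tensor4D(1)[OF b]] tensor4D(2)[OF b] smooth_christoffel]
       slot_smooth[OF open_S mlin4_linear(1)[OF tensor4D(1)[OF b]] tensor4D(2)[OF b] smooth_christoffel];
        assumption)+
  then show ?thesis unfolding lcov4_def
    by (intro smooth_on_diff open_S smooth_on_dird tensor4D(2)[OF b])
qed

lemma tensor3_ldelta4:
  assumes b: "tensor4 S b"
  shows "tensor3 S (ldelta4 G b)"
proof -
  have "tensor2 S (\<lambda>x p q. lcov4 G b x p u v w q)" for u v w
    unfolding tensor2_def
    by (auto intro!: bilinearI2 mlin4_lcov4(2)[OF b] mlin4_linear(1)[OF mlin4_lcov4(1)[OF b]] smooth_lcov4[OF b])
  from smooth_onb_trace[OF this] have "smooth_on (\<lambda>x. ldelta4 G b x u v w) S" for u v w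
    unfolding ldelta4_def .
  moreover have "mlin3 (ldelta4 G b x)" if x: "x \<in> S" for x
    by (rule mlin3I; rule linearI; simp add: ldelta4_def mlin4_simps[OF mlin4_lcov4(1)[OF b x]] sum.distrib
      sum_distrib_left)
  ultimately show ?thesis by (simp add: tensor3_def)
qed

lemma dird_minus_cong:
  assumes "x \<in> S" "\<And>y. y \<in> S \<Longrightarrow> F y = - H y" "H differentiable (at x)"
  shows "dird F x v = - dird (H :: _ \<Rightarrow> real) x v"
proof -
  have "dird F x v = dird (\<lambda>y. (-1) * H y) x v"
    by (rule fun_cong[OF dird_cong_open[OF open_S assms(1)]]) (simp add: assms(2))
  then show ?thesis using dird_cmult[OF assms(3), of "-1"] by simp
qed

lemma dird_eq_0:
  assumes "x \<in> S" "\<And>y. y \<in> S \<Longrightarrow> F y = 0"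
  shows "dird F x v = (0::real)"
  using fun_cong[OF dird_cong_open[OF open_S assms(1), of F "\<lambda>_. 0"]] assms(2) by (simp add: dird_const)

text \<open>Each symmetry is a linear identity valid on all of \<open>S\<close>; it survives
  differentiation and also holds for each Christoffel correction.\<close>

lemma curvlike_lcov4:
  assumes b: "tensor4 S b" and c: "\<And>y. y \<in> S \<Longrightarrow> curvlike (b y)" and x: "x \<in> S"
  shows "curvlike (lcov4 G b x p)"
  unfolding curvlike_def
proof (intro conjI allI mlin4_lcov4[OF b x])
  fix u v w t
  have d: "(\<lambda>y. b y u v w t) differentiable (at x)" for u v w t
    by (rule smooth_diff[OF tensor4D(2)[OF b] x])
  have 1: "dird (\<lambda>y. b y u v w t) x p = - dird (\<lambda>y. b y v u w t) x p"
    by (rule dird_minus_cong[OF x curvlikeD(2)[OF c] d])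
  have 2: "dird (\<lambda>y. b y u v w t) x p = - dird (\<lambda>y. b y u v t w) x p"
    by (rule dird_minus_cong[OF x curvlikeD(3)[OF c] d])
  have "dird (\<lambda>y. b y u v w t + b y v w u t + b y w u v t) x p = 0"
    by (rule dird_eq_0[OF x curvlikeD(4)[OF c]])
  then have 3: "dird (\<lambda>y. b y u v w t) x p + dird (\<lambda>y. b y v w u t) x p + dird (\<lambda>y. b y w u v t) x p = 0"
    by (simp add: dird_add d differentiable_add)
  show "lcov4 G b x p u v w t = - lcov4 G b x p v u w t"
    unfolding lcov4_def 1 curvlikeD(2)[OF c[OF x], of u _ w t] curvlikeD(2)[OF c[OF x], of u v]
      curvlikeD(2)[OF c[OF x], of _ v w t]
    by simp
  show "lcov4 G b x p u v w t = - lcov4 G b x p u v t w"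
    unfolding lcov4_def 2 curvlikeD(3)[OF c[OF x], of _ _ w t] curvlikeD(3)[OF c[OF x], of u v w]
      curvlikeD(3)[OF c[OF x], of u v _ t]
    by simp
  show "lcov4 G b x p u v w t + lcov4 G b x p v w u t + lcov4 G b x p w u v t = 0"
    using 3 curvlikeD(4)[OF c[OF x], of "christoffel G x p u" v w t] curvlikeD(4)[OF c[OF x], of u
      "christoffel G x p v" w t]
      curvlikeD(4)[OF c[OF x], of u v "christoffel G x p w" t] curvlikeD(4)[OF c[OF x], of u v w
        "christoffel G x p t"]
    unfolding lcov4_def by linarith
qed

text \<open>Covariant differentiation commutes with contraction. The contraction is passed as a
  separate field \<open>r\<close> so that it can be instantiated with the Ricci tensor and, for the
  Weyl tensor, with 0.\<close>

lemma lcov4_trace: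
  assumes b: "tensor4 S b" and x: "x \<in> S"
    and r: "\<And>y u v. y \<in> S \<Longrightarrow> (\<Sum>j\<in>UNIV. b y (onb G y j) u v (onb G y j)) = r y u v"
  shows "(\<Sum>j\<in>UNIV. lcov4 G b x p (onb G x j) u v (onb G x j)) = lcov2 G r x p u v"
proof -
  note t = tensor4_fix23[OF b]
  have "dird (\<lambda>y. r y u v) x p = dird (\<lambda>y. \<Sum>j\<in>UNIV. b y (onb G y j) u v (onb G y j)) x p"
    by (rule fun_cong[OF dird_cong_open[OF open_S x]]) (simp add: r)
  also have "\<dots> = (\<Sum>j\<in>UNIV. lcov2 G (\<lambda>y a c. b y a u v c) x p (onb G x j) (onb G x j))"
    by (rule dird_onb_trace[OF t x])
  finally show ?thesis unfolding lcov2_def lcov4_def r[OF x, symmetric] by (simp add: sum_subtractf)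
qed

section \<open>Ricci, Schouten and Weyl tensor\<close>

lemma lRic_sym:
  assumes x: "x \<in> S"
  shows "lRic G x u v = lRic G x v u"
proof -
  note c = curvlike_lRiem[OF x]
  show ?thesis unfolding lRic_def
    by (rule sum.cong) (metis curvlike_pair[OF c] curvlikeD(2,3)[OF c])+
qed

lemma tensor2_lRic: "tensor2 S (lRic G)"
proof -
  from smooth_onb_trace[OF tensor4_fix23[OF tensor4_lRiem]] have "smooth_on (\<lambda>x. lRic G x u v) S" for u v
    unfolding lRic_def .
  moreover have "bilinear (lRic G x)" if x: "x \<in> S" for x
    by (rule bilinearI2; rule linearI; simp add: lRic_def mlin4_simps[OF mlin4_lRiem[OF x]] sum.distrib
      sum_distrib_left)
  ultimately show ?thesis by (simp add: tensor2_def)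
qed

lemma smooth_lscal: "smooth_on (lscal G) S"
  using smooth_onb_trace[OF tensor2_lRic] unfolding lscal_def[abs_def] .

lemma tensor2_lschouten: "tensor2 S (lschouten G)"
proof -
  define k c where k_def: "k = 1 / (real CARD('n) - 2)" and c_def: "c = 1 / (2 * (real CARD('n) - 1))"
  have "smooth_on (\<lambda>x. lschouten G x u v) S" for u v
    unfolding lschouten_def
    by (intro smooth_on_mult smooth_on_diff smooth_on_const open_S smooth_lscal[unfolded eta_contract_eq]
      smooth_metric tensor2D(2)[OF tensor2_lRic])
  moreover have "bilinear (lschouten G x)" if x: "x \<in> S" for x
    unfolding lschouten_def k_def[symmetric] c_def[symmetric]
    by (rule bilinearI2; rule linearI; simp add: G_simps[OF x] bilinear_simps[OF tensor2D(1)[OF tensor2_lRic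
      x]] algebra_simps)
  ultimately show ?thesis by (simp add: tensor2_def)
qed

lemma lschouten_sym: "x \<in> S \<Longrightarrow> lschouten G x u v = lschouten G x v u"
  by (simp add: lschouten_def lRic_sym[of x u] metric_sym[of x u])

lemma curvlike_lweyl:
  assumes x: "x \<in> S"
  shows "curvlike (lweyl G x)"
  unfolding lweyl_def[abs_def]
  using curvlike_diff[OF curvlike_lRiem[OF x] curvlike_kulkarni_nomizu[of G x "lschouten G",
     OF tensor2D(1)[OF tensor2_metric x] metric_sym[OF x] tensor2D(1)[OF tensor2_lschouten x]
       lschouten_sym[OF x]]] .

lemma tensor4_lweyl: "tensor4 S (lweyl G)"
proof -
  have "smooth_on (\<lambda>x. lweyl G x u v w t) S" for u v w t
    unfolding lweyl_def kulkarni_nomizu_def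
    by (intro smooth_on_diff smooth_on_add smooth_on_mult open_S smooth_metric tensor2D(2)[OF
      tensor2_lschouten] tensor4D(2)[OF tensor4_lRiem])
  then show ?thesis using curvlike_lweyl by (auto simp: tensor4_def curvlike_def)
qed

text \<open>This formula explains the constants in the Schouten tensor: its trace is S / (2 (n -
  1)), so the contraction of its product with the metric is the Ricci tensor, and the Weyl tensor is
  trace-free.\<close>

lemma kulkarni_nomizu_trace:
  assumes x: "x \<in> S" and h: "bilinear (h x)"
  shows "(\<Sum>j\<in>UNIV. kulkarni_nomizu G h x (onb G x j) u v (onb G x j)) =
     (real CARD('n) - 2) * h x u v + G x u v * (\<Sum>j\<in>UNIV. h x (onb G x j) (onb G x j))"
proof -
  have n: "(\<Sum>j\<in>UNIV. G x (onb G x j) (onb G x j)) = real CARD('n)" by (rule onb_card[OF onb_at[OF x]])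
  have 1: "(\<Sum>j\<in>UNIV. G x (onb G x j) v * h x u (onb G x j)) = h x u v"
    by (rule onb_contract(2)[OF x bilinear_linear(1)[OF h]])
  have 2: "(\<Sum>j\<in>UNIV. G x u (onb G x j) * h x (onb G x j) v) = h x u v"
    by (rule onb_contract(1)[OF x bilinear_linear(2)[OF h]])
  show ?thesis unfolding kulkarni_nomizu_def
    by (simp add: sum.distrib sum_subtractf 1 2 n sum_distrib_right[symmetric] sum_distrib_left[symmetric]
      algebra_simps)
qed

lemma lschouten_trace:
  assumes x: "x \<in> S" and n: "CARD('n) \<ge> 3"
  shows "(\<Sum>j\<in>UNIV. lschouten G x (onb G x j) (onb G x j)) = lscal G x / (2 * (real CARD('n) - 1))"
proof -
  have "(\<Sum>j\<in>UNIV. lschouten G x (onb G x j) (onb G x j)) = 1 / (real CARD('n) - 2) * (lscal G x - 1 / (2 *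
    (real CARD('n) - 1)) * lscal G x * real CARD('n))"
    unfolding lschouten_def sum_distrib_left[symmetric] sum_subtractf onb_card[OF onb_at[OF x]]
      lscal_def[symmetric] ..
  also have "\<dots> = lscal G x / (2 * (real CARD('n) - 1))"
  proof -
    have "real CARD('n) - 2 \<noteq> 0" "real CARD('n) - 1 \<noteq> 0" using n by auto
    then show ?thesis by (simp add: divide_simps) (simp add: algebra_simps)
  qed
  finally show ?thesis .
qed

lemma lweyl_trace:
  assumes x: "x \<in> S" and n: "CARD('n) \<ge> 3"
  shows "(\<Sum>j\<in>UNIV. lweyl G x (onb G x j) u v (onb G x j)) = 0"
proof -
  have "real CARD('n) - 2 \<noteq> 0" using n by auto
  then show ?thesis
  unfolding lweyl_def sum_subtractf kulkarni_nomizu_trace[of x "lschouten G", OF x tensor2D(1)[OF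
    tensor2_lschouten x]]
    lschouten_trace[OF x n] lRic_def[symmetric]
    by (simp add: lschouten_def)
qed

section \<open>Contracted Bianchi identities\<close>

lemma lcov2_lRic:
  assumes x: "x \<in> S"
  shows "lcov2 G (lRic G) x p u v = (\<Sum>j\<in>UNIV. lcov4 G (lRiem G) x p (onb G x j) u v (onb G x j))"
  by (rule lcov4_trace[OF tensor4_lRiem x, symmetric]) (simp add: lRic_def)

text \<open>The second Bianchi identity with the direction of differentiation contracted against the
  last slot; the other two terms become derivatives of the Ricci tensor.\<close>

lemma contracted_bianchi:
  assumes x: "x \<in> S"
  shows "ldelta4 G (lRiem G) x u v w = lcov2 G (lRic G) x u v w - lcov2 G (lRic G) x v u w"
proof -
  note c = curvlike_lcov4[OF tensor4_lRiem curvlike_lRiem x]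
  have "lcov4 G (lRiem G) x e u v w e = lcov4 G (lRiem G) x u e v w e - lcov4 G (lRiem G) x v e u w e" for e
    using second_bianchi[OF x, of e u v w e] curvlikeD(2)[OF c, of u v e w e] by linarith
  then show ?thesis unfolding ldelta4_def lcov2_lRic[OF x] by (simp add: sum_subtractf)
qed

lemma dird_lscal:
  assumes x: "x \<in> S"
  shows "dird (lscal G) x u = (\<Sum>j\<in>UNIV. lcov2 G (lRic G) x u (onb G x j) (onb G x j))"
  using dird_onb_trace[OF tensor2_lRic x] unfolding lscal_def[abs_def] .

text \<open>\<open>contracted_bianchi\<close> is contracted once more, in v and w. The right-hand
  side becomes dS minus the divergence of the Ricci tensor, and the antisymmetries in both pairs
  turn the left-hand side into that same divergence, whence the factor 2.\<close>

lemma divergence_lRic: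
  assumes x: "x \<in> S"
  shows "2 * (\<Sum>j\<in>UNIV. lcov2 G (lRic G) x (onb G x j) u (onb G x j)) = dird (lscal G) x u"
proof -
  let ?e = "onb G x"
  note c = curvlike_lcov4[OF tensor4_lRiem curvlike_lRiem x]
  have "(\<Sum>i\<in>UNIV. ldelta4 G (lRiem G) x u (?e i) (?e i)) = dird (lscal G) x u - (\<Sum>i\<in>UNIV. lcov2 G (lRic G) x
    (?e i) u (?e i))"
    unfolding contracted_bianchi[OF x] dird_lscal[OF x] by (simp add: sum_subtractf)
  moreover have "(\<Sum>i\<in>UNIV. ldelta4 G (lRiem G) x u (?e i) (?e i)) = (\<Sum>j\<in>UNIV. lcov2 G (lRic G) x (?e j) u (?e j))"
  proof -
    have "lcov4 G (lRiem G) x p u e e q = lcov4 G (lRiem G) x p e u q e" for p e q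
      using curvlikeD(2)[OF c, of p u e e q] curvlikeD(3)[OF c, of p e u e q] by simp
    then show ?thesis unfolding ldelta4_def lcov2_lRic[OF x] by (subst sum.swap) simp
  qed
  ultimately show ?thesis by simp
qed

lemma lcov2_lschouten:
  assumes x: "x \<in> S"
  shows "lcov2 G (lschouten G) x p u v = 1 / (real CARD('n) - 2) *
     (lcov2 G (lRic G) x p u v - 1 / (2 * (real CARD('n) - 1)) * dird (lscal G) x p * G x u v)"
proof -
  have d: "(\<lambda>y. lRic G y u v) differentiable (at x)" "(\<lambda>y. G y u v) differentiable (at x)" "lscal G
    differentiable (at x)"
    by (rule smooth_diff[OF tensor2D(2)[OF tensor2_lRic] x] smooth_diff[OF smooth_metric x] smooth_diff[OF
      smooth_lscal x])+
  define k c where k_def: "k = 1 / (real CARD('n) - 2)" and c_def: "c = 1 / (2 * (real CARD('n) - 1))"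
  show ?thesis
    unfolding lcov2_def lschouten_def k_def[symmetric] c_def[symmetric]
    by (simp add: dird_cmult dird_diff dird_mult d differentiable_mult differentiable_diff metric_compat[OF
      x] dird_const
        algebra_simps)
qed

lemma lcov4_lweyl:
  assumes x: "x \<in> S"
  shows "lcov4 G (lweyl G) x p u v w t = lcov4 G (lRiem G) x p u v w t
    - kulkarni_nomizu G (\<lambda>y. lcov2 G (lschouten G) y p) x u v w t"
proof -
  have d: "(\<lambda>y. lschouten G y u v) differentiable (at x)" "(\<lambda>y. G y u v) differentiable (at x)"
     "(\<lambda>y. lRiem G y u v w t) differentiable (at x)" for u v w t
    by (rule smooth_diff[OF tensor2D(2)[OF tensor2_lschouten] x] smooth_diff[OF smooth_metric x]
      smooth_diff[OF tensor4D(2)[OF tensor4_lRiem] x])+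
  show ?thesis
    unfolding lcov4_def lcov2_def lweyl_def kulkarni_nomizu_def
    by (simp add: dird_add dird_diff dird_mult d differentiable_mult differentiable_diff differentiable_add
      metric_compat[OF x] algebra_simps)
qed

lemma divergence_lschouten:
  assumes x: "x \<in> S" and n: "CARD('n) \<ge> 3"
  shows "(\<Sum>j\<in>UNIV. lcov2 G (lschouten G) x (onb G x j) u (onb G x j)) = 1 / (2 * (real CARD('n) - 1)) * dird
    (lscal G) x u"
proof -
  have s: "(\<Sum>j\<in>UNIV. dird (lscal G) x (onb G x j) * G x u (onb G x j)) = dird (lscal G) x u"
    by (rule onb_contract(3)[OF x linear_dird[OF smooth_diff[OF smooth_lscal x]]])
  have r: "(\<Sum>j\<in>UNIV. lcov2 G (lRic G) x (onb G x j) u (onb G x j)) = 1 / 2 * dird (lscal G) x u"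
    using divergence_lRic[OF x, of u] by simp
  have "(\<Sum>j\<in>UNIV. lcov2 G (lschouten G) x (onb G x j) u (onb G x j)) =
     1 / (real CARD('n) - 2) * (1 / 2 * dird (lscal G) x u - 1 / (2 * (real CARD('n) - 1)) * dird (lscal G) x u)"
    unfolding lcov2_lschouten[OF x] sum_distrib_left[symmetric] sum_subtractf mult.assoc r s ..
  also have "\<dots> = 1 / (2 * (real CARD('n) - 1)) * dird (lscal G) x u"
  proof -
    have "real CARD('n) - 2 \<noteq> 0" "real CARD('n) - 1 \<noteq> 0" using n by auto
    then show ?thesis by (simp add: divide_simps) (simp add: algebra_simps)
  qed
  finally show ?thesis .
qed

text \<open>The contracted Bianchi identity gives n - 2 copies of the Cotton tensor and the
  divergence of the Kulkarni-Nomizu product takes one away. The terms with dS cancel because the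
  divergence of the Schouten tensor is the differential of its trace.\<close>

lemma ldelta4_lweyl:
  assumes x: "x \<in> S" and n: "CARD('n) \<ge> 3"
  shows "ldelta4 G (lweyl G) x u v w = (real CARD('n) - 3) * (lcov2 G (lschouten G) x u v w - lcov2 G
    (lschouten G) x v u w)"
proof -
  let ?e = "onb G x" and ?k = "lcov2 G (lschouten G) x" and ?c = "1 / (2 * (real CARD('n) - 1))"
  note m = mlin3_lcov2[OF tensor2_lschouten x]
  have n2: "real CARD('n) - 2 \<noteq> 0" using n by auto
  have 1: "(\<Sum>j\<in>UNIV. G x u (?e j) * ?k (?e j) v w) = ?k u v w" for u v w
    by (rule onb_contract(1)[OF x mlin3_linear(3)[OF m]])
  have ric: "lcov2 G (lRic G) x p u v = (real CARD('n) - 2) * ?k p u v + ?c * dird (lscal G) x p * G x u v"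
    for p u v
    unfolding lcov2_lschouten[OF x] using n2 by simp
  have "ldelta4 G (lweyl G) x u v w = ldelta4 G (lRiem G) x u v w -
      (?k u v w + G x v w * (\<Sum>j\<in>UNIV. ?k (?e j) u (?e j)) - G x u w * (\<Sum>j\<in>UNIV. ?k (?e j) v (?e j)) - ?k v u w)"
    unfolding ldelta4_def lcov4_lweyl[OF x] kulkarni_nomizu_def
    by (simp add: sum.distrib sum_subtractf 1 sum_distrib_left)
  also have "\<dots> = (real CARD('n) - 3) * (?k u v w - ?k v u w)"
    unfolding contracted_bianchi[OF x] ric divergence_lschouten[OF x n] by (simp add: algebra_simps)
  finally show ?thesis .
qed

end

section \<open>Conformal change of the metric\<close>

context local_metric
begin

text \<open>Together with the vanishing trace below, these are the algebraic properties that
  \<open>ldelta1_conf\<close> asks of the tensor whose divergence is taken.\<close>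

lemma ldelta4_curvlike:
  assumes b: "tensor4 S b" and c: "\<And>y. y \<in> S \<Longrightarrow> curvlike (b y)" and x: "x \<in> S"
  shows "ldelta4 G b x u v w = - ldelta4 G b x v u w"
    "ldelta4 G b x u v w + ldelta4 G b x v w u + ldelta4 G b x w u v = 0"
proof -
  note k = curvlike_lcov4[OF b c x]
  show "ldelta4 G b x u v w = - ldelta4 G b x v u w"
    unfolding ldelta4_def sum_negf[symmetric] by (rule sum.cong[OF refl]) (rule curvlikeD(2)[OF k])
  show "ldelta4 G b x u v w + ldelta4 G b x v w u + ldelta4 G b x w u v = 0"
    unfolding ldelta4_def sum.distrib[symmetric] by (rule sum.neutral) (simp add: curvlikeD(4)[OF k])
qed

text \<open>After exchanging two sums and two slots, the inner sum is a contraction of \<nabla>W,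
  hence the derivative of a vanishing trace.\<close>

lemma ldelta4_lweyl_trace:
  assumes x: "x \<in> S" and n: "CARD('n) \<ge> 3"
  shows "(\<Sum>i\<in>UNIV. ldelta4 G (lweyl G) x (onb G x i) u (onb G x i)) = 0"
proof -
  note k = curvlike_lcov4[OF tensor4_lweyl curvlike_lweyl x]
  have t: "(\<Sum>i\<in>UNIV. lcov4 G (lweyl G) x p (onb G x i) u v (onb G x i)) = 0" for p u v
    using lcov4_trace[OF tensor4_lweyl x, of "\<lambda>_ _ _. 0" p u v] lweyl_trace n by (simp add: lcov2_def dird_const)
  have "(\<Sum>i\<in>UNIV. ldelta4 G (lweyl G) x (onb G x i) u (onb G x i)) =
      (\<Sum>j\<in>UNIV. \<Sum>i\<in>UNIV. lcov4 G (lweyl G) x (onb G x j) (onb G x i) u (onb G x i) (onb G x j))"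
    unfolding ldelta4_def by (rule sum.swap)
  also have "\<dots> = (\<Sum>j\<in>UNIV. - (\<Sum>i\<in>UNIV. lcov4 G (lweyl G) x (onb G x j) (onb G x i) u (onb G x j) (onb G x i)))"
    unfolding sum_negf[symmetric] by (intro sum.cong refl curvlikeD(3)[OF k])
  also have "\<dots> = 0" by (simp add: t)
  finally show ?thesis .
qed

end

definition conf :: "(real^'n::finite \<Rightarrow> real) \<Rightarrow> (real^'n \<Rightarrow> 'n form2) \<Rightarrow> real^'n \<Rightarrow> 'n form2" where
  "conf f G x u v = exp (2 * f x) * G x u v"

locale conformal = local_metric S G for S :: "(real^'n::finite) set" and G +
  fixes f :: "real^'n \<Rightarrow> real"
  assumes smooth_f: "smooth_on f S" and dim4: "CARD('n) \<ge> 4"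
begin

lemma dim3: "CARD('n) \<ge> 3" using dim4 by simp

lemma metric_form_conf: "x \<in> S \<Longrightarrow> metric_form (conf f G x)"
  using metric[of x] unfolding metric_form_def
  by (auto simp: conf_def G_simps intro!: bilinearI2 linearI) (simp_all add: algebra_simps)

text \<open>Every fact about a local metric thereby holds for the rescaled metric too, under the
  prefix \<open>cf\<close>. In particular both metrics have their own Bianchi identities.\<close>

sublocale cf: local_metric S "conf f G"
proof
  show "smooth_on (\<lambda>x. conf f G x u v) S" for u v
    unfolding conf_def by (intro smooth_on_mult smooth_on_exp smooth_f smooth_metric open_S smooth_on_const)
qed (auto simp: open_S metric_form_conf)

definition phi where "phi x u = dird f x u"
definition gradf where "gradf x = sharp G x (phi x)"
definition hess where "hess x u v = dird (\<lambda>y. phi y v) x u - phi x (christoffel G x u v)"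
text \<open>The difference of the two Levi-Civita connections.\<close>

definition cdiff where "cdiff x u v = phi x u *\<^sub>R v + phi x v *\<^sub>R u - G x u v *\<^sub>R gradf x"
text \<open>The amount by which the Schouten tensor decreases; \<open>phi x (gradf x)\<close> is the
  squared norm of df.\<close>

definition schd where "schd x u v = hess x u v - phi x u * phi x v + phi x (gradf x) / 2 * G x u v"
definition nabF where "nabF x u = dird gradf x u + christoffel G x u (gradf x)"

lemma linear_phi: "x \<in> S \<Longrightarrow> linear (phi x)"
  unfolding phi_def[abs_def] eta_contract_eq by (rule linear_dird[OF smooth_diff[OF smooth_f]])

lemmas phi_simps = linear_rules[OF linear_phi]

lemma smooth_phi: "smooth_on (\<lambda>x. phi x u) S"
  unfolding phi_def by (rule smooth_on_dird[OF smooth_f])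

lemma metric_gradf: "x \<in> S \<Longrightarrow> G x (gradf x) u = phi x u"
  unfolding gradf_def by (rule metric_sharp[of G x, OF metric linear_phi])

lemma smooth_gradf: "smooth_on gradf S"
  unfolding gradf_def[abs_def] by (rule smooth_on_sharp[OF open_S metric smooth_metric linear_phi smooth_phi])

lemma hess_sym: "x \<in> S \<Longrightarrow> hess x u v = hess x v u"
  unfolding hess_def phi_def using dird_commute_real[OF open_S smooth_f, of x u v] christoffel_sym by metis

lemma dird_phi_linear: "x \<in> S \<Longrightarrow> linear (\<lambda>v. dird (\<lambda>y. phi y v) x u)" "x \<in> S \<Longrightarrow> linear (\<lambda>u. dird (\<lambda>y. phi y v) x u)"
  by (rule dird_linear_param[OF open_S _ linear_phi smooth_diff[OF smooth_phi]]; assumption)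
     (rule linear_dird[OF smooth_diff[OF smooth_phi], unfolded eta_contract_eq])

lemma bilinear_hess:
  assumes x: "x \<in> S"
  shows "bilinear (hess x)"
  by (rule bilinearI2; rule linearI; simp add: hess_def linear_rules[OF dird_phi_linear(1)[OF x]]
     linear_rules[OF dird_phi_linear(2)[OF x]] chr_simps[OF x] phi_simps[OF x] algebra_simps)

lemma bilinear_schd:
  assumes x: "x \<in> S"
  shows "bilinear (schd x)"
  by (rule bilinearI2; rule linearI; simp add: schd_def bilinear_simps[OF bilinear_hess[OF x]] phi_simps[OF
    x] G_simps[OF x] algebra_simps)

lemma metric_nabF:
  assumes x: "x \<in> S"
  shows "G x (nabF x u) w = hess x u w"
proof -
  have "dird (\<lambda>y. phi y w) x u = dird (\<lambda>y. G y (gradf y) w) x u"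
    by (rule fun_cong[OF dird_cong_open[OF open_S x]]) (simp add: metric_gradf)
  also have "\<dots> = dird (\<lambda>y. G y (gradf x) w) x u + G x (dird gradf x u) w"
    using tensor2_differentiable(2)[OF open_S x tensor2_metric smooth_diff[OF smooth_gradf x], of "\<lambda>_. w" u]
    by (simp add: dird_const G_simps[OF x])
  finally show ?thesis unfolding hess_def nabF_def by (simp add: metric_compat[OF x] metric_gradf[OF x]
    G_simps[OF x])
qed

lemma dird_conf:
  assumes x: "x \<in> S"
  shows "dird (\<lambda>y. conf f G y u v) x p = exp (2 * f x) * (2 * phi x p * G x u v + dird (\<lambda>y. G y u v) x p)"
proof -
  have d: "f differentiable (at x)" by (rule smooth_diff[OF smooth_f x])
  have d2: "(\<lambda>y. 2 * f y) differentiable (at x)" using d by (simp add: differentiable_mult)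
  have d3: "(\<lambda>y. exp (2 * f y)) differentiable (at x)"
    by (rule smooth_diff[OF _ x]) (intro smooth_on_exp smooth_on_mult open_S smooth_f smooth_on_const)
  show ?thesis
    unfolding conf_def dird_mult[OF d3 smooth_diff[OF smooth_metric x]] dird_exp[OF d2] dird_cmult[OF d] phi_def
    by (simp add: algebra_simps)
qed

lemma christoffel_conf:
  assumes x: "x \<in> S"
  shows "christoffel (conf f G) x u v = christoffel G x u v + cdiff x u v"
proof (rule cf.christoffel_eqI[OF x])
  fix w
  show "conf f G x (christoffel G x u v + cdiff x u v) w = (dird (\<lambda>y. conf f G y v w) x u + dird (\<lambda>y. conf f
    G y u w) x v - dird (\<lambda>y. conf f G y u v) x w) / 2"
    unfolding dird_conf[OF x] unfolding conf_def
    by (simp add: G_simps[OF x] metric_christoffel[OF x] cdiff_def metric_gradf[OF x] field_simps)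
qed

lemma dird_christoffel_conf:
  assumes x: "x \<in> S"
  shows "dird (\<lambda>y. christoffel (conf f G) y v w) x u = dird (\<lambda>y. christoffel G y v w) x u
    + (dird (\<lambda>y. phi y v) x u *\<^sub>R w + dird (\<lambda>y. phi y w) x u *\<^sub>R v - (dird (\<lambda>y. G y v w) x u *\<^sub>R gradf x + G
      x v w *\<^sub>R dird gradf x u))"
proof -
  have d: "(\<lambda>y. phi y a) differentiable (at x)" "(\<lambda>y. G y a b) differentiable (at x)"
    "gradf differentiable (at x)" "(\<lambda>y. christoffel G y a b) differentiable (at x)" for a b
    by (rule smooth_diff[OF smooth_phi x] smooth_diff[OF smooth_metric x] smooth_diff[OF smooth_gradf x]
      smooth_diff[OF smooth_christoffel x])+
  have "dird (\<lambda>y. christoffel (conf f G) y v w) x u = dird (\<lambda>y. christoffel G y v w + (phi y v *\<^sub>R w + phi y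
    w *\<^sub>R v - G y v w *\<^sub>R gradf y)) x u"
    by (rule fun_cong[OF dird_cong_open[OF open_S x]]) (simp add: christoffel_conf cdiff_def)
  also have "\<dots> = dird (\<lambda>y. christoffel G y v w) x u
    + (dird (\<lambda>y. phi y v) x u *\<^sub>R w + dird (\<lambda>y. phi y w) x u *\<^sub>R v - (dird (\<lambda>y. G y v w) x u *\<^sub>R gradf x + G
      x v w *\<^sub>R dird gradf x u))"
    by (simp add: dird_add dird_diff dird_scaleR d differentiable_add differentiable_diff
      differentiable_scaleR dird_const)
  finally show ?thesis .
qed

text \<open>Second derivatives of f enter only through \<open>hess\<close> and \<open>nabF\<close>,
  and first derivatives of the metric only through compatibility. Once these are substituted, what
  remains beside the curvature of \<open>G\<close> is algebra.\<close>

lemma lRiem_conf: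
  assumes x: "x \<in> S"
  shows "lRiem (conf f G) x u v w t = exp (2 * f x) * (lRiem G x u v w t - kulkarni_nomizu G schd x u v w t)"
proof -
  have h: "dird (\<lambda>y. phi y b) x a = hess x a b + phi x (christoffel G x a b)" for a b by (simp add: hess_def)
  have nf: "dird gradf x a = nabF x a - christoffel G x a (gradf x)" for a by (simp add: nabF_def)
  have c: "christoffel G x v u = christoffel G x u v" by (rule christoffel_sym[OF x])
  have "G x (lcurv (conf f G) x u v w) t = lRiem G x u v w t - kulkarni_nomizu G schd x u v w t"
    unfolding lcurv_def[of "conf f G"] dird_christoffel_conf[OF x] christoffel_conf[OF x] lRiem_def lcurv_def[of G]
      kulkarni_nomizu_def schd_def h nf metric_compat[OF x]
    by (simp add: cdiff_def G_simps[OF x] chr_simps[OF x] phi_simps[OF x] metric_gradf[OF x] metric_nabF[OF x]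
        metric_sym[OF x, of _ "gradf x"] metric_sym[OF x, of v u] c hess_sym[OF x, of v u] algebra_simps
        metric_sym[OF x, of t] metric_sym[OF x, of w u] metric_sym[OF x, of w v] metric_sym[OF x, of w
        "christoffel G x a b" for a b]
        metric_sym[OF x, of v "christoffel G x a b" for a b] metric_sym[OF x, of u "christoffel G x a b" for a b]
        hess_sym[OF x, of w])
  then show ?thesis by (simp add: lRiem_def conf_def)
qed

text \<open>The basis \<open>onb (conf f G) x\<close> is an unrelated choice, but by independence of
  the basis it may be replaced by exp (-f) times the old one.\<close>

lemma conf_onb_trace:
  fixes b :: "'n form2"
  assumes x: "x \<in> S" and b: "\<And>u. linear (b u)" "\<And>v. linear (\<lambda>u. b u v)"
  shows "(\<Sum>j\<in>UNIV. b (onb (conf f G) x j) (onb (conf f G) x j)) = exp (- 2 * f x) * (\<Sum>j\<in>UNIV. b (onb G x j)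
    (onb G x j))"
proof -
  have ee: "exp (- f x) * exp (- f x) = exp (- 2 * f x)" by (simp add: exp_add[symmetric])
  have e2: "exp (2 * f x) * (exp (- f x) * exp (- f x)) = 1" by (simp add: exp_add[symmetric])
  have o: "is_onb (conf f G x) (\<lambda>j. exp (- f x) *\<^sub>R onb G x j)"
    using onb_at[OF x] e2 unfolding is_onb_def conf_def by (auto simp: G_simps[OF x])
  have "(\<Sum>j\<in>UNIV. b (onb (conf f G) x j) (onb (conf f G) x j)) = (\<Sum>j\<in>UNIV. b (exp (- f x) *\<^sub>R onb G x j)
    (exp (- f x) *\<^sub>R onb G x j))"
    by (rule onb_sum_indep[OF cf.metric[OF x] cf.onb_at[OF x] o b])
  then show ?thesis unfolding ee[symmetric]
    by (simp add: linear_cmul[OF b(1)] linear_cmul[OF b(2)] sum_distrib_left mult.assoc)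
qed

abbreviation trh where "trh x \<equiv> (\<Sum>j\<in>UNIV. schd x (onb G x j) (onb G x j))"

lemma exp2_cancel: "exp (- 2 * f x) * (exp (2 * f x) * a) = (a::real)"
  by (simp add: exp_minus mult.assoc[symmetric])

lemma lRic_conf:
  assumes x: "x \<in> S"
  shows "lRic (conf f G) x u v = lRic G x u v - ((real CARD('n) - 2) * schd x u v + G x u v * trh x)"
proof -
  note l = mlin4_linear[OF cf.mlin4_lRiem[OF x]]
  have "lRic (conf f G) x u v = exp (- 2 * f x) * (\<Sum>j\<in>UNIV. lRiem (conf f G) x (onb G x j) u v (onb G x j))"
    unfolding lRic_def by (rule conf_onb_trace[OF x l(1) l(4)])
  also have "\<dots> = (\<Sum>j\<in>UNIV. lRiem G x (onb G x j) u v (onb G x j) - kulkarni_nomizu G schd x (onb G x j) u v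
    (onb G x j))"
    unfolding lRiem_conf[OF x] sum_distrib_left[symmetric] by (rule exp2_cancel)
  finally show ?thesis unfolding sum_subtractf kulkarni_nomizu_trace[of x schd, OF x bilinear_schd[OF x]]
    lRic_def .
qed

lemma lscal_conf:
  assumes x: "x \<in> S"
  shows "lscal (conf f G) x = exp (- 2 * f x) * (lscal G x - 2 * (real CARD('n) - 1) * trh x)"
proof -
  note l = bilinear_linear[OF tensor2D(1)[OF cf.tensor2_lRic x]]
  have "lscal (conf f G) x = exp (- 2 * f x) * (\<Sum>j\<in>UNIV. lRic (conf f G) x (onb G x j) (onb G x j))"
    unfolding lscal_def by (rule conf_onb_trace[OF x l])
  also have "(\<Sum>j\<in>UNIV. lRic (conf f G) x (onb G x j) (onb G x j)) = lscal G x - ((real CARD('n) - 2) * trh x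
    + real CARD('n) * trh x)"
    unfolding lRic_conf[OF x] sum_subtractf sum.distrib sum_distrib_left[symmetric]
      sum_distrib_right[symmetric] onb_card[OF onb_at[OF x]]
      lscal_def ..
  finally show ?thesis by (simp add: algebra_simps)
qed

lemma lschouten_conf:
  assumes x: "x \<in> S"
  shows "lschouten (conf f G) x u v = lschouten G x u v - schd x u v"
proof -
  define N where "N = real CARD('n)"
  have n: "N - 2 \<noteq> 0" "N - 1 \<noteq> 0" using dim4 by (auto simp: N_def)
  have "lscal (conf f G) x * conf f G x u v = (lscal G x - 2 * (N - 1) * trh x) * G x u v"
    unfolding lscal_conf[OF x] conf_def N_def by (simp add: exp_minus field_simps)
  then have "lschouten (conf f G) x u v = 1 / (N - 2) * (lRic G x u v - ((N - 2) * schd x u v + G x u v * trh x) -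
     1 / (2 * (N - 1)) * ((lscal G x - 2 * (N - 1) * trh x) * G x u v))"
    unfolding lschouten_def lRic_conf[OF x] N_def[symmetric] by (simp add: mult.assoc)
  also have "\<dots> = lschouten G x u v - schd x u v"
    unfolding lschouten_def N_def[symmetric] using n by (simp add: divide_simps) (simp add: algebra_simps)
  finally show ?thesis .
qed

text \<open>Up to the common factor, the curvature loses the Kulkarni-Nomizu product of the metric
  with \<open>schd\<close>, and the Schouten tensor loses \<open>schd\<close>; the two changes
  cancel.\<close>

lemma lweyl_conf:
  assumes x: "x \<in> S"
  shows "lweyl (conf f G) x u v w t = exp (2 * f x) * lweyl G x u v w t"
  unfolding lweyl_def lRiem_conf[OF x] kulkarni_nomizu_def lschouten_conf[OF x] conf_def
  by (simp add: algebra_simps)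

lemma lweyl_traces:
  assumes x: "x \<in> S"
  shows "(\<Sum>j\<in>UNIV. lweyl G x (onb G x j) u v (onb G x j)) = 0"
    "(\<Sum>j\<in>UNIV. lweyl G x u (onb G x j) v (onb G x j)) = 0"
    "lweyl G x u v w w = 0"
proof -
  note c = curvlike_lweyl[OF x]
  show 1: "(\<Sum>j\<in>UNIV. lweyl G x (onb G x j) u v (onb G x j)) = 0" for u v by (rule lweyl_trace[OF x dim3])
  show "(\<Sum>j\<in>UNIV. lweyl G x u (onb G x j) v (onb G x j)) = 0"
    unfolding curvlikeD(2)[OF c, of u] sum_negf 1 by simp
  show "lweyl G x u v w w = 0" using curvlikeD(3)[OF c, of u v w w] by simp
qed

lemma lcov4_lweyl_conf:
  assumes x: "x \<in> S"
  shows "lcov4 (conf f G) (lweyl (conf f G)) x p u v w t = exp (2 * f x) * (2 * phi x p * lweyl G x u v w t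
    + lcov4 G (lweyl G) x p u v w t
     - lweyl G x (cdiff x p u) v w t - lweyl G x u (cdiff x p v) w t - lweyl G x u v (cdiff x p w) t - lweyl
       G x u v w (cdiff x p t))"
proof -
  have d: "f differentiable (at x)" by (rule smooth_diff[OF smooth_f x])
  have d2: "(\<lambda>y. 2 * f y) differentiable (at x)" using d by (simp add: differentiable_mult)
  have d3: "(\<lambda>y. exp (2 * f y)) differentiable (at x)"
    by (rule smooth_diff[OF _ x]) (intro smooth_on_exp smooth_on_mult open_S smooth_f smooth_on_const)
  have "dird (\<lambda>y. lweyl (conf f G) y u v w t) x p = dird (\<lambda>y. exp (2 * f y) * lweyl G y u v w t) x p"
    by (rule fun_cong[OF dird_cong_open[OF open_S x]]) (rule lweyl_conf)
  also have "\<dots> = exp (2 * f x) * (2 * phi x p * lweyl G x u v w t + dird (\<lambda>y. lweyl G y u v w t) x p)"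
    unfolding dird_mult[OF d3 smooth_diff[OF tensor4D(2)[OF tensor4_lweyl] x]] dird_exp[OF d2] dird_cmult[OF
      d] phi_def
    by (simp add: algebra_simps)
  finally show ?thesis unfolding lcov4_def lweyl_conf[OF x] christoffel_conf[OF x]
    by (simp add: mlin4_simps[OF tensor4D(1)[OF tensor4_lweyl x]] algebra_simps)
qed

section \<open>Divergences after a conformal change\<close>

lemma sum_phi: 
  assumes x: "x \<in> S" and "linear h"
  shows "(\<Sum>j\<in>UNIV. phi x (onb G x j) * h (onb G x j)) = (h (gradf x) :: real)"
  using onb_contract(1)[OF x assms(2), of "gradf x"] by (simp add: metric_gradf[OF x])

text \<open>The two terms of \<open>cdiff\<close> with \<open>phi\<close> contribute 2 F, the term
  with the metric contributes - n F.\<close>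

lemma sum_cdiff_diag:
  assumes x: "x \<in> S" and h: "linear h"
  shows "(\<Sum>j\<in>UNIV. h (cdiff x (onb G x j) (onb G x j))) = ((2 - real CARD('n)) * h (gradf x) :: real)"
proof -
  have "h (cdiff x e e) = 2 * (phi x e * h e) - G x e e * h (gradf x)" for e
    unfolding cdiff_def linear_rules[OF h] by simp
  then have "(\<Sum>j\<in>UNIV. h (cdiff x (onb G x j) (onb G x j))) = 2 * h (gradf x) - real CARD('n) * h (gradf x)"
    by (simp only: sum_subtractf sum_distrib_left[symmetric] sum_phi[OF x h] sum_distrib_right[symmetric]
        onb_card[OF onb_at[OF x]])
  then show ?thesis by (simp add: algebra_simps)
qed

lemma sum_cdiff:
  assumes x: "x \<in> S" and h: "bilinear (h :: 'n form2)"
  shows "(\<Sum>j\<in>UNIV. h (cdiff x (onb G x j) u) (onb G x j)) =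
     h u (gradf x) + phi x u * (\<Sum>j\<in>UNIV. h (onb G x j) (onb G x j)) - h (gradf x) u"
proof -
  have 1: "(\<Sum>j\<in>UNIV. phi x (onb G x j) * h u (onb G x j)) = h u (gradf x)"
    by (rule sum_phi[OF x bilinear_linear(1)[OF h]])
  have 2: "(\<Sum>j\<in>UNIV. G x (onb G x j) u * h (gradf x) (onb G x j)) = h (gradf x) u"
    by (rule onb_contract(2)[OF x bilinear_linear(1)[OF h]])
  show ?thesis unfolding cdiff_def
    by (simp add: bilinear_simps[OF h] sum.distrib sum_subtractf 1 2 sum_distrib_left)
qed

text \<open>The coefficient n - 3 is a count: 2 from the factor exp (2 f), - 1 from each of the
  first three slots, n - 2 from the slot contracted with the derivative. The three further terms,
  with F in one of the first three slots, cancel by the first Bianchi identity.\<close>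

lemma ldelta4_lweyl_conf:
  assumes x: "x \<in> S"
  shows "ldelta4 (conf f G) (lweyl (conf f G)) x u v w =
    ldelta4 G (lweyl G) x u v w + (real CARD('n) - 3) * lweyl G x u v w (gradf x)"
proof -
  let ?e = "onb G x" and ?W = "lweyl G x" and ?F = "gradf x"
  note c = curvlike_lweyl[OF x]
  note l = mlin4_linear[OF curvlikeD(1)[OF c]]
  note l' = mlin4_lcov4[OF cf.tensor4_lweyl x]
  have "ldelta4 (conf f G) (lweyl (conf f G)) x u v w = exp (- 2 * f x) * (\<Sum>j\<in>UNIV. lcov4 (conf f G) (lweyl
    (conf f G)) x (?e j) u v w (?e j))"
    unfolding ldelta4_def 
    by (rule conf_onb_trace[OF x mlin4_linear(1)[OF cf.mlin4_lcov4(1)[OF cf.tensor4_lweyl x]]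
      cf.mlin4_lcov4(2)[OF cf.tensor4_lweyl x]])
  also have "\<dots> = (\<Sum>j\<in>UNIV. 2 * phi x (?e j) * ?W u v w (?e j) + lcov4 G (lweyl G) x (?e j) u v w (?e j)
     - ?W (cdiff x (?e j) u) v w (?e j) - ?W u (cdiff x (?e j) v) w (?e j) - ?W u v (cdiff x (?e j) w) (?e
       j) - ?W u v w (cdiff x (?e j) (?e j)))"
    unfolding lcov4_lweyl_conf[OF x] sum_distrib_left[symmetric] by (rule exp2_cancel)
  also have "\<dots> = 2 * ?W u v w ?F + ldelta4 G (lweyl G) x u v w - (?W u v w ?F - ?W ?F v w u)
     - (?W u v w ?F - ?W u ?F w v) - (?W u v w ?F - ?W u v ?F w) - (2 - real CARD('n)) * ?W u v w ?F"
  proof -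
    have 1: "(\<Sum>j\<in>UNIV. ?W (cdiff x (?e j) u) v w (?e j)) = ?W u v w ?F - ?W ?F v w u"
      using sum_cdiff[OF x bilinearI2[of "\<lambda>a b. ?W a v w b", OF l(1) l(4)], of u] by (simp add: lweyl_traces[OF x])
    have 2: "(\<Sum>j\<in>UNIV. ?W u (cdiff x (?e j) v) w (?e j)) = ?W u v w ?F - ?W u ?F w v"
      using sum_cdiff[OF x bilinearI2[of "\<lambda>a b. ?W u a w b", OF l(1) l(3)], of v] by (simp add: lweyl_traces[OF x])
    have 3: "(\<Sum>j\<in>UNIV. ?W u v (cdiff x (?e j) w) (?e j)) = ?W u v w ?F - ?W u v ?F w"
      using sum_cdiff[OF x bilinearI2[of "\<lambda>a b. ?W u v a b", OF l(1) l(2)], of w] by (simp add: lweyl_traces[OF x])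
    have 4: "(\<Sum>j\<in>UNIV. 2 * phi x (?e j) * ?W u v w (?e j)) = 2 * ?W u v w ?F"
      using sum_phi[OF x l(1)[of u v w]] by (simp add: mult.assoc sum_distrib_left[symmetric])
    show ?thesis unfolding sum.distrib sum_subtractf 1 2 3 4 sum_cdiff_diag[OF x l(1)] ldelta4_def ..
  qed
  also have "\<dots> = ldelta4 G (lweyl G) x u v w + (real CARD('n) - 3) * ?W u v w ?F"
  proof -
    have "?W ?F v w u + ?W u ?F w v = ?W u v w ?F" "?W u v ?F w = - ?W u v w ?F"
      using curvlikeD(4)[OF c, of u v w ?F] curvlikeD(3)[OF c, of u v ?F w] curvlike_pair[OF c, of ?F v w u]
        curvlike_pair[OF c, of u ?F w v]
        curvlikeD(3)[OF c, of w u v ?F] curvlikeD(2)[OF c, of w v u ?F] curvlikeD(3)[OF c, of v w ?F u]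
        curvlikeD(3)[OF c, of w u ?F v]
        curvlikeD(2)[OF c, of w u v ?F] curvlikeD(3)[OF c, of w v u ?F]
        curvlikeD(3)[OF c, of w v ?F u] curvlikeD(2)[OF c, of w v ?F u] curvlike_pair[OF c, of v w u ?F]
        curvlike_pair[OF c, of w u v ?F]
      by linarith+
    then show ?thesis by (simp add: algebra_simps)
  qed
  finally show ?thesis .
qed

lemma lcov3_conf:
  assumes x: "x \<in> S" and b: "mlin3 (b x)"
  shows "lcov3 (conf f G) b x p u v w = lcov3 G b x p u v w - b x (cdiff x p u) v w - b x u (cdiff x p v) w
    - b x u v (cdiff x p w)"
  unfolding lcov3_def christoffel_conf[OF x] by (simp add: mlin3_simps[OF b])

text \<open>Stated for a general \<open>b\<close>, to be applied to the divergence of the new Weyl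
  tensor. The contracted slot contributes n - 2 and the two free slots - 1 each, which gives n - 4;
  the two terms left over merge by the cyclic identity.\<close>

lemma ldelta1_conf:
  assumes x: "x \<in> S" and t: "tensor3 S b"
    and antisym: "\<And>u v w. b x u v w = - b x v u w"
    and cyclic: "\<And>u v w. b x u v w + b x v w u + b x w u v = 0"
    and tr: "\<And>u. (\<Sum>j\<in>UNIV. b x (onb G x j) u (onb G x j)) = 0"
  shows "ldelta1 (conf f G) b x u v = exp (- 2 * f x) * (ldelta1 G b x u v + (real CARD('n) - 4) * b x
    (gradf x) u v - b x (gradf x) v u)"
proof -
  let ?e = "onb G x" and ?F = "gradf x"
  note b = tensor3D(1)[OF t x]
  note l = mlin3_linear[OF b]
  have aa: "b x e e w = 0" for e w using antisym[of e e w] by simp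
  have "ldelta1 (conf f G) b x u v = exp (- 2 * f x) * (\<Sum>j\<in>UNIV. lcov3 (conf f G) b x (?e j) (?e j) u v)"
    unfolding ldelta1_def
    by (rule conf_onb_trace[OF x mlin3_linear(3)[OF cf.mlin3_lcov3(1)[OF t x]] cf.mlin3_lcov3(2)[OF t x]])
  also have "(\<Sum>j\<in>UNIV. lcov3 (conf f G) b x (?e j) (?e j) u v) =
     ldelta1 G b x u v - (2 - real CARD('n)) * b x ?F u v - (b x ?F u v - b x u ?F v) - (b x ?F u v - b x v u ?F)"
  proof -
    have 1: "(\<Sum>j\<in>UNIV. b x (cdiff x (?e j) (?e j)) u v) = (2 - real CARD('n)) * b x ?F u v"
      by (rule sum_cdiff_diag[OF x l(3)])
    have 2: "(\<Sum>j\<in>UNIV. b x (?e j) (cdiff x (?e j) u) v) = b x ?F u v - b x u ?F v"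
      using sum_cdiff[OF x bilinearI2[of "\<lambda>p q. b x q p v", OF l(3) l(2)], of u] by (simp add: aa)
    have 3: "(\<Sum>j\<in>UNIV. b x (?e j) u (cdiff x (?e j) v)) = b x ?F u v - b x v u ?F"
      using sum_cdiff[OF x bilinearI2[of "\<lambda>p q. b x q u p", OF l(3) l(1)], of v] by (simp add: tr)
    show ?thesis unfolding lcov3_conf[of x b, OF x b] sum_subtractf 1 2 3 ldelta1_def ..
  qed
  also have "\<dots> = ldelta1 G b x u v + (real CARD('n) - 4) * b x ?F u v - b x ?F v u"
    using cyclic[of v u ?F] by (simp add: algebra_simps)
  finally show ?thesis .
qed

end

section \<open>The generalized Bach tensor in one coordinate system\<close>

definition lact :: "(real^'n::finite \<Rightarrow> 'n form2) \<Rightarrow> real^'n \<Rightarrow> 'n form2 \<Rightarrow> 'n form2" where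
  "lact G x b z t = (\<Sum>i\<in>UNIV. \<Sum>j\<in>UNIV. b (onb G x i) (onb G x j) * lweyl G x (onb G x j) z t (onb G x i))"

definition lnabla :: "(real^'n::finite \<Rightarrow> 'n form2) \<Rightarrow> (real^'n \<Rightarrow> real^'n) \<Rightarrow> real^'n \<Rightarrow> real^'n \<Rightarrow> real^'n" where
  "lnabla G T x u = dird T x u + christoffel G x u (T x)"

definition lcotton :: "(real^'n::finite \<Rightarrow> 'n form2) \<Rightarrow> real^'n \<Rightarrow> real^'n \<Rightarrow> 'n form2" where
  "lcotton G x u v w = lcov2 G (lschouten G) x u v w - lcov2 G (lschouten G) x v u w"

text \<open>For an arbitrary vector field \<open>T\<close>. The multiples of the metric in \<open>E\<^sub>T\<close> are omitted, as
  the Weyl tensor is trace-free.\<close>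

definition lbach :: "(real^'n::finite \<Rightarrow> 'n form2) \<Rightarrow> (real^'n \<Rightarrow> real^'n) \<Rightarrow> real^'n \<Rightarrow> 'n form2" where
  "lbach G T x u v = (let n = real CARD('n) in
     ldelta1 G (ldelta4 G (lweyl G)) x u v + (n - 3) / (n - 2) * lact G x (lRic G x) u v
     - (n - 4) / (n - 2) * lact G x (sym2 (\<lambda>p q. lRic G x p q +
         (n - 2) * (G x (lnabla G T x p) q + G x (T x) p * G x (T x) q))) u v
     - (n - 3) * (n - 4) * (lact G x (\<lambda>p q. G x (T x) p * G x (T x) q) u v
         + sym2 (\<lambda>p q. lcotton G x (T x) p q - lweyl G x (T x) p q (T x)) u v))"

section \<open>Action of the Weyl tensor and the choice of the vector field\<close>

lemma lact_add: "lact G x (\<lambda>p q. b p q + c p q) z t = lact G x b z t + lact G x c z t"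
  unfolding lact_def by (simp add: sum.distrib algebra_simps)

lemma lact_cmult: "lact G x (\<lambda>p q. k * b p q) z t = k * lact G x b z t"
  unfolding lact_def by (simp add: sum_distrib_left mult.assoc)

context local_metric
begin

lemma lweyl_linear:
  assumes "x \<in> S"
  shows "linear (lweyl G x u v w)" "linear (\<lambda>w. lweyl G x u v w t)" "linear (\<lambda>v. lweyl G x u v w t)" "linear
    (\<lambda>u. lweyl G x u v w t)"
  using mlin4_linear[OF tensor4D(1)[OF tensor4_lweyl assms]] .

lemmas W_simps = mlin4_simps[OF tensor4D(1)[OF tensor4_lweyl]]

lemma lact_endo:
  assumes x: "x \<in> S"
  shows "lact G x (\<lambda>p q. G x (L p) q) z t = (\<Sum>i\<in>UNIV. lweyl G x (L (onb G x i)) z t (onb G x i))"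
  unfolding lact_def by (intro sum.cong refl onb_contract(1)[OF x lweyl_linear(4)[OF x]])

lemma lact_outer:
  assumes x: "x \<in> S"
  shows "lact G x (\<lambda>p q. G x a p * G x b q) z t = lweyl G x b z t a"
proof -
  have "lact G x (\<lambda>p q. G x a p * G x b q) z t = (\<Sum>i\<in>UNIV. G x a (onb G x i) * lweyl G x b z t (onb G x i))"
    unfolding lact_def mult.assoc sum_distrib_left[symmetric]
    by (intro sum.cong refl arg_cong2[of _ _ _ _ "(*)"] onb_contract(1)[OF x lweyl_linear(4)[OF x]])
  then show ?thesis using onb_contract(1)[OF x lweyl_linear(1)[OF x]] by simp
qed

lemma lact_metric:
  assumes x: "x \<in> S" and n: "CARD('n) \<ge> 3"
  shows "lact G x (G x) z t = 0"
  using lact_endo[OF x, of "\<lambda>p. p"] lweyl_trace[OF x n] by simp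

text \<open>By pair symmetry, transposing the argument of the Weyl action transposes its
  value.\<close>

lemma lact_sym2:
  assumes x: "x \<in> S"
  shows "lact G x (sym2 b) z t = lact G x b z t + lact G x b t z"
proof -
  note c = curvlike_lweyl[OF x]
  have s: "lweyl G x p z t q = lweyl G x q t z p" for p q
    using curvlike_pair[OF c, of p z t q] curvlikeD(2)[OF c, of t q p z] curvlikeD(3)[OF c, of q t p z] by simp
  have "lact G x (\<lambda>p q. b q p) z t = lact G x b t z"
    unfolding lact_def by (subst sum.swap) (intro sum.cong refl arg_cong2[of _ _ _ _ "(*)"] s)
  then show ?thesis unfolding sym2_def lact_add by simp
qed

lemma lcotton_ldelta4:
  assumes x: "x \<in> S" and n: "CARD('n) \<ge> 3"
  shows "ldelta4 G (lweyl G) x u v w = (real CARD('n) - 3) * lcotton G x u v w"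
  unfolding ldelta4_lweyl[OF x n] lcotton_def ..

lemma mlin3_lcotton: 
  assumes x: "x \<in> S"
  shows "mlin3 (lcotton G x)"
  by (rule mlin3I; rule linearI; simp add: lcotton_def mlin3_simps[OF mlin3_lcov2[OF tensor2_lschouten x]]
    algebra_simps)

lemma lact_nabla_nullity:
  assumes x: "x \<in> N" and N: "open N" "N \<subseteq> S" and d: "\<nu> differentiable (at x)"
    and null: "\<And>y u v w. y \<in> N \<Longrightarrow> lweyl G y (\<nu> y) u v w = 0"
  shows "lact G x (\<lambda>p q. G x (lnabla G \<nu> x p) q) z t = - ldelta4 G (lweyl G) x (\<nu> x) z t"
proof -
  have xS: "x \<in> S" using x N by auto
  have "lcov4 G (lweyl G) x v (\<nu> x) z t w = - lweyl G x (lnabla G \<nu> x v) z t w" for v w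
  proof -
    have "dird (\<lambda>y. lweyl G y (\<nu> y) z t w) x v = dird (\<lambda>y. 0::real) x v"
      by (rule fun_cong[OF dird_cong_open[OF N(1) x null]])
    moreover have "dird (\<lambda>y. lweyl G y (\<nu> y) z t w) x v = dird (\<lambda>y. lweyl G y (\<nu> x) z t w) x v + lweyl G x
      (dird \<nu> x v) z t w"
      by (rule slot_dird[OF open_S xS lweyl_linear(4) smooth_diff[OF tensor4D(2)[OF tensor4_lweyl] xS] d])
    ultimately show ?thesis
      unfolding lcov4_def lnabla_def null[OF x] by (simp add: W_simps[OF xS] dird_const)
  qed
  then show ?thesis unfolding lact_endo[OF xS] ldelta4_def by (simp add: sum_negf)
qed

text \<open>The two occurrences of \<open>\<nu>\<close>, in the derivative of \<open>T\<close> and in the Cotton term, cancel by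
  \<open>\<delta>W = (n - 3) d\<^sup>\<nabla>k\<close>.\<close>

lemma lbach_add_nullity:
  assumes x: "x \<in> N" and N: "open N" "N \<subseteq> S" and n: "CARD('n) \<ge> 4"
    and T: "T differentiable (at x)" and d: "\<nu> differentiable (at x)"
    and null: "\<And>y u v w. y \<in> N \<Longrightarrow> lweyl G y (\<nu> y) u v w = 0"
  shows "lbach G (\<lambda>y. T y + \<nu> y) x z t = lbach G T x z t"
proof -
  define m where "m = real CARD('n)"
  have m: "m - 2 \<noteq> 0" "m - 3 \<noteq> 0" using n by (auto simp: m_def)
  have xS: "x \<in> S" using x N by auto
  have n3: "CARD('n) \<ge> 3" using n by simp
  note c = curvlike_lweyl[OF xS]
  have z: "lweyl G x (\<nu> x) u v w = 0" "lweyl G x u v w (\<nu> x) = 0" for u v w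
    using null[OF x] curvlike_pair[OF c, of u v w "\<nu> x"] curvlikeD(2)[OF c, of w "\<nu> x" u v] by auto
  let ?M = "\<lambda>T p q. G x (lnabla G T x p) q + G x (T x) p * G x (T x) q"
  have nab: "lnabla G (\<lambda>y. T y + \<nu> y) x p = lnabla G T x p + lnabla G \<nu> x p" for p
    unfolding lnabla_def dird_add[OF T d] by (simp add: chr_simps[OF xS])
  have M: "lact G x (?M (\<lambda>y. T y + \<nu> y)) u v = lact G x (?M T) u v - (m - 3) * lcotton G x (\<nu> x) u v" for u v
  proof -
    have "lact G x (?M (\<lambda>y. T y + \<nu> y)) u v = lact G x (\<lambda>p q. G x (lnabla G T x p) q) u v
        + lact G x (\<lambda>p q. G x (lnabla G \<nu> x p) q) u v + lweyl G x (T x + \<nu> x) u v (T x + \<nu> x)"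
      unfolding nab G_simps(2)[OF xS] lact_add lact_outer[OF xS, unfolded G_simps(2)[OF xS]] lact_outer[OF
        xS, of "T x + \<nu> x" "T x + \<nu> x", unfolded G_simps(2)[OF xS]] ..
    moreover have "lact G x (\<lambda>p q. G x (lnabla G \<nu> x p) q) u v = - ((m - 3) * lcotton G x (\<nu> x) u v)"
      unfolding m_def lcotton_ldelta4[OF xS n3, symmetric] by (rule lact_nabla_nullity[OF x N d null])
    ultimately show ?thesis
      unfolding lact_add lact_outer[OF xS] by (simp add: W_simps[OF xS] z)
  qed
  have s: "lact G x (sym2 (\<lambda>p q. lRic G x p q + (m - 2) * ?M T p q)) z t =
     lact G x (lRic G x) z t + (m - 2) * lact G x (?M T) z t + (lact G x (lRic G x) t z + (m - 2) * lact G x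
       (?M T) t z)" for T
    unfolding lact_sym2[OF xS] lact_add[of G x "lRic G x"] lact_cmult ..
  \<comment> \<open>The factor n - 2 inside E cancels the denominator. Through \<open>M\<close> the
    field \<nu> then contributes (n - 3) (n - 4) times its symmetrized Cotton term, exactly what the
    last bracket of \<open>lbach\<close> takes away.\<close>
  have q: "(m - 4) / (m - 2) * (a + (m - 2) * b + (a' + (m - 2) * b')) = (m - 4) / (m - 2) * (a + a') + (m -
    4) * (b + b')" for a b a' b'
    using m by (simp add: field_simps)
  show ?thesis
    unfolding lbach_def Let_def m_def[symmetric] s[of T] s[of "\<lambda>y. T y + \<nu> y"] q M lact_outer[OF xS]
    by (simp add: sym2_def W_simps[OF xS] z mlin3_simps[OF mlin3_lcotton[OF xS]] algebra_simps)
qed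

end

context conformal
begin

text \<open>The argument \<open>b\<close> is held fixed. The Weyl tensor grows by exp (2 f), and
  each of the two contractions shrinks by exp (-2 f).\<close>

lemma lact_conf:
  assumes x: "x \<in> S" and b: "bilinear (b :: 'n form2)"
  shows "lact (conf f G) x b z t = exp (- 2 * f x) * lact G x b z t"
proof -
  note l = lweyl_linear[OF x]
  let ?e = "onb G x" and ?e' = "onb (conf f G) x"
  have "lact (conf f G) x b z t = exp (2 * f x) * (\<Sum>i\<in>UNIV. \<Sum>j\<in>UNIV. b (?e' i) (?e' j) * lweyl G x (?e' j) z
    t (?e' i))"
    unfolding lact_def lweyl_conf[OF x] by (simp add: sum_distrib_left mult_ac)
  also have "(\<Sum>i\<in>UNIV. \<Sum>j\<in>UNIV. b (?e' i) (?e' j) * lweyl G x (?e' j) z t (?e' i)) =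
     (\<Sum>i\<in>UNIV. exp (- 2 * f x) * (\<Sum>j\<in>UNIV. b (?e' i) (?e j) * lweyl G x (?e j) z t (?e' i)))"
    by (intro sum.cong refl conf_onb_trace[OF x]; rule linearI; simp add: bilinear_simps[OF b] W_simps[OF x]
      algebra_simps)
  also have "\<dots> = exp (- 2 * f x) * (\<Sum>i\<in>UNIV. (\<Sum>j\<in>UNIV. b (?e' i) (?e j) * lweyl G x (?e j) z t (?e' i)))"
    unfolding sum_distrib_left[symmetric] ..
  also have "(\<Sum>i\<in>UNIV. (\<Sum>j\<in>UNIV. b (?e' i) (?e j) * lweyl G x (?e j) z t (?e' i))) = exp (- 2 * f x) * lact
    G x b z t"
    unfolding lact_def
    by (rule conf_onb_trace[OF x]; rule linearI; simp add: bilinear_simps[OF b] W_simps[OF x] algebra_simps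
      sum.distrib sum_distrib_left)
  finally show ?thesis using exp2_cancel[of x "exp (- 2 * f x) * lact G x b z t"] by (simp add: mult_ac)
qed

lemma lcotton_conf:
  assumes x: "x \<in> S"
  shows "lcotton (conf f G) x u v w = lcotton G x u v w + lweyl G x u v w (gradf x)"
proof -
  have "(real CARD('n) - 3) * lcotton (conf f G) x u v w = (real CARD('n) - 3) * (lcotton G x u v w + lweyl
    G x u v w (gradf x))"
    using ldelta4_lweyl_conf[OF x, of u v w]
    unfolding cf.lcotton_ldelta4[OF x dim3] lcotton_ldelta4[OF x dim3] by (simp add: algebra_simps)
  moreover have "real CARD('n) - 3 \<noteq> 0" using dim4 by auto
  ultimately show ?thesis by simp
qed

text \<open>Only the inner divergence belongs to the new metric; the outer one is exchanged
  separately by \<open>ldelta1_conf\<close>, so the two changes of connection are never expanded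
  together. Differentiating W(., ., ., F) yields \<nabla>W contracted with F, and W contracted with
  the Hessian.\<close>

lemma ldelta1_ldelta4_conf:
  assumes x: "x \<in> S"
  shows "ldelta1 G (ldelta4 (conf f G) (lweyl (conf f G))) x u v =
    ldelta1 G (ldelta4 G (lweyl G)) x u v + (real CARD('n) - 3) * (ldelta4 G (lweyl G) x (gradf x) v u +
      lact G x (hess x) u v)"
proof -
  let ?e = "onb G x" and ?F = "gradf x" and ?n = "real CARD('n) - 3"
  let ?D = "ldelta4 G (lweyl G)"
  note t = tensor3_ldelta4[OF tensor4_lweyl]
  note cW = curvlike_lcov4[OF tensor4_lweyl curvlike_lweyl x]
  have d: "(\<lambda>y. ?D y u v w) differentiable (at x)" "(\<lambda>y. lweyl G y u v w t) differentiable (at x)" "gradf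
    differentiable (at x)" for u v w t
    by (rule smooth_diff[OF tensor3D(2)[OF t] x] smooth_diff[OF tensor4D(2)[OF tensor4_lweyl] x]
      smooth_diff[OF smooth_gradf x])+
  have "lcov3 G (ldelta4 (conf f G) (lweyl (conf f G))) x p u v w =
     lcov3 G ?D x p u v w + ?n * (lcov4 G (lweyl G) x p u v w ?F + lweyl G x u v w (nabF x p))" for p u v w
  proof -
    have s: "(\<lambda>y. lweyl G y u v w (gradf y)) differentiable (at x)"
       "dird (\<lambda>y. lweyl G y u v w (gradf y)) x p = dird (\<lambda>y. lweyl G y u v w ?F) x p + lweyl G x u v w (dird
        gradf x p)"
      using slot_differentiable[OF open_S x lweyl_linear(1) d(2,3)] slot_dird[OF open_S x lweyl_linear(1)
        d(2,3)] by auto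
    have "dird (\<lambda>y. ldelta4 (conf f G) (lweyl (conf f G)) y u v w) x p = dird (\<lambda>y. ?D y u v w + ?n * lweyl G
      y u v w (gradf y)) x p"
      by (rule fun_cong[OF dird_cong_open[OF open_S x]]) (rule ldelta4_lweyl_conf)
    also have "\<dots> = dird (\<lambda>y. ?D y u v w) x p + ?n * (dird (\<lambda>y. lweyl G y u v w ?F) x p + lweyl G x u v w
      (dird gradf x p))"
      unfolding s(2)[symmetric] by (simp only: dird_add d dird_cmult s(1) differentiable_mult differentiable_const)
    finally show ?thesis unfolding lcov3_def lcov4_def ldelta4_lweyl_conf[OF x] nabF_def
      by (simp add: W_simps[OF x] algebra_simps)
  qed
  then have "ldelta1 G (ldelta4 (conf f G) (lweyl (conf f G))) x u v = ldelta1 G ?D x u v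
      + ?n * ((\<Sum>j\<in>UNIV. lcov4 G (lweyl G) x (?e j) (?e j) u v ?F) + (\<Sum>j\<in>UNIV. lweyl G x (?e j) u v (nabF x
        (?e j))))"
    unfolding ldelta1_def by (simp add: sum.distrib sum_distrib_left[symmetric])
  also have "(\<Sum>j\<in>UNIV. lcov4 G (lweyl G) x (?e j) (?e j) u v ?F) = ?D x ?F v u"
    unfolding ldelta4_def
  proof (rule sum.cong[OF refl])
    fix j
    show "lcov4 G (lweyl G) x (?e j) (?e j) u v ?F = lcov4 G (lweyl G) x (?e j) ?F v u (?e j)"
      using curvlike_pair[OF cW, of _ "?e j" u v ?F] curvlikeD(2)[OF cW, of _ v ?F "?e j" u] curvlikeD(3)[OF
        cW, of _ ?F v "?e j" u] by simp
  qed
  also have "(\<Sum>j\<in>UNIV. lweyl G x (?e j) u v (nabF x (?e j))) = lact G x (hess x) u v"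
  proof -
    have "(\<Sum>j\<in>UNIV. lweyl G x (?e j) u v (nabF x (?e j))) = (\<Sum>j\<in>UNIV. \<Sum>i\<in>UNIV. hess x (?e j) (?e i) * lweyl
      G x (?e j) u v (?e i))"
      unfolding metric_nabF[OF x, symmetric] by (intro sum.cong refl onb_contract(1)[OF x lweyl_linear(1)[OF
        x], symmetric])
    also have "\<dots> = lact G x (hess x) u v"
      unfolding lact_def hess_sym[OF x, of "?e j" "?e i" for i j] by (subst sum.swap) (intro sum.cong refl
        arg_cong2[of _ _ _ _ "(*)"] hess_sym[OF x])
    finally show ?thesis .
  qed
  finally show ?thesis .
qed

text \<open>The weight of \<open>T'\<close> makes its dual with respect to the new metric equal to
  the dual of \<open>Z\<close> with respect to the old one. The Hessian comes from \<nabla>F; it is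
  what cancels the Hessian in the new Ricci tensor.\<close>

lemma lnabla_conf:
  assumes x: "x \<in> S" and T: "T differentiable (at x)"
  defines "T' \<equiv> \<lambda>y. exp (- 2 * f y) *\<^sub>R (T y + gradf y)" and "Z \<equiv> T x + gradf x"
  shows "conf f G x (lnabla (conf f G) T' x p) q = G x (lnabla G T x p) q + hess x p q
     - phi x p * G x Z q - phi x q * G x Z p + phi x Z * G x p q"
    "conf f G x (T' x) q = G x Z q"
proof -
  have d: "f differentiable (at x)" "gradf differentiable (at x)"
    by (rule smooth_diff[OF smooth_f x] smooth_diff[OF smooth_gradf x])+
  have d2: "(\<lambda>y. - 2 * f y) differentiable (at x)" using d by (simp add: differentiable_mult)
  have d3: "(\<lambda>y. exp (- 2 * f y)) differentiable (at x)"
    by (rule smooth_diff[OF _ x]) (intro smooth_on_exp smooth_on_mult open_S smooth_f smooth_on_const)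
  have ee: "exp (2 * f x) * (exp (- 2 * f x) * r) = r" for r by (simp add: exp_minus)
  have "dird T' x p = exp (- 2 * f x) *\<^sub>R (dird T x p + dird gradf x p - (2 * phi x p) *\<^sub>R Z)"
    unfolding T'_def Z_def dird_scaleR[OF d3 differentiable_add[OF T d(2)]] dird_add[OF T d(2)] dird_exp[OF
      d2] dird_cmult[OF d(1)] phi_def
    by (simp add: algebra_simps)
  then have "lnabla (conf f G) T' x p = exp (- 2 * f x) *\<^sub>R (lnabla G T x p + nabF x p - (2 * phi x p) *\<^sub>R Z
    + cdiff x p Z)"
    unfolding lnabla_def nabF_def christoffel_conf[OF x] by (simp add: T'_def Z_def chr_simps[OF x]
      cdiff_def phi_simps[OF x] G_simps[OF x] algebra_simps)
  moreover have "G x (lnabla G T x p + nabF x p - (2 * phi x p) *\<^sub>R Z + cdiff x p Z) q = G x (lnabla G T x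
    p) q + hess x p q
     - phi x p * G x Z q - phi x q * G x Z p + phi x Z * G x p q"
    unfolding cdiff_def by (simp add: G_simps[OF x] metric_nabF[OF x] metric_gradf[OF x] metric_sym[OF x, of p Z])
  ultimately show "conf f G x (lnabla (conf f G) T' x p) q = G x (lnabla G T x p) q + hess x p q
     - phi x p * G x Z q - phi x q * G x Z p + phi x Z * G x p q"
    by (simp only: conf_def G_simps(6)[OF x] real_scaleR_def ee)
  show "conf f G x (T' x) q = G x Z q"
    unfolding conf_def T'_def Z_def by (simp only: G_simps(6)[OF x] real_scaleR_def ee)
qed

lemma lbach_conf:
  assumes x: "x \<in> S" and T: "T differentiable (at x)"
  shows "lbach (conf f G) (\<lambda>y. exp (- 2 * f y) *\<^sub>R (T y + gradf y)) x u v = exp (- 2 * f x) * lbach G T x u v"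
proof -
  define m where "m = real CARD('n)"
  have m: "m - 2 \<noteq> 0" "m - 3 \<noteq> 0" using dim4 by (auto simp: m_def)
  define Z where "Z = T x + gradf x"
  let ?G = "conf f G" and ?T = "\<lambda>y. exp (- 2 * f y) *\<^sub>R (T y + gradf y)" and ?F = "gradf x"
  let ?W = "lweyl G x" and ?C = "lcotton G x" and ?a = "exp (- 2 * f x)" and ?D = "ldelta4 G (lweyl G) x"
  note c = curvlike_lweyl[OF x]
  have nab: "?G x (lnabla ?G ?T x p) q = G x (lnabla G T x p) q + hess x p q
     - phi x p * G x Z q - phi x q * G x Z p + phi x Z * G x p q"
    "?G x (?T x) q = G x Z q" for p q
    unfolding Z_def by (rule lnabla_conf[OF x T])+
  have D: "?D p q r = (m - 3) * ?C p q r" for p q r unfolding m_def by (rule lcotton_ldelta4[OF x dim3])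
  have D': "ldelta4 ?G (lweyl ?G) x p q r = (m - 3) * (?C p q r + ?W p q r ?F)" for p q r
    unfolding m_def cf.lcotton_ldelta4[OF x dim3] lcotton_conf[OF x] ..
  have W: "?W a v u b = ?W b u v a" for a b
    using curvlike_pair[OF c, of a v u b] curvlikeD(2)[OF c, of u b a v] curvlikeD(3)[OF c, of b u a v] by simp
  have tr: "(\<Sum>j\<in>UNIV. ldelta4 ?G (lweyl ?G) x (onb G x j) w (onb G x j)) = 0" for w
  proof -
    have "(\<Sum>j\<in>UNIV. ldelta4 ?G (lweyl ?G) x (onb ?G x j) w (onb ?G x j)) = 0"
      by (rule cf.ldelta4_lweyl_trace[OF x dim3])
    then show ?thesis
      using conf_onb_trace[OF x, of "\<lambda>p q. ldelta4 ?G (lweyl ?G) x p w q"] mlin3_linear[OF tensor3D(1)[OF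
        cf.tensor3_ldelta4[OF cf.tensor4_lweyl] x]]
      by simp
  qed
  have A1: "ldelta1 ?G (ldelta4 ?G (lweyl ?G)) x u v = ?a * (ldelta1 G (ldelta4 G (lweyl G)) x u v
     + (m - 3) * ((m - 3) * ?C ?F v u + lact G x (hess x) u v)
     + (m - 4) * ((m - 3) * (?C ?F u v + ?W ?F u v ?F)) - (m - 3) * (?C ?F v u + ?W ?F u v ?F))"
  proof -
    let ?b = "ldelta4 ?G (lweyl ?G)"
    have "ldelta1 ?G ?b x u v = ?a * (ldelta1 G ?b x u v + (m - 4) * ?b x ?F u v - ?b x ?F v u)"
      unfolding m_def
    proof (rule ldelta1_conf[OF x])
      show "tensor3 S ?b" by (rule cf.tensor3_ldelta4[OF cf.tensor4_lweyl])
      show "?b x p q r = - ?b x q p r" for p q r by (rule cf.ldelta4_curvlike(1)[OF cf.tensor4_lweyl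
        cf.curvlike_lweyl x])
      show "?b x p q r + ?b x q r p + ?b x r p q = 0" for p q r by (rule cf.ldelta4_curvlike(2)[OF
        cf.tensor4_lweyl cf.curvlike_lweyl x])
    qed (rule tr)
    then show ?thesis
      unfolding ldelta1_ldelta4_conf[OF x] D D' m_def[symmetric] W[of ?F ?F] by (simp only: add_ac)
  qed
  have bR: "bilinear (lRic G x)" by (rule tensor2D(1)[OF tensor2_lRic x])
  have outer: "(\<lambda>p q. phi x p * phi x q) = (\<lambda>p q. G x ?F p * G x ?F q)" by (simp add: metric_gradf[OF x])
  \<comment> \<open>All multiples of the metric in the change of the Ricci tensor are gathered,
    since the Weyl tensor annihilates the metric.\<close>
  define k where "k = (m - 2) * (phi x ?F / 2) + trh x"
  have R: "lRic ?G x = (\<lambda>p q. lRic G x p q + ((-(m - 2)) * hess x p q + ((m - 2) * (phi x p * phi x q) + (-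
    k) * G x p q)))"
    unfolding lRic_conf[OF x] schd_def k_def m_def by (intro ext) (simp add: algebra_simps)
  have A2: "lact ?G x (lRic ?G x) u v = ?a * (lact G x (lRic G x) u v - (m - 2) * lact G x (hess x) u v + (m
    - 2) * ?W ?F u v ?F)"
    unfolding lact_conf[OF x tensor2D(1)[OF cf.tensor2_lRic x]] 
    unfolding R lact_add lact_cmult outer lact_outer[OF x] lact_metric[OF x dim3] by (simp add: algebra_simps)
  let ?M = "\<lambda>p q. lRic G x p q + (m - 2) * (G x (lnabla G T x p) q + G x (T x) p * G x (T x) q)"
  define k' where "k' = (m - 2) * phi x Z - k"
  \<comment> \<open>The Hessians cancel, and the \<open>phi\<close> terms complete the square: with
    \<open>phi\<close> dual to F, the form dual to Z minus \<open>phi\<close> is the one dual to T.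
    So E changes only by a multiple of the metric.\<close>
  have E: "lRic ?G x p q + (m - 2) * (?G x (lnabla ?G ?T x p) q + ?G x (?T x) p * ?G x (?T x) q) = ?M p q +
    k' * G x p q" for p q
    unfolding nab R k'_def by (simp add: Z_def G_simps[OF x] metric_gradf[OF x] algebra_simps)
  have bM: "bilinear (sym2 (\<lambda>p q. ?M p q + k' * G x p q))"
  proof -
    have "linear (dird T x)" by (rule linear_dird[OF T])
    note this[THEN linear_add] this[THEN linear_cmul]
    then show ?thesis unfolding sym2_def lnabla_def
      by (intro bilinearI2; intro linearI; simp add: G_simps[OF x] chr_simps[OF x] bilinear_simps[OF bR]
        algebra_simps)
  qed
  have A3: "lact ?G x (sym2 (\<lambda>p q. lRic ?G x p q + (m - 2) * (?G x (lnabla ?G ?T x p) q + ?G x (?T x) p * ?G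
    x (?T x) q))) u v
      = ?a * lact G x (sym2 ?M) u v"
    unfolding E lact_conf[OF x bM]
    unfolding lact_sym2[OF x] lact_add[of G x ?M] lact_cmult[of G x k'] lact_metric[OF x dim3] by simp
  have bT: "bilinear (\<lambda>p q. G x Z p * G x Z q)"
    by (rule bilinearI2; rule linearI; simp add: G_simps[OF x] algebra_simps)
  have A4: "lact ?G x (\<lambda>p q. ?G x (?T x) p * ?G x (?T x) q) u v = ?a * ?W Z u v Z"
    unfolding nab lact_conf[OF x bT] lact_outer[OF x] ..
  have Tx: "?T x = ?a *\<^sub>R Z" by (simp add: Z_def)
  have A5: "lcotton ?G x (?T x) p q - lweyl ?G x (?T x) p q (?T x) = ?a * (?C Z p q - ?W Z p q (T x))" for p q
  proof -
    have ea: "exp (2 * f x) * (?a * (?a * r)) = ?a * r" for r by (simp add: exp_minus field_simps)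
    have "lweyl ?G x (?a *\<^sub>R Z) p q (?a *\<^sub>R Z) = ?a * ?W Z p q Z"
      by (simp only: lweyl_conf[OF x] W_simps[OF x] real_scaleR_def ea)
    moreover have "lcotton ?G x (?a *\<^sub>R Z) p q = ?a * (?C Z p q + ?W Z p q ?F)"
      by (simp only: lcotton_conf[OF x] W_simps[OF x] mlin3_simps[OF mlin3_lcotton[OF x]] real_scaleR_def
        distrib_left)
    moreover have "?W Z p q Z = ?W Z p q (T x) + ?W Z p q ?F" by (simp add: Z_def W_simps[OF x])
    ultimately show ?thesis unfolding Tx by (simp add: algebra_simps)
  qed
  have s: "sym2 (\<lambda>p q. ?a * b p q) u v = ?a * sym2 b u v" for b by (simp add: sym2_def algebra_simps)
  \<comment> \<open>The coefficient (n - 3) / (n - 2) of the Ricci term turns n - 2 Hessians into n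
    - 3, the number produced by the double divergence with the opposite sign.\<close>
  have q: "(m - 3) / (m - 2) * (?a * (r - (m - 2) * h + (m - 2) * w)) = ?a * ((m - 3) / (m - 2) * r - (m -
    3) * h + (m - 3) * w)" for r h w
    using m by (simp add: field_simps)
  have "lbach ?G ?T x u v = ?a * (ldelta1 G (ldelta4 G (lweyl G)) x u v
     + (m - 3) * ((m - 3) * ?C ?F v u + lact G x (hess x) u v)
     + (m - 4) * ((m - 3) * (?C ?F u v + ?W ?F u v ?F)) - (m - 3) * (?C ?F v u + ?W ?F u v ?F)
     + ((m - 3) / (m - 2) * lact G x (lRic G x) u v - (m - 3) * lact G x (hess x) u v + (m - 3) * ?W ?F u v ?F)
     - (m - 4) / (m - 2) * lact G x (sym2 ?M) u v
     - (m - 3) * (m - 4) * (?W Z u v Z + sym2 (\<lambda>p q. ?C Z p q - ?W Z p q (T x)) u v))"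
    unfolding lbach_def Let_def m_def[symmetric] A1 A2 A3 A4 A5 s q by (simp add: algebra_simps)
  \<comment> \<open>All terms with F must vanish. The Cotton terms of F from the double divergence
    add up to (n - 3) (n - 4) symmetrized copies, which cancel those in \<open>Z\<close>. The terms
    W(F, ., ., F) cancel in the same way, and the mixed terms in T and F by pair symmetry.\<close>
  also have "\<dots> = ?a * lbach G T x u v"
    unfolding lbach_def Let_def m_def[symmetric] lact_outer[OF x] sym2_def[of "\<lambda>p q. lcotton G x _ p q - _ p
      q"] Z_def
    by (simp add: W_simps[OF x] mlin3_simps[OF mlin3_lcotton[OF x]] W[of "T x" "gradf x"] W[of "gradf x" "T
      x"] W[of ?F ?F] W[of "T x" "T x"] algebra_simps)
  finally show ?thesis .
qed

end

section \<open>Regularity of the vector field \<open>T\<close>\<close>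

definition triple :: "('n::finite \<Rightarrow> real^'n) \<Rightarrow> (real^'n \<Rightarrow> real^'n \<Rightarrow> 'n covec) \<Rightarrow> (real^'n \<Rightarrow> real^'n \<Rightarrow> 'n
  covec) \<Rightarrow> real" where
  "triple e K L = (\<Sum>i\<in>UNIV. \<Sum>a\<in>UNIV. \<Sum>b\<in>UNIV. K (e a) (e b) (e i) * L (e a) (e b) (e i))"

lemma triple_scale: 
  assumes "mlin3 K" "mlin3 L"
  shows "triple (\<lambda>j. c *\<^sub>R e j) K L = c ^ 6 * triple e K L"
  unfolding triple_def
  by (simp add: mlin3_simps[OF assms(1)] mlin3_simps[OF assms(2)] sum_distrib_left algebra_simps
    power_numeral_reduce)

lemma triple_linear:
  "triple e (\<lambda>a b i. K a b i + K' a b i) L = triple e K L + triple e K' L"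
  "triple e (\<lambda>a b i. c * K a b i) L = c * triple e K L"
  "triple e L (\<lambda>a b i. K a b i + K' a b i) = triple e L K + triple e L K'"
  "triple e L (\<lambda>a b i. c * K a b i) = c * triple e L K"
  unfolding triple_def by (simp_all add: sum.distrib sum_distrib_left algebra_simps)

text \<open>The bases are exchanged one contraction at a time, the innermost sum first.\<close>

lemma triple_indep:
  fixes h :: "'n::finite form2"
  assumes h: "metric_form h" "is_onb h e" "is_onb h e'" and K: "mlin3 K" and L: "mlin3 L"
  shows "triple e K L = triple e' K L"
proof -
  note s = mlin3_simps[OF K] mlin3_simps[OF L] algebra_simps sum.distrib sum_distrib_left
  have "triple e K L = (\<Sum>i\<in>UNIV. \<Sum>a\<in>UNIV. \<Sum>b\<in>UNIV. K (e a) (e' b) (e i) * L (e a) (e' b) (e i))"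
    unfolding triple_def by (intro sum.cong refl onb_sum_indep[OF h, of "\<lambda>p q. K _ p _ * L _ q _"]; rule
      linearI; simp add: s)
  also have "\<dots> = (\<Sum>i\<in>UNIV. \<Sum>a\<in>UNIV. \<Sum>b\<in>UNIV. K (e' a) (e' b) (e i) * L (e' a) (e' b) (e i))"
    by (intro sum.cong refl onb_sum_indep[OF h, of "\<lambda>p q. \<Sum>b\<in>UNIV. K p (e' b) _ * L q (e' b) _"]; rule
      linearI; simp add: s)
  also have "\<dots> = triple e' K L"
    unfolding triple_def
    by (intro onb_sum_indep[OF h, of "\<lambda>p q. \<Sum>a\<in>UNIV. \<Sum>b\<in>UNIV. K (e' a) (e' b) p * L (e' a) (e' b) q"]; rule
      linearI; simp add: s)
  finally show ?thesis .
qed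

definition nullity :: "(real^'n::finite \<Rightarrow> real^'n \<Rightarrow> 'n form2) \<Rightarrow> (real^'n) set" where
  "nullity W = {\<nu>. \<forall>u v w. W \<nu> u v w = 0}"

text \<open>Twice the bilinear form of the endomorphism \<open>w_endo\<close>, and the associated endomorphism
  of the tangent space.\<close>

definition w_form :: "('n::finite \<Rightarrow> real^'n) \<Rightarrow> (real^'n \<Rightarrow> real^'n \<Rightarrow> 'n form2) \<Rightarrow> 'n form2" where
  "w_form e W u v = triple e (\<lambda>a b i. W a b i u) (\<lambda>a b i. W a b i v)"

definition w_op :: "'n::finite form2 \<Rightarrow> ('n \<Rightarrow> real^'n) \<Rightarrow> (real^'n \<Rightarrow> real^'n \<Rightarrow> 'n form2) \<Rightarrow> real^'n \<Rightarrow> real^'n" where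
  "w_op h e W u = sharp (\<lambda>_. h) () (w_form e W u)"

text \<open>These two conditions characterize \<open>T\<close>: it is orthogonal to the nullity of the Weyl tensor,
  which is the kernel of \<open>w_form\<close>, and it solves the linear equation in the definition of \<open>T\<close>.\<close>

definition T_cond :: "'n::finite form2 \<Rightarrow> ('n \<Rightarrow> real^'n) \<Rightarrow> (real^'n \<Rightarrow> real^'n \<Rightarrow> 'n form2) \<Rightarrow>
    (real^'n \<Rightarrow> 'n form2) \<Rightarrow> real^'n \<Rightarrow> bool" where
  "T_cond h e W D t \<longleftrightarrow> (\<forall>\<nu>\<in>nullity W. h t \<nu> = 0) \<and>
     (\<forall>y. (real CARD('n) - 3) * w_form e W t y = triple e D (\<lambda>a b i. W a b i y))"

lemma mlin4_fix4: "mlin4 W \<Longrightarrow> mlin3 (\<lambda>a b i. W a b i u)"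
  by (auto simp: mlin4_def mlin3_def bilinear_def)

lemma curvlike_nullity4:
  assumes "curvlike W"
  shows "(\<forall>u v w. W \<nu> u v w = 0) \<longleftrightarrow> (\<forall>u v w. W u v w \<nu> = 0)"
  using curvlike_pair[OF assms] curvlikeD(2)[OF assms] by (metis neg_0_equal_iff_equal)

text \<open>In an orthonormal basis the full contraction of \<open>K\<close> with itself is a sum of
  squares. This makes the nullity of the Weyl tensor the kernel of \<open>w_form\<close>.\<close>

lemma triple_eq_0:
  fixes h :: "'n::finite form2"
  assumes h: "metric_form h" "is_onb h e" and K: "mlin3 K" and z: "triple e K K = 0"
  shows "K u v w = 0"
proof -
  have k: "K (e a) (e b) (e i) = 0" for a b i
  proof -
    have "(\<Sum>a\<in>UNIV. \<Sum>b\<in>UNIV. K (e a) (e b) (e i) * K (e a) (e b) (e i)) = 0"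
      using z unfolding triple_def by (subst (asm) sum_nonneg_eq_0_iff) (auto intro!: sum_nonneg)
    then have "(\<Sum>b\<in>UNIV. K (e a) (e b) (e i) * K (e a) (e b) (e i)) = 0"
      by (subst (asm) sum_nonneg_eq_0_iff) (auto intro!: sum_nonneg)
    then show ?thesis by (subst (asm) sum_nonneg_eq_0_iff) auto
  qed
  have 1: "K u (e b) (e i) = 0" for b i
    using onb_sum_real(1)[OF h mlin3_linear(3)[OF K], of u "e b" "e i"] by (simp add: k)
  have 2: "K u v (e i) = 0" for i
    using onb_sum_real(1)[OF h mlin3_linear(2)[OF K], of v u "e i"] by (simp add: 1)
  show ?thesis using onb_sum_real(1)[OF h mlin3_linear(1)[OF K], of w u v] by (simp add: 2)
qed

text \<open>The orthogonal projector for the Euclidean inner product. The dimension of its kernel is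
  what \<open>T_smooth\<close> compares with the complement of the nullity at nearby points.\<close>

lemma ex_projector:
  fixes E :: "(real^'n::finite) set"
  assumes "subspace E"
  obtains P where "linear P" "\<And>u. P u \<in> E" "\<And>u. u \<in> E \<Longrightarrow> P u = u" "dim {u. P u = 0} + dim E = CARD('n)"
proof -
  obtain B where B: "B \<subseteq> E" "pairwise orthogonal B" "\<And>x. x \<in> B \<Longrightarrow> norm x = 1" "independent B" "card B = dim
    E" "span B = E"
    using orthonormal_basis_subspace[OF assms] by metis
  have f: "finite B" using B(4) independent_imp_finite by blast
  define P where "P = (\<lambda>u. \<Sum>b\<in>B. (u \<bullet> b) *\<^sub>R b)"
  have lP: "linear P" unfolding P_def
    by (rule linearI) (simp_all add: inner_add_left scaleR_add_left sum.distrib scaleR_sum_right)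
  have PE: "P u \<in> E" for u unfolding P_def B(6)[symmetric]
    by (intro span_sum span_scale span_base)
  have Pb: "P u \<bullet> b = u \<bullet> b" if "b \<in> B" for u b
  proof -
    have "P u \<bullet> b = (\<Sum>c\<in>B. (u \<bullet> c) * (c \<bullet> b))" by (simp add: P_def inner_sum_left)
    also have "\<dots> = (\<Sum>c\<in>B. if c = b then u \<bullet> b else 0)"
    proof (rule sum.cong[OF refl])
      fix c assume "c \<in> B"
      then show "(u \<bullet> c) * (c \<bullet> b) = (if c = b then u \<bullet> b else 0)"
        using B(2,3) that by (auto simp: pairwise_def orthogonal_def norm_eq_1)
    qed
    finally show ?thesis using f that by simp
  qed
  have o: "(u - P u) \<bullet> v = 0" if "v \<in> E" for u v
  proof -
    have "orthogonal (u - P u) v"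
      using orthogonal_to_span[of v B "u - P u"] that B(6) Pb by (simp add: orthogonal_def inner_diff_left)
    then show ?thesis by (simp add: orthogonal_def)
  qed
  have id: "P u = u" if "u \<in> E" for u
  proof -
    have "u - P u \<in> E" using that PE assms by (simp add: subspace_diff)
    then have "(u - P u) \<bullet> (u - P u) = 0" using o by blast
    then show ?thesis by simp
  qed
  have "{u. P u = 0} = {y \<in> UNIV. \<forall>x\<in>E. orthogonal x y}"
  proof (intro set_eqI iffI; simp)
    fix u assume "P u = 0"
    then show "\<forall>x\<in>E. orthogonal x u" using o[of _ u] by (auto simp: orthogonal_def inner_commute)
  next
    fix u assume a: "\<forall>x\<in>E. orthogonal x u"
    then have "u \<bullet> b = 0" if "b \<in> B" for b using B(1) that by (auto simp: orthogonal_def inner_commute)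
    then show "P u = 0" by (simp add: P_def)
  qed
  then have "dim {u. P u = 0} + dim E = CARD('n)"
    using dim_subspace_orthogonal_to_vectors[OF assms subspace_UNIV] by simp
  then show ?thesis using that[OF lP PE id] by blast
qed

text \<open>The injective map \<open>A\<close> turns orthogonality for \<open>h\<close> into
  Euclidean orthogonality, since h(u, v) is the Euclidean product of A u and v.\<close>

lemma dim_metric_complement:
  fixes h :: "'n::finite form2"
  assumes h: "metric_form h" and E: "subspace E"
  shows "dim {w. \<forall>\<nu>\<in>E. h w \<nu> = 0} + dim E \<le> CARD('n)"
proof -
  let ?C = "{w. \<forall>\<nu>\<in>E. h w \<nu> = 0}"
  define A where "A = (\<lambda>u. \<chi> i. h u (axis i 1))"
  have A: "A u \<bullet> v = h u v" for u v
  proof -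
    have "h u v = h u (\<Sum>i\<in>UNIV. (v $ i) *\<^sub>R axis i 1)" by (simp only: vec_expand[symmetric])
    also have "\<dots> = A u \<bullet> v" by (simp add: metric_form_sums[OF h] metric_form_simps[OF h] A_def inner_vec_def
      mult.commute)
    finally show ?thesis ..
  qed
  have lA: "linear A" unfolding A_def
    by (rule linearI) (simp_all add: vec_eq_iff metric_form_simps[OF h])
  have "inj A" by (rule injI) (metis A metric_form_nondegenerate[OF h])
  then have "inj_on A (span ?C)" by (rule inj_on_subset) simp
  then have "dim ?C = dim (A ` ?C)"
    by (rule dim_image_eq[OF lA, symmetric])
  also have "\<dots> \<le> dim {y \<in> UNIV. \<forall>x\<in>E. orthogonal x y}"
    by (rule dim_subset) (auto simp: orthogonal_def inner_commute[of _ "A _"] A)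
  finally show ?thesis
    using dim_subspace_orthogonal_to_vectors[OF E subspace_UNIV] by simp
qed

text \<open>Kept free of coordinates because it serves twice: for the tensors in a chart, and for
  the tensors at a point of the manifold from which \<open>T_field\<close> is defined.\<close>

locale curvature_at =
  fixes h :: "'n::finite form2" and e :: "'n \<Rightarrow> real^'n" and W :: "real^'n \<Rightarrow> real^'n \<Rightarrow> 'n form2"
  assumes h: "metric_form h" and e: "is_onb h e" and W: "curvlike W"
begin

lemmas h_simps = metric_form_simps[OF h]
lemmas W_lin = mlin4_simps[OF curvlikeD(1)[OF W]]

lemma subspace_nullity: "subspace (nullity W)"
  by (rule subspaceI) (auto simp: nullity_def W_lin)

lemma w_form_bilinear: "linear (w_form e W u)" "linear (\<lambda>u. w_form e W u v)"
  by (rule linearI; simp add: w_form_def W_lin triple_linear)+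

lemma w_form_sym: "w_form e W u v = w_form e W v u"
  by (simp add: w_form_def triple_def mult.commute)

lemma triple_null: "\<nu> \<in> nullity W \<Longrightarrow> triple e D (\<lambda>a b i. W a b i \<nu>) = 0"
  unfolding nullity_def using curvlike_nullity4[OF W, of \<nu>] by (simp add: triple_def)

lemma w_form_null: "\<nu> \<in> nullity W \<Longrightarrow> w_form e W u \<nu> = 0"
  unfolding w_form_def by (rule triple_null)

lemma w_form_eq_0:
  assumes "w_form e W u u = 0"
  shows "u \<in> nullity W"
proof -
  have "W p v w u = 0" for p v w
    by (rule triple_eq_0[OF h e mlin4_fix4[OF curvlikeD(1)[OF W]]]) (rule assms[unfolded w_form_def])
  then show ?thesis using curvlike_nullity4[OF W, of u] by (simp add: nullity_def)
qed

lemma metric_w_op: "h (w_op h e W u) v = w_form e W u v"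
  unfolding w_op_def by (rule metric_sharp[of "\<lambda>_. h", OF h w_form_bilinear(1)])

lemma linear_w_op: "linear (w_op h e W)"
  unfolding w_op_def[abs_def] by (rule linear_sharp[of "\<lambda>_. h", OF h w_form_bilinear])

lemma w_op_kernel: "w_op h e W u = 0 \<longleftrightarrow> u \<in> nullity W"
proof
  assume "w_op h e W u = 0"
  then have "w_form e W u u = 0" using metric_w_op[of u u] by (simp add: h_simps)
  then show "u \<in> nullity W" using w_form_eq_0 by blast
next
  assume "u \<in> nullity W"
  then have "h (w_op h e W u) w = h 0 w" for w
    using metric_w_op[of u w] w_form_null[of u w] w_form_sym[of u w] by (simp add: h_simps)
  then show "w_op h e W u = 0" using metric_form_nondegenerate[OF h] by blast
qed

lemma w_op_perp: "\<nu> \<in> nullity W \<Longrightarrow> h (w_op h e W u) \<nu> = 0"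
  by (simp add: metric_w_op w_form_null)

lemma perp_null_eq_0:
  assumes "u \<in> nullity W" "\<And>\<nu>. \<nu> \<in> nullity W \<Longrightarrow> h u \<nu> = 0"
  shows "u = 0"
  using assms(2)[OF assms(1)] h by (metis less_irrefl metric_form_def)

end

context local_metric
begin

text \<open>One contraction at a time; at each stage the partial sum is a smooth field of bilinear
  forms in the next slot to be contracted.\<close>

lemma smooth_triple:
  assumes K: "tensor3 S K" and L: "tensor3 S L"
  shows "smooth_on (\<lambda>x. triple (onb G x) (K x) (L x)) S"
proof -
  note s = mlin3_simps[OF tensor3D(1)[OF K]] mlin3_simps[OF tensor3D(1)[OF L]]
  have 1: "smooth_on (\<lambda>x. \<Sum>b\<in>UNIV. K x u (onb G x b) v * L x u' (onb G x b) v') S" for u v u' v'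
    by (rule smooth_onb_trace[of "\<lambda>x p q. K x u p v * L x u' q v'"], unfold tensor2_def)
      (auto intro!: bilinearI2 linearI smooth_on_mult[OF open_S] tensor3D(2)[OF K] tensor3D(2)[OF L] simp: s
        algebra_simps)
  have 2: "smooth_on (\<lambda>x. \<Sum>a\<in>UNIV. \<Sum>b\<in>UNIV. K x (onb G x a) (onb G x b) v * L x (onb G x a) (onb G x b) v')
    S" for v v'
    by (rule smooth_onb_trace[of "\<lambda>x p q. \<Sum>b\<in>UNIV. K x p (onb G x b) v * L x q (onb G x b) v'"], unfold
      tensor2_def)
      (auto intro!: bilinearI2 linearI 1 simp: s algebra_simps sum.distrib sum_distrib_left)
  show ?thesis unfolding triple_def
    by (rule smooth_onb_trace[of "\<lambda>x p q. \<Sum>a\<in>UNIV. \<Sum>b\<in>UNIV. K x (onb G x a) (onb G x b) p * L x (onb G x a)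
      (onb G x b) q"], unfold tensor2_def)
      (auto intro!: bilinearI2 linearI 2 simp: s algebra_simps sum.distrib sum_distrib_left)
qed

lemma curvature_at_lweyl: "x \<in> S \<Longrightarrow> curvature_at (G x) (onb G x) (lweyl G x)"
  by (simp add: curvature_at_def metric onb_at curvlike_lweyl)

abbreviation lnull where "lnull x \<equiv> nullity (lweyl G x)"
abbreviation lQ where "lQ x \<equiv> w_form (onb G x) (lweyl G x)"
abbreviation lw where "lw x \<equiv> w_op (G x) (onb G x) (lweyl G x)"
abbreviation lT_cond where "lT_cond x \<equiv> T_cond (G x) (onb G x) (lweyl G x) (ldelta4 G (lweyl G) x)"

lemmas subspace_lnull = curvature_at.subspace_nullity[OF curvature_at_lweyl]
lemmas lQ_bilinear = curvature_at.w_form_bilinear[OF curvature_at_lweyl]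
lemmas lQ_eq_0 = curvature_at.w_form_eq_0[OF curvature_at_lweyl]
lemmas metric_lw = curvature_at.metric_w_op[OF curvature_at_lweyl]
lemmas linear_lw = curvature_at.linear_w_op[OF curvature_at_lweyl]
lemmas lw_kernel = curvature_at.w_op_kernel[OF curvature_at_lweyl]
lemmas lw_perp = curvature_at.w_op_perp[OF curvature_at_lweyl]
lemmas perp_null_eq_0 = curvature_at.perp_null_eq_0[OF curvature_at_lweyl]

lemma smooth_lw: "smooth_on (\<lambda>x. lw x u) S"
proof -
  have "smooth_on (\<lambda>x. lQ x u v) S" for u v
    unfolding w_form_def by (rule smooth_triple[OF tensor4_fix4[OF tensor4_lweyl] tensor4_fix4[OF tensor4_lweyl]])
  from smooth_on_sharp[OF open_S metric smooth_metric lQ_bilinear(1) this] show ?thesis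
    unfolding w_op_def sharp_def[abs_def] .
qed

text \<open>Near a point \<open>x\<^sub>0\<close> where the nullity has locally constant dimension, \<open>T = w y\<close> where \<open>y\<close> solves
  \<open>(w\<^sup>2 + P) y = \<theta>\<close> for a fixed projector \<open>P\<close> onto the nullity at \<open>x\<^sub>0\<close>; this equation is
  uniquely solvable, and its solution lies in the kernel of \<open>P\<close> by a dimension count.\<close>

lemma T_smooth:
  assumes n: "CARD('n) \<ge> 4" and N: "open N" "N \<subseteq> S" "x0 \<in> N"
    and dim: "\<And>x. x \<in> N \<Longrightarrow> dim (lnull x) = dim (lnull x0)"
    and T: "\<And>x. x \<in> N \<Longrightarrow> lT_cond x (T x)"
  obtains N' where "open N'" "x0 \<in> N'" "N' \<subseteq> N" "smooth_on T N'"
proof -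
  have x0: "x0 \<in> S" using N by auto
  have n3: "real CARD('n) - 3 \<noteq> 0" using n by auto
  obtain P where P: "linear P" "\<And>u. P u \<in> lnull x0" "\<And>u. u \<in> lnull x0 \<Longrightarrow> P u = u"
    "dim {u. P u = 0} + dim (lnull x0) = CARD('n)"
    using ex_projector[OF subspace_lnull[OF x0]] by metis
  \<comment> \<open>The square is needed because a solution y of an equation with w alone may have a
    component in the nullity at x. The vector w y is always orthogonal to it, and w (w y) = w T then
    forces w y = T.\<close>
  define M where "M = (\<lambda>x u. lw x (lw x u) + P u)"
  define \<theta> where "\<theta> = (\<lambda>x y. triple (onb G x) (ldelta4 G (lweyl G) x) (\<lambda>a b i. lweyl G x a b i y) / (real
    CARD('n) - 3))"
  define c where "c = (\<lambda>x. sharp G x (\<theta> x))"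
  have linM: "linear (M x)" if "x \<in> S" for x
    unfolding M_def by (rule linearI) (simp_all add: linear_rules[OF linear_lw[OF that]] linear_rules[OF
      P(1)] algebra_simps)
  have smM: "smooth_on (\<lambda>x. M x u) S" for u
    unfolding M_def by (intro smooth_on_add smooth_on_const open_S slot_smooth[OF open_S linear_lw smooth_lw
      smooth_lw])
  have injM: "inj (M x0)"
  proof -
    have "u = 0" if "M x0 u = 0" for u
    proof -
      \<comment> \<open>The values of w are orthogonal to the nullity at \<open>x0\<close> and those
        of \<open>P\<close> lie in it, so the two summands of \<open>M x0 u = 0\<close> vanish
        separately.\<close>
      have "G x0 (P u) \<nu> = 0" if "\<nu> \<in> lnull x0" for \<nu>
        using lw_perp[OF x0 that, of "lw x0 u"] \<open>M x0 u = 0\<close> G_simps(2)[OF x0, of "lw x0 (lw x0 u)" "P u" \<nu>]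
        by (simp add: M_def G_simps[OF x0])
      then have Pu: "P u = 0" using perp_null_eq_0[OF x0 P(2)] by blast
      then have "lw x0 u \<in> lnull x0" using that lw_kernel[OF x0] by (simp add: M_def)
      then have "lw x0 u = 0" using perp_null_eq_0[OF x0 _ lw_perp[OF x0]] by blast
      then show "u = 0" using lw_kernel[OF x0] P(3) Pu by metis
    qed
    then show ?thesis using linear_injective_0[OF linM[OF x0]] by blast
  qed
  define N' where "N' = N \<inter> {x \<in> S. inj (M x)}"
  have oN': "open N'" unfolding N'_def by (intro open_Int N(1) open_inj_set[OF open_S linM smM])
  have N'S: "N' \<subseteq> S" by (auto simp: N'_def)
  note t3 = tensor3_ldelta4[OF tensor4_lweyl]
  have lth: "linear (\<theta> x)" if "x \<in> S" for x
    unfolding \<theta>_def by (rule linearI) (simp_all add: W_simps[OF that] triple_linear add_divide_distrib)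
  have smth: "smooth_on (\<lambda>x. \<theta> x u) S" for u
    unfolding \<theta>_def by (intro smooth_on_divide open_S smooth_triple[OF t3 tensor4_fix4[OF tensor4_lweyl]]
      smooth_on_const n3)
  have smc: "smooth_on c S"
    unfolding c_def by (rule smooth_on_sharp[OF open_S metric smooth_metric lth smth])
  have cG: "G x (c x) v = \<theta> x v" if "x \<in> S" for x v
    unfolding c_def by (rule metric_sharp[of G x, OF metric[OF that] lth[OF that]])
  have wT: "lw x (T x) = c x" if "x \<in> N" for x
  proof -
    have xS: "x \<in> S" using that N by auto
    have "G x (lw x (T x)) v = G x (c x) v" for v
      using T[OF that] n3 unfolding metric_lw[OF xS] cG[OF xS] T_cond_def \<theta>_def by (simp add: field_simps)
    then show ?thesis using metric_form_nondegenerate[OF metric[OF xS]] by blast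
  qed
  have sol: "\<exists>y. M x y = c x \<and> T x = lw x y" if "x \<in> N'" for x
  proof -
    have xN: "x \<in> N" and xS: "x \<in> S" and inj: "inj (M x)" using that by (auto simp: N'_def)
    note lw = linear_lw[OF xS]
    define C where "C = {u. P u = 0}"
    define V where "V = {w. \<forall>\<nu>\<in>lnull x. G x w \<nu> = 0}"
    have sC: "subspace C" unfolding C_def by (rule subspaceI) (simp_all add: linear_rules[OF P(1)])
    have sV: "subspace V" unfolding V_def by (rule subspaceI) (simp_all add: G_simps[OF xS])
    define L where "L = (\<lambda>u. lw x (lw x u))"
    have lL: "linear L" unfolding L_def using linear_compose[OF lw lw] by (simp add: comp_def)
    have LM: "L u = M x u" if "u \<in> C" for u using that by (simp add: L_def M_def C_def)
    have "inj_on L (span C)" unfolding span_eq_iff[THEN iffD2, OF sC]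
      using inj LM by (auto simp: inj_on_def)
    then have "dim (L ` C) = dim C" by (rule dim_image_eq[OF lL])
    \<comment> \<open>Here the constancy of the dimension enters: \<open>C\<close> is complementary
      to the nullity at \<open>x0\<close>, \<open>V\<close> to the nullity at x.\<close>
    moreover have "dim V \<le> dim C"
      using dim_metric_complement[OF metric[OF xS] subspace_lnull[OF xS]] P(4) dim[OF xN] by (simp add:
        V_def C_def)
    moreover have "L ` C \<subseteq> V" by (auto simp: L_def V_def lw_perp[OF xS])
    ultimately have "L ` C = V" using subspace_dim_equal[OF linear_subspace_image[OF lL sC] sV] by simp
    moreover have "c x \<in> V" unfolding V_def wT[OF xN, symmetric] using lw_perp[OF xS] by auto
    ultimately obtain y where y: "y \<in> C" "c x = L y" by (auto simp: image_iff set_eq_iff)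
    have "T x - lw x y \<in> lnull x"
      using y(2) wT[OF xN] lw_kernel[OF xS, of "T x - lw x y"] by (simp add: L_def linear_diff[OF lw])
    moreover have "G x (T x - lw x y) \<nu> = 0" if "\<nu> \<in> lnull x" for \<nu>
      using T[OF xN] that lw_perp[OF xS that] by (simp add: T_cond_def G_simps[OF xS])
    ultimately have "T x - lw x y = 0" using perp_null_eq_0[OF xS] by blast
    then show ?thesis using y LM by auto
  qed
  define y where "y = (\<lambda>x. SOME y. M x y = c x \<and> T x = lw x y)"
  have y: "M x (y x) = c x" "T x = lw x (y x)" if "x \<in> N'" for x
    using someI_ex[OF sol[OF that]] by (auto simp: y_def)
  have sub: "smooth_on F S \<Longrightarrow> smooth_on F N'" for F :: "real^'n \<Rightarrow> real^'n"
    by (rule smooth_on_subset[OF open_S oN' N'S])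
  have "smooth_on y N'"
    by (rule smooth_on_solution[OF oN', of M c]) (use linM smM smc sub y N'S in \<open>auto simp: N'_def\<close>)
  then have "smooth_on (\<lambda>x. lw x (y x)) N'"
    by (rule slot_smooth[OF oN' _ sub[OF smooth_lw], rotated]) (use linear_lw N'S in auto)
  then have "smooth_on T N'" using smooth_on_cong[OF oN', of T "\<lambda>x. lw x (y x)"] y(2) by blast
  then show thesis using that[OF oN'] N x0 injM by (auto simp: N'_def)
qed

end

context conformal
begin

lemma lnull_conf: "x \<in> S \<Longrightarrow> cf.lnull x = lnull x"
  unfolding nullity_def by (simp add: lweyl_conf)

lemma triple_conf:
  assumes x: "x \<in> S" and K: "mlin3 K" and L: "mlin3 L"
  shows "triple (onb (conf f G) x) K L = exp (- f x) ^ 6 * triple (onb G x) K L"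
proof -
  have e2: "exp (2 * f x) * (exp (- f x) * exp (- f x)) = 1" by (simp add: exp_add[symmetric])
  have o: "is_onb (conf f G x) (\<lambda>j. exp (- f x) *\<^sub>R onb G x j)"
    using onb_at[OF x] e2 unfolding is_onb_def conf_def by (auto simp: G_simps[OF x])
  show ?thesis
    using triple_indep[OF cf.metric[OF x] cf.onb_at[OF x] o K L] triple_scale[OF K L] by simp
qed

text \<open>A full contraction of two 3-tensors scales by exp (-6 f) and each Weyl factor by exp (2
  f), so the two sides of the linear equation scale by exp (-2 f) and exp (-4 f). With the extra
  term of the new divergence, the difference in question lies in the kernel of
  \<open>w_form\<close>.\<close>

lemma T_cond_conf:
  assumes x: "x \<in> S" and t: "lT_cond x t" and t': "cf.lT_cond x t'"
  shows "t' - exp (- 2 * f x) *\<^sub>R (t + gradf x) \<in> lnull x"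
proof -
  let ?W = "lweyl G x" and ?D = "ldelta4 G (lweyl G) x" and ?n = "real CARD('n) - 3" and ?a = "exp (f x)"
    and ?e = "onb G x"
  have n: "?n \<noteq> 0" using dim4 by auto
  note mW = mlin4_fix4[OF curvlikeD(1)[OF curvlike_lweyl[OF x]]]
  note mW' = mlin4_fix4[OF curvlikeD(1)[OF cf.curvlike_lweyl[OF x]]]
  have mD: "mlin3 (ldelta4 (conf f G) (lweyl (conf f G)) x)" by (rule tensor3D(1)[OF cf.tensor3_ldelta4[OF
    cf.tensor4_lweyl] x])
  have e: "exp (2 * f x) = ?a * ?a" "exp (- 2 * f x) = inverse ?a * inverse ?a" "exp (- f x) = inverse ?a"
    by (simp_all add: exp_add[symmetric] flip: exp_minus)
  have a: "?a \<noteq> 0" by simp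
  have "lQ x (t' - exp (- 2 * f x) *\<^sub>R (t + gradf x)) y = 0" for y
  proof -
    have h1: "?n * lQ x t y = triple ?e ?D (\<lambda>a b i. ?W a b i y)"
      using t by (simp add: T_cond_def)
    have "?n * triple (onb (conf f G) x) (\<lambda>a b i. lweyl (conf f G) x a b i t') (\<lambda>a b i. lweyl (conf f G) x a
      b i y) =
        triple (onb (conf f G) x) (ldelta4 (conf f G) (lweyl (conf f G)) x) (\<lambda>a b i. lweyl (conf f G) x a b i y)"
      using t' by (simp add: T_cond_def w_form_def)
    then have h2: "?n * ((?a * ?a) * ((?a * ?a) * lQ x t' y)) = (?a * ?a) * (triple ?e ?D (\<lambda>a b i. ?W a b i
      y) + ?n * lQ x (gradf x) y)"
      unfolding triple_conf[OF x mW' mW'] triple_conf[OF x mD mW']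
      unfolding lweyl_conf[OF x] ldelta4_lweyl_conf[OF x] triple_linear e w_form_def
      using a by simp
    have "(?a * ?a) * (?n * ((?a * ?a) * lQ x t' y)) = (?a * ?a) * (?n * (lQ x t y + lQ x (gradf x) y))"
      using h2 unfolding h1[symmetric] by (simp only: mult_ac distrib_left)
    then have "?n * ((?a * ?a) * lQ x t' y) = ?n * (lQ x t y + lQ x (gradf x) y)"
      using a by (simp only: mult_cancel_left mult_eq_0_iff simp_thms)
    then have "(?a * ?a) * lQ x t' y = lQ x t y + lQ x (gradf x) y" using n by simp
    then show ?thesis using a unfolding e by (simp add: linear_rules[OF lQ_bilinear(2)[OF x]] field_simps)
  qed
  then show ?thesis using lQ_eq_0[OF x] by blast
qed

end

section \<open>Changes of coordinates\<close>

definition overlap :: "('a, 'n) chart \<Rightarrow> ('a, 'n) chart \<Rightarrow> (real^'n) set" where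
  "overlap c c' = snd c ` (fst c \<inter> fst c')"

locale atlas =
  fixes A :: "('a::topological_space, 'n::finite) chart set"
  assumes atlas: "smooth_atlas A"
begin

lemma chart:
  assumes "c \<in> A"
  shows "open (fst c)" "open (snd c ` fst c)" "q \<in> fst c \<Longrightarrow> chart_inv c (snd c q) = q"
    "x \<in> snd c ` fst c \<Longrightarrow> chart_inv c x \<in> fst c" "x \<in> snd c ` fst c \<Longrightarrow> snd c (chart_inv c x) = x"
    "continuous_on (snd c ` fst c) (chart_inv c)"
  using atlas assms unfolding smooth_atlas_def is_chart_def homeomorphism_def by auto

lemma open_chart_image:
  assumes c: "c \<in> A" and V: "open V"
  shows "open (snd c ` (fst c \<inter> V))"
proof -
  have "snd c ` (fst c \<inter> V) = snd c ` fst c \<inter> chart_inv c -` V"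
    using chart(3)[OF c] by (auto simp: image_iff)
  then show ?thesis using continuous_open_preimage[OF chart(6)[OF c] chart(2)[OF c] V] by simp
qed

lemma overlap:
  assumes "c \<in> A" "c' \<in> A"
  shows "open (overlap c c')" "smooth_on (snd c' \<circ> chart_inv c) (overlap c c')" "overlap c c' \<subseteq> snd c ` fst c"
  using open_chart_image[OF assms(1) chart(1)[OF assms(2)]] atlas assms
  unfolding smooth_atlas_def overlap_def by auto

lemma overlapD:
  assumes "c \<in> A" "x \<in> overlap c c'"
  shows "chart_inv c x \<in> fst c" "chart_inv c x \<in> fst c'" "snd c (chart_inv c x) = x" "x \<in> snd c ` fst c"
  using assms chart(3)[OF assms(1)] unfolding overlap_def by auto

lemma overlapI: "q \<in> fst c \<Longrightarrow> q \<in> fst c' \<Longrightarrow> snd c q \<in> overlap c c'"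
  unfolding overlap_def by auto

lemma coord_change_dird: "coord_change c c' q = dird (snd c' \<circ> chart_inv c) (snd c q)"
  unfolding coord_change_def dird_def[abs_def] by simp

lemma transition_derivative:
  assumes "c \<in> A" "c' \<in> A" "q \<in> fst c" "q \<in> fst c'"
  shows "((snd c' \<circ> chart_inv c) has_derivative coord_change c c' q) (at (snd c q))"
  unfolding coord_change_dird
  by (rule has_derivative_dird, rule smooth_on_differentiable[OF overlap(1,2)[OF assms(1,2)] overlapI[OF
    assms(3,4)]])

lemma linear_coord_change:
  assumes "c \<in> A" "c' \<in> A" "q \<in> fst c" "q \<in> fst c'"
  shows "linear (coord_change c c' q)"
  using transition_derivative[OF assms] has_derivative_linear by blast

lemma derivative_chain:
  fixes h :: "'a \<Rightarrow> 'b::real_normed_vector"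
  assumes c: "c \<in> A" "c' \<in> A" and q: "q \<in> fst c" "q \<in> fst c'"
    and h: "(h \<circ> chart_inv c') differentiable (at (snd c' q))"
  shows "((h \<circ> chart_inv c) has_derivative (\<lambda>v. dird (h \<circ> chart_inv c') (snd c' q) (coord_change c c' q v)))
    (at (snd c q))"
proof -
  have e: "(snd c' \<circ> chart_inv c) (snd c q) = snd c' q" by (simp add: chart(3)[OF c(1) q(1)])
  have "(((h \<circ> chart_inv c') \<circ> (snd c' \<circ> chart_inv c)) has_derivative (dird (h \<circ> chart_inv c') (snd c' q) \<circ>
    coord_change c c' q)) (at (snd c q))"
    by (rule diff_chain_at[OF transition_derivative[OF c q]]) (unfold e, rule has_derivative_dird[OF h])
  then have "(((h \<circ> chart_inv c') \<circ> (snd c' \<circ> chart_inv c)) has_derivative (\<lambda>v. dird (h \<circ> chart_inv c') (snd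
    c' q) (coord_change c c' q v))) (at (snd c q))"
    by (simp only: comp_def)
  then show ?thesis
    by (rule has_derivative_transform_within_open[OF _ overlap(1)[OF c] overlapI[OF q]])
       (use overlapD[OF c(1), of _ c'] chart(3)[OF c(2)] in auto)
qed

lemma coord_change_comp:
  assumes c: "c \<in> A" "c' \<in> A" "c'' \<in> A" and q: "q \<in> fst c" "q \<in> fst c'" "q \<in> fst c''"
  shows "coord_change c' c'' q (coord_change c c' q u) = coord_change c c'' q u"
proof -
  have "(snd c'' \<circ> chart_inv c') differentiable at (snd c' q)"
    using transition_derivative[OF c(2,3) q(2,3)] differentiable_def by blast
  from dird_eqI[OF derivative_chain[OF c(1,2) q(1,2) this]] show ?thesis
    unfolding coord_change_dird by simp
qed

lemma coord_change_id:
  assumes c: "c \<in> A" and q: "q \<in> fst c"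
  shows "coord_change c c q u = u"
  unfolding coord_change_dird
proof (rule dird_eqI)
  show "((snd c \<circ> chart_inv c) has_derivative (\<lambda>u. u)) (at (snd c q))"
    by (rule has_derivative_transform_within_open[OF has_derivative_ident chart(2)[OF c]])
      (use q chart(5)[OF c] in auto)
qed

lemma chart_at:
  assumes "q \<in> fst c" "c \<in> A"
  shows "chart_at A q \<in> A" "q \<in> fst (chart_at A q)"
  using someI_ex[of "\<lambda>c. c \<in> A \<and> q \<in> fst c"] assms unfolding chart_at_def by blast+

section \<open>Vector fields read in a fixed chart\<close>

text \<open>The isomorphism from the tangent space at q, as encoded by the selected chart, to its
  description in \<open>c\<close>; \<open>coord_field\<close> is the inverse.\<close>

definition to_chart where "to_chart c q = coord_change (chart_at A q) c q"

lemma to_chart: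
  assumes "c \<in> A" "q \<in> fst c"
  shows "linear (to_chart c q)" "linear (\<lambda>u. coord_field A c u q)"
    "to_chart c q (coord_field A c u q) = u" "coord_field A c (to_chart c q u) q = u"
proof -
  note ca = chart_at[OF assms(2,1)]
  show "linear (to_chart c q)" unfolding to_chart_def by (rule linear_coord_change[OF ca(1) assms(1) ca(2)
    assms(2)])
  show "linear (\<lambda>u. coord_field A c u q)"
    unfolding coord_field_def using linear_coord_change[OF assms(1) ca(1) assms(2) ca(2)] by (simp only:
      eta_contract_eq)
  show "to_chart c q (coord_field A c u q) = u"
    unfolding to_chart_def coord_field_def coord_change_comp[OF assms(1) ca(1) assms(1) assms(2) ca(2) assms(2)]
    by (rule coord_change_id[OF assms])
  show "coord_field A c (to_chart c q u) q = u"
    unfolding to_chart_def coord_field_def coord_change_comp[OF ca(1) assms(1) ca(1) ca(2) assms(2) ca(2)]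
    by (rule coord_change_id[OF ca])
qed

lemma to_chart_at:
  assumes "c \<in> A" "q \<in> fst c"
  shows "to_chart (chart_at A q) q u = u" "coord_field A (chart_at A q) u q = u"
  using to_chart(3)[OF chart_at[OF assms(2,1)]] coord_change_id[OF chart_at[OF assms(2,1)]]
  by (simp_all add: to_chart_def coord_field_def)

definition vrep where "vrep c Y x = to_chart c (chart_inv c x) (Y (chart_inv c x))"

lemma vrep_at: "c \<in> A \<Longrightarrow> q \<in> fst c \<Longrightarrow> vrep c Y (snd c q) = to_chart c q (Y q)"
  by (simp add: vrep_def chart)

lemma components_eq: "components A c Y q = to_chart c q (Y q)"
  by (simp add: components_def to_chart_def)

text \<open>The derivative is defined in the chart selected for q; by the chain rule it may be
  computed in any chart around q.\<close>

lemma chart_deriv_eq: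
  fixes h :: "'a \<Rightarrow> 'b::real_normed_vector"
  assumes c: "c \<in> A" and q: "q \<in> fst c" and h: "(h \<circ> chart_inv c) differentiable (at (snd c q))"
  shows "chart_deriv A q h v = dird (h \<circ> chart_inv c) (snd c q) (to_chart c q v)"
proof -
  note ca = chart_at[OF q c]
  have "chart_deriv A q h v = dird (h \<circ> chart_inv (chart_at A q)) (snd (chart_at A q) q) v"
    by (simp add: chart_deriv_def dird_def)
  also have "\<dots> = dird (h \<circ> chart_inv c) (snd c q) (to_chart c q v)"
    unfolding to_chart_def by (rule dird_eqI[OF derivative_chain[OF ca(1) c ca(2) q h]])
  finally show ?thesis .
qed

lemma vrep_change:
  assumes c: "c \<in> A" "c' \<in> A" and x: "x \<in> overlap c c'"
  shows "components A c' Y (chart_inv c x) = dird (snd c' \<circ> chart_inv c) x (vrep c Y x)"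
proof -
  note o = overlapD[OF c(1) x]
  note ca = chart_at[OF o(1) c(1)]
  show ?thesis
    unfolding vrep_def to_chart_def components_def
    using coord_change_comp[OF ca(1) c(1,2) ca(2) o(1,2), of "Y (chart_inv c x)"]
    by (simp add: coord_change_dird[of c c'] o(3))
qed

lemma transition_deriv_smooth:
  assumes c: "c \<in> A" "c' \<in> A"
  shows "smooth_on (\<lambda>x. dird (snd c' \<circ> chart_inv c) x u) (overlap c c')"
    "x \<in> overlap c c' \<Longrightarrow> linear (dird (snd c' \<circ> chart_inv c) x)"
  using smooth_on_dird[OF overlap(2)[OF c]] linear_dird[OF smooth_on_differentiable[OF overlap(1,2)[OF c]]] by auto

text \<open>The bracket is defined in the chart selected for q. In the passage to \<open>c\<close>
  the second derivatives of the transition map cancel by their symmetry.\<close>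

lemma lie_bracket_rep:
  assumes c: "c \<in> A" and q: "q \<in> fst c"
    and X: "vrep c X differentiable (at (snd c q))" and Y: "vrep c Y differentiable (at (snd c q))"
  shows "to_chart c q (lie_bracket A X Y q) =
     dird (vrep c Y) (snd c q) (vrep c X (snd c q)) - dird (vrep c X) (snd c q) (vrep c Y (snd c q))"
proof -
  define c0 where "c0 = chart_at A q"
  have c0: "c0 \<in> A" "q \<in> fst c0" using chart_at[OF q c] by (auto simp: c0_def)
  let ?x = "snd c q" and ?\<tau> = "snd c0 \<circ> chart_inv c"
  note ov = overlap[OF c c0(1)] and x = overlapI[OF q c0(2)] and sm = transition_deriv_smooth[OF c c0(1)]
  have comp: "chart_deriv A q (components A c0 Z) v = dird (\<lambda>y. dird ?\<tau> y (vrep c Z ?x)) ?x (to_chart c q v)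
    + dird ?\<tau> ?x (dird (vrep c Z) ?x (to_chart c q v))"
    if Z: "vrep c Z differentiable (at ?x)" for Z v
  proof -
    have e: "(components A c0 Z \<circ> chart_inv c) y = dird ?\<tau> y (vrep c Z y)" if "y \<in> overlap c c0" for y
      using vrep_change[OF c c0(1) that] by simp
    have d: "(\<lambda>y. dird ?\<tau> y u) differentiable (at ?x)" for u by (rule smooth_on_differentiable[OF ov(1) sm(1) x])
    have "(components A c0 Z \<circ> chart_inv c) differentiable (at ?x)"
      by (rule differentiable_transfer_open[OF ov(1) x slot_differentiable[OF ov(1) x sm(2) d Z] e])
    from chart_deriv_eq[OF c q this]
    have "chart_deriv A q (components A c0 Z) v = dird (\<lambda>y. dird ?\<tau> y (vrep c Z y)) ?x (to_chart c q v)"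
      using dird_cong_open[OF ov(1) x e] by simp
    then show ?thesis using slot_dird[OF ov(1) x sm(2) d Z] by simp
  qed
  have "lie_bracket A X Y q = dird ?\<tau> ?x (dird (vrep c Y) ?x (vrep c X ?x)) - dird ?\<tau> ?x (dird (vrep c X) ?x
    (vrep c Y ?x))"
    unfolding lie_bracket_def c0_def[symmetric] comp[OF X] comp[OF Y] vrep_at[OF c q, symmetric]
    using dird_commute[OF ov(1,2) x, of "vrep c Y ?x" "vrep c X ?x"] by simp
  also have "\<dots> = coord_field A c (dird (vrep c Y) ?x (vrep c X ?x) - dird (vrep c X) ?x (vrep c Y ?x)) q"
    unfolding coord_field_def c0_def[symmetric] coord_change_dird by (simp add: linear_diff[OF sm(2)[OF x]])
  finally show ?thesis using to_chart(3)[OF c q] by simp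
qed

text \<open>The components in \<open>c\<close> solve a linear equation whose matrix is the Jacobian
  of the transition map from \<open>c\<close> to \<open>c'\<close>.\<close>

lemma smooth_vrep_coord_field:
  assumes c: "c \<in> A" "c' \<in> A"
  shows "smooth_on (vrep c (coord_field A c' u)) (overlap c c')"
proof (rule smooth_on_solution[OF overlap(1)[OF c], where M = "\<lambda>x. dird (snd c' \<circ> chart_inv c) x" and b = "\<lambda>x. u"])
  fix x assume x: "x \<in> overlap c c'"
  note o = overlapD[OF c(1) x]
  show "linear (dird (snd c' \<circ> chart_inv c) x)" by (rule transition_deriv_smooth(2)[OF c x])
  show "inj (dird (snd c' \<circ> chart_inv c) x)"
  proof (rule injI)
    fix a b assume "dird (snd c' \<circ> chart_inv c) x a = dird (snd c' \<circ> chart_inv c) x b"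
    then have "coord_change c c' (chart_inv c x) a = coord_change c c' (chart_inv c x) b"
      by (simp add: coord_change_dird o(3))
    then show "a = b"
      using coord_change_comp[OF c(1,2,1) o(1,2,1)] coord_change_id[OF c(1) o(1)] by metis
  qed
  show "dird (snd c' \<circ> chart_inv c) x (vrep c (coord_field A c' u) x) = u"
    unfolding vrep_change[OF c x, symmetric] components_eq using to_chart(3)[OF c(2) o(2)] .
qed (use transition_deriv_smooth[OF c] overlap[OF c] smooth_on_const in auto)

lemma vrep_coord_field:
  assumes "c \<in> A" "x \<in> snd c ` fst c"
  shows "vrep c (coord_field A c u) x = u"
  unfolding vrep_def using to_chart(3)[OF assms(1) chart(4)[OF assms]] .

lemma lie_bracket_coord_field:
  assumes c: "c \<in> A" and q: "q \<in> fst c"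
  shows "lie_bracket A (coord_field A c u) (coord_field A c v) q = 0"
proof -
  have x: "snd c q \<in> snd c ` fst c" using q by auto
  have d: "vrep c (coord_field A c u) differentiable (at (snd c q))" "dird (vrep c (coord_field A c u)) (snd
    c q) w = 0" for u w
    using differentiable_cong_open[OF chart(2)[OF c] x, of "vrep c (coord_field A c u)" "\<lambda>_. u"]
      dird_cong_open[OF chart(2)[OF c] x, of "vrep c (coord_field A c u)" "\<lambda>_. u"] vrep_coord_field[OF c]
    by (auto simp: dird_const)
  have "to_chart c q (lie_bracket A (coord_field A c u) (coord_field A c v) q) = 0"
    unfolding lie_bracket_rep[OF c q d(1) d(1)] d(2) by simp
  then show ?thesis using to_chart(4)[OF c q] linear_0[OF to_chart(2)[OF c q]] by metis
qed

end

section \<open>Riemannian geometry in charts\<close>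

text \<open>The value 0 outside of the chart makes the representation of \<open>\<psi>\<^sup>-\<^sup>2 g\<close> a pointwise multiple of
  that of \<open>g\<close> everywhere.\<close>

definition metric_rep :: "('a, 'n::finite) chart set \<Rightarrow> ('a, 'n) tensor2 \<Rightarrow> ('a, 'n) chart \<Rightarrow> real^'n \<Rightarrow> 'n
  form2" where
  "metric_rep A g c x u v = (if x \<in> snd c ` fst c
     then g (chart_inv c x) (coord_field A c u (chart_inv c x)) (coord_field A c v (chart_inv c x)) else 0)"

locale riemannian = atlas A for A :: "('a::topological_space, 'n::finite) chart set" +
  fixes g :: "('a, 'n) tensor2"
  assumes riemannian: "riemannian_metric A g"
begin

lemma metric_form_g: "c \<in> A \<Longrightarrow> q \<in> fst c \<Longrightarrow> metric_form (g q)"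
  using riemannian unfolding riemannian_metric_def metric_form_def points_def by auto

lemma metric_rep_at:
  assumes "c \<in> A" "q \<in> fst c"
  shows "metric_rep A g c (snd c q) (to_chart c q u) (to_chart c q v) = g q u v"
  using assms by (simp add: metric_rep_def chart to_chart)

lemma local_metric_rep:
  assumes c: "c \<in> A"
  shows "local_metric (snd c ` fst c) (metric_rep A g c)"
proof
  show "open (snd c ` fst c)" by (rule chart(2)[OF c])
  fix u v
  have "smooth_on ((\<lambda>q. g q (coord_field A c u q) (coord_field A c v q)) \<circ> chart_inv c) (snd c ` fst c)"
    using riemannian c unfolding riemannian_metric_def by blast
  then show "smooth_on (\<lambda>x. metric_rep A g c x u v) (snd c ` fst c)"
    by (subst smooth_on_cong[OF chart(2)[OF c]]) (auto simp: metric_rep_def)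
next
  fix x assume x: "x \<in> snd c ` fst c"
  define q where "q = chart_inv c x"
  have q: "q \<in> fst c" using chart(4)[OF c x] by (simp add: q_def)
  note h = metric_form_g[OF c q] and l = to_chart(2)[OF c q]
  have e: "metric_rep A g c x = (\<lambda>u v. g q (coord_field A c u q) (coord_field A c v q))"
    using x by (intro ext) (simp add: metric_rep_def q_def)
  have "coord_field A c u q \<noteq> 0" if "u \<noteq> 0" for u
    using to_chart(3)[OF c q, of u] linear_0[OF to_chart(1)[OF c q]] that by auto
  then have "\<forall>u. u \<noteq> 0 \<longrightarrow> 0 < g q (coord_field A c u q) (coord_field A c u q)"
    using h by (auto simp: metric_form_def)
  moreover have "\<forall>u v. g q (coord_field A c u q) (coord_field A c v q) = g q (coord_field A c v q)
    (coord_field A c u q)"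
    using metric_form_sym[OF h] by blast
  moreover have "bilinear (\<lambda>u v. g q (coord_field A c u q) (coord_field A c v q))"
    by (rule bilinearI2; rule linearI; simp add: linear_add[OF l] linear_cmul[OF l] metric_form_simps[OF h])
  ultimately show "metric_form (metric_rep A g c x)" unfolding e metric_form_def by blast
qed

text \<open>The brackets remove the derivatives of the components of X and Z; of the derivatives of
  Y only the one along X remains.\<close>

lemma koszul_rep:
  assumes c: "c \<in> A" and q: "q \<in> fst c"
    and d: "vrep c X differentiable (at (snd c q))" "vrep c Y differentiable (at (snd c q))" "vrep c Z
      differentiable (at (snd c q))"
  shows "koszul A g X Y Z q = 2 * metric_rep A g c (snd c q)
    (dird (vrep c Y) (snd c q) (vrep c X (snd c q)) + christoffel (metric_rep A g c) (snd c q) (vrep c X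
      (snd c q)) (vrep c Y (snd c q)))
    (vrep c Z (snd c q))"
proof -
  let ?G = "metric_rep A g c" and ?x = "snd c q" and ?S = "snd c ` fst c"
  interpret L: local_metric ?S ?G by (rule local_metric_rep[OF c])
  have x: "?x \<in> ?S" using q by auto
  have vd: "vf_deriv A V (\<lambda>q. g q (P q) (Q q)) q =
     dird (\<lambda>y. ?G y (vrep c P ?x) (vrep c Q ?x)) ?x (vrep c V ?x)
     + ?G ?x (dird (vrep c P) ?x (vrep c V ?x)) (vrep c Q ?x) + ?G ?x (vrep c P ?x) (dird (vrep c Q) ?x
       (vrep c V ?x))"
    if P: "vrep c P differentiable (at ?x)" and Q: "vrep c Q differentiable (at ?x)" for V P Q
  proof -
    have e: "((\<lambda>q. g q (P q) (Q q)) \<circ> chart_inv c) y = ?G y (vrep c P y) (vrep c Q y)" if y: "y \<in> ?S" for y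
      using y to_chart(4)[OF c chart(4)[OF c y]] by (simp add: metric_rep_def vrep_def)
    note td = tensor2_differentiable[OF L.open_S x L.tensor2_metric P Q]
    have "((\<lambda>q. g q (P q) (Q q)) \<circ> chart_inv c) differentiable (at ?x)"
      by (rule differentiable_transfer_open[OF L.open_S x td(1) e])
    note cd = chart_deriv_eq[OF c q this]
    have "dird ((\<lambda>q. g q (P q) (Q q)) \<circ> chart_inv c) ?x = dird (\<lambda>y. ?G y (vrep c P y) (vrep c Q y)) ?x"
      by (rule dird_cong_open[OF L.open_S x e])
    then show ?thesis by (simp only: vf_deriv_def cd vrep_at[OF c q] td(2))
  qed
  have gl: "g q a b = ?G ?x (to_chart c q a) (to_chart c q b)" for a b using metric_rep_at[OF c q] by simp
  show ?thesis
    unfolding koszul_def vd[OF d(2,3)] vd[OF d(1,3)] vd[OF d(1,2)] gl lie_bracket_rep[OF c q d(1,2)]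
      lie_bracket_rep[OF c q d(1,3)] lie_bracket_rep[OF c q d(2,3)]
    unfolding vrep_at[OF c q, symmetric]
    by (simp add: L.G_simps[OF x] L.metric_christoffel[OF x] L.metric_sym[OF x, of "vrep c Z ?x"]
      L.metric_sym[OF x, of "vrep c Y ?x"] L.metric_sym[OF x, of "vrep c X ?x"])
qed

text \<open>The extension has constant components in the chart selected for q, so in
  \<open>c\<close> it is controlled only on the overlap of the two charts, where it is smooth but in
  general not constant.\<close>

lemma vf_ext_smooth:
  assumes c: "c \<in> A" and q: "q \<in> fst c"
  shows "smooth_on (vrep c (vf_ext A q u)) (overlap c (chart_at A q))" "snd c q \<in> overlap c (chart_at A q)"
    "open (overlap c (chart_at A q))" "overlap c (chart_at A q) \<subseteq> snd c ` fst c"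
    "vrep c (vf_ext A q u) differentiable (at (snd c q))" "vrep c (vf_ext A q u) (snd c q) = to_chart c q u"
proof -
  note ca = chart_at[OF q c]
  show 1: "smooth_on (vrep c (vf_ext A q u)) (overlap c (chart_at A q))"
    unfolding vf_ext_def by (rule smooth_vrep_coord_field[OF c ca(1)])
  show 2: "snd c q \<in> overlap c (chart_at A q)" by (rule overlapI[OF q ca(2)])
  show 3: "open (overlap c (chart_at A q))" "overlap c (chart_at A q) \<subseteq> snd c ` fst c" using overlap[OF c
    ca(1)] by auto
  show "vrep c (vf_ext A q u) differentiable (at (snd c q))" by (rule smooth_on_differentiable[OF 3(1) 1 2])
  show "vrep c (vf_ext A q u) (snd c q) = to_chart c q u"
    by (simp add: vrep_at[OF c q] vf_ext_def to_chart_at(2)[OF c q])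
qed

lemma nabla_rep:
  assumes c: "c \<in> A" and q: "q \<in> fst c"
    and d: "vrep c X differentiable (at (snd c q))" "vrep c Y differentiable (at (snd c q))"
  shows "to_chart c q (nabla A g X Y q) = dird (vrep c Y) (snd c q) (vrep c X (snd c q))
    + christoffel (metric_rep A g c) (snd c q) (vrep c X (snd c q)) (vrep c Y (snd c q))" (is "_ = ?v")
proof -
  have "nabla A g X Y q = coord_field A c ?v q"
    unfolding nabla_def
  proof (rule sharp_eqI[of g q, OF metric_form_g[OF c q]])
    fix w
    show "g q (coord_field A c ?v q) w = koszul A g X Y (vf_ext A q w) q / 2"
      unfolding koszul_rep[OF c q d vf_ext_smooth(5)[OF c q]] vf_ext_smooth(6)[OF c q]
      using metric_rep_at[OF c q, of "coord_field A c ?v q" w] to_chart(3)[OF c q] by simp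
  qed
  then show ?thesis using to_chart(3)[OF c q] by simp
qed

lemma vrep_nabla:
  assumes c: "c \<in> A" and x: "x \<in> snd c ` fst c"
    and d: "vrep c X differentiable (at x)" "vrep c Y differentiable (at x)"
  shows "vrep c (nabla A g X Y) x = dird (vrep c Y) x (vrep c X x) + christoffel (metric_rep A g c) x (vrep
    c X x) (vrep c Y x)"
  using nabla_rep[OF c chart(4)[OF c x], of X Y] d chart(5)[OF c x] by (simp add: vrep_def)

text \<open>The chart \<open>c\<close> need not be the one selected for q, so the extensions have
  nonconstant components. Their first derivatives drop out because the extensions commute, their
  second derivatives by symmetry. This generality is required to differentiate the curvature within
  one chart.\<close>

lemma curv_op_rep:
  assumes c: "c \<in> A" and q: "q \<in> fst c"
  shows "to_chart c q (curv_op A g q a b d) = lcurv (metric_rep A g c) (snd c q) (to_chart c q a) (to_chart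
    c q b) (to_chart c q d)"
proof -
  let ?G = "metric_rep A g c" and ?x = "snd c q" and ?N = "overlap c (chart_at A q)"
  let ?\<Gamma> = "christoffel ?G"
  interpret L: local_metric "snd c ` fst c" ?G by (rule local_metric_rep[OF c])
  note v = vf_ext_smooth[OF c q]
  have xS: "?x \<in> snd c ` fst c" using q by auto
  let ?V = "\<lambda>u. vrep c (vf_ext A q u)"
  have vd: "?V u differentiable (at y)" if "y \<in> ?N" for u y by (rule smooth_on_differentiable[OF v(3,1) that])
  have lie: "lie_bracket A (vf_ext A q u) (vf_ext A q w) q' = 0" if "q' \<in> fst (chart_at A q)" for u w q'
    unfolding vf_ext_def by (rule lie_bracket_coord_field[OF chart_at(1)[OF q c] that])
  have sy: "dird (?V u) ?x (?V w ?x) = dird (?V w) ?x (?V u ?x)" for u w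
    using lie_bracket_rep[OF c q vd[OF v(2)] vd[OF v(2)], of u w] lie[OF chart_at(2)[OF q c], of u w]
      linear_0[OF to_chart(1)[OF c q]] by simp
  define n where "n = (\<lambda>u w y. dird (?V w) y (?V u y) + ?\<Gamma> y (?V u y) (?V w y))"
  have nab: "vrep c (nabla A g (vf_ext A q u) (vf_ext A q w)) y = n u w y" if "y \<in> ?N" for u w y
    unfolding n_def by (rule vrep_nabla[OF c _ vd[OF that] vd[OF that]]) (use v(4) that in auto)
  have t2: "tensor2 ?N ?\<Gamma>"
    using L.bilinear_christoffel smooth_on_subset[OF L.open_S v(3,4) L.smooth_christoffel] v(4)
    unfolding tensor2_def by blast
  have dl: "linear (dird (?V w) y)" if "y \<in> ?N" for w y by (rule linear_dird[OF vd[OF that]])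
  have dd: "(\<lambda>y. dird (?V w) y u) differentiable (at ?x)" for u w
    by (rule smooth_on_differentiable[OF v(3) smooth_on_dird[OF v(1)] v(2)])
  have d1: "(\<lambda>y. dird (?V w) y (?V u y)) differentiable (at ?x)" for u w
    by (rule slot_differentiable[OF v(3,2) dl dd vd[OF v(2)]])
  have d2: "(\<lambda>y. ?\<Gamma> y (?V u y) (?V w y)) differentiable (at ?x)" for u w
    by (rule tensor2_differentiable(1)[OF v(3,2) t2 vd[OF v(2)] vd[OF v(2)]])
  have nd: "n u w differentiable (at ?x)" for u w
    unfolding n_def by (rule differentiable_add[OF d1 d2])
  have nn: "to_chart c q (nabla A g (vf_ext A q a) (nabla A g (vf_ext A q u) (vf_ext A q w)) q) =
     dird (n u w) ?x (?V a ?x) + ?\<Gamma> ?x (?V a ?x) (n u w ?x)" for a u w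
  proof -
    have "vrep c (nabla A g (vf_ext A q u) (vf_ext A q w)) differentiable (at ?x)"
      by (rule differentiable_transfer_open[OF v(3,2) nd nab])
    from nabla_rep[OF c q vd[OF v(2)] this] show ?thesis
      using nab[OF v(2)] dird_cong_open[OF v(3,2) nab] by simp
  qed
  have dn: "dird (n u w) ?x p = dird (\<lambda>y. dird (?V w) y (?V u ?x)) ?x p + dird (?V w) ?x (dird (?V u) ?x p)
     + (dird (\<lambda>y. ?\<Gamma> y (?V u ?x) (?V w ?x)) ?x p + ?\<Gamma> ?x (dird (?V u) ?x p) (?V w ?x) + ?\<Gamma> ?x (?V u ?x)
       (dird (?V w) ?x p))" for u w p
  proof -
    have "dird (\<lambda>y. dird (?V w) y (?V u y)) ?x p = dird (\<lambda>y. dird (?V w) y (?V u ?x)) ?x p + dird (?V w) ?x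
      (dird (?V u) ?x p)"
      by (rule slot_dird[OF v(3,2) dl dd vd[OF v(2)]])
    then show ?thesis
      unfolding n_def dird_add[OF d1 d2] tensor2_differentiable(2)[OF v(3,2) t2 vd[OF v(2)] vd[OF v(2)]] by
        (rule arg_cong)
  qed
  have lz: "vrep c (lie_bracket A (vf_ext A q a) (vf_ext A q b)) y = 0" if "y \<in> ?N" for y
    unfolding vrep_def lie[OF overlapD(2)[OF c that]] by (rule linear_0[OF to_chart(1)[OF c overlapD(1)[OF c
      that]]])
  have "vrep c (lie_bracket A (vf_ext A q a) (vf_ext A q b)) differentiable (at ?x)"
    by (rule differentiable_transfer_open[OF v(3,2) differentiable_const lz])
  from nabla_rep[OF c q this vd[OF v(2)]]
  have nl: "to_chart c q (nabla A g (lie_bracket A (vf_ext A q a) (vf_ext A q b)) (vf_ext A q d) q) = 0"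
    unfolding lz[OF v(2)] by (simp add: linear_0[OF dl[OF v(2)]] L.chr_simps[OF xS])
  have com: "dird (\<lambda>y. dird (?V d) y (?V b ?x)) ?x (?V a ?x) = dird (\<lambda>y. dird (?V d) y (?V a ?x)) ?x (?V b ?x)"
    by (rule dird_commute[OF v(3,1,2)])
  have "to_chart c q (curv_op A g q a b d) = lcurv ?G ?x (?V a ?x) (?V b ?x) (?V d ?x)"
    unfolding curv_op_def Let_def linear_diff[OF to_chart(1)[OF c q]] nn nl dn
    unfolding com sy[of b a] n_def lcurv_def
    by (simp add: L.chr_simps[OF xS])
  then show ?thesis unfolding v(6) .
qed

end

text \<open>The condition is invariant under linear isometries. It is verified in the tangent space
  as encoded on the manifold and then carried into a chart.\<close>

lemma T_cond_transport:
  fixes h h' :: "'n::finite form2" and J :: "real^'n \<Rightarrow> real^'n"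
  assumes h': "metric_form h'" "is_onb h' e'" and e: "is_onb h e" and J: "linear J" "surj J"
    and h: "\<And>u v. h u v = h' (J u) (J v)" and W: "\<And>a b c d. W a b c d = W' (J a) (J b) (J c) (J d)"
    and D: "\<And>a b c. D a b c = D' (J a) (J b) (J c)" and W': "mlin4 W'" and D': "mlin3 D'"
    and T: "T_cond h e W D t"
  shows "T_cond h' e' W' D' (J t)"
proof -
  have eJ: "is_onb h' (\<lambda>j. J (e j))" using e by (simp add: is_onb_def h)
  have tr: "triple e' K L = triple e (\<lambda>a b i. K (J a) (J b) (J i)) (\<lambda>a b i. L (J a) (J b) (J i))"
    if "mlin3 K" "mlin3 L" for K L
    unfolding triple_indep[OF h' eJ that] unfolding triple_def ..
  have s: "\<exists>v'. v = J v'" for v using J(2) by (metis surjD)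
  have De: "D = (\<lambda>a b i. D' (J a) (J b) (J i))" by (intro ext) (rule D)
  show ?thesis unfolding T_cond_def w_form_def
  proof (intro conjI ballI allI)
    fix \<nu> assume n: "\<nu> \<in> nullity W'"
    obtain \<nu>' where v: "\<nu> = J \<nu>'" using s by blast
    then have "\<nu>' \<in> nullity W" using n by (simp add: nullity_def W)
    then show "h' (J t) \<nu> = 0" using T by (simp add: T_cond_def h v)
  next
    fix y obtain y' where y: "y = J y'" using s by blast
    show "(real CARD('n) - 3) * triple e' (\<lambda>a b i. W' a b i (J t)) (\<lambda>a b i. W' a b i y) = triple e' D' (\<lambda>a b
      i. W' a b i y)"
      unfolding tr[OF mlin4_fix4[OF W'] mlin4_fix4[OF W']] tr[OF D' mlin4_fix4[OF W']]
      using T by (simp add: T_cond_def w_form_def W De y)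
  qed
qed

section \<open>The Moore-Penrose inverse\<close>

text \<open>Covectors are replaced by the vectors dual to them, which turns \<open>w_endo\<close>
  into half of \<open>w_op\<close>. This operator is bijective on the orthogonal complement of the
  nullity, and its inverse there is the Moore-Penrose inverse.\<close>

lemma T_field_T_cond:
  fixes g :: "('a, 'n::finite) tensor2"
  assumes h: "metric_form (g q)" and W: "curvlike (weyl A g q)"
    and D: "mlin3 (delta_W A g q)" "\<And>u v w. delta_W A g q u v w = - delta_W A g q v u w" and n: "CARD('n) \<ge> 4"
  shows "T_cond (g q) (onb g q) (weyl A g q) (delta_W A g q) (T_field A g q)"
proof -
  define e W D h where "e = onb g q" and "W = weyl A g q" and "D = delta_W A g q" and "h = g q"
  have eb: "is_onb (g q) e" unfolding e_def by (rule is_onb_onb[of g q, OF assms(1)])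
  have W: "curvlike W" and h: "metric_form h" and eh: "is_onb h e" using assms(2) assms(1) eb by (simp_all
    add: W_def h_def)
  interpret C: curvature_at h e W by (rule curvature_at.intro[OF h eh W])
  note l = mlin4_linear[OF curvlikeD(1)[OF W]]
  have n3: "real CARD('n) - 3 \<noteq> 0" using n by auto
  let ?Q = "w_form e W" and ?w = "w_op h e W" and ?E = "nullity W"
  let ?t = "\<lambda>y. triple e D (\<lambda>a b i. W a b i y)"
  have bia: "W v z t u - W u z t v = W u v z t" for u v z t
    using curvlikeD(4)[OF W, of u v z t] curvlikeD(3)[OF W, of v z u t]
      curvlikeD(2)[OF W, of u z t v] curvlikeD(3)[OF W, of z u t v] by linarith
  have act: "weyl_act A g q (wedge (h u) (h v)) z t = W u v z t" for u v z t
  proof -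
    have "(\<Sum>i\<in>UNIV. \<Sum>j\<in>UNIV. h a (e i) * h b (e j) * W (e j) z t (e i)) = W b z t a" for a b
      using onb_sum_real(1)[OF h eh l(4)] onb_sum_real(1)[OF h eh l(1)] by (simp add: mult.assoc flip:
        sum_distrib_left)
    from this[of u v] this[of v u] show ?thesis
      unfolding weyl_act_def wedge_def e_def[symmetric] W_def[symmetric] bia[where u=u and v=v and z=z and
        t=t, symmetric]
      by (simp add: sum_subtractf algebra_simps)
  qed
  \<comment> \<open>Against antisymmetric coefficients the first Bianchi identity moves both
    contracted vectors into the first pair of slots. This is the origin of the factor 2 between
    \<open>w_endo\<close> and \<open>w_form\<close>, and of the same factor on the right-hand side
    of the equation for T.\<close>
  have half: "2 * (\<Sum>a\<in>UNIV. \<Sum>b\<in>UNIV. M (e a) (e b) * W (e b) z y (e a)) = (\<Sum>a\<in>UNIV. \<Sum>b\<in>UNIV. M (e a) (e b) *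
    W (e a) (e b) z y)"
    if "\<And>u v. M u v = - M v u" for M z y
  proof -
    have "(\<Sum>a\<in>UNIV. \<Sum>b\<in>UNIV. M (e a) (e b) * W (e b) z y (e a)) = (\<Sum>a\<in>UNIV. \<Sum>b\<in>UNIV. M (e b) (e a) * W (e a)
      z y (e b))"
      by (rule sum.swap)
    also have "\<dots> = - (\<Sum>a\<in>UNIV. \<Sum>b\<in>UNIV. M (e a) (e b) * W (e a) z y (e b))"
    proof -
      have "M (e b) (e a) * W (e a) z y (e b) = - (M (e a) (e b) * W (e a) z y (e b))" for a b
        using that[of "e b" "e a"] by simp
      then show ?thesis by (simp add: sum_negf)
    qed
    finally show ?thesis
      unfolding bia[where u="e _" and v="e _" and z=z and t=y, symmetric] by (simp add: right_diff_distrib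
        sum_subtractf)
  qed
  have endo: "2 * w_endo A g q (h s) y = ?Q s y" for s y
  proof -
    have p: "W (e i) s a b = W a b (e i) s" for i a b by (rule curvlike_pair[OF W])
    have "2 * w_endo A g q (h s) y = (\<Sum>i\<in>UNIV. 2 * (\<Sum>a\<in>UNIV. \<Sum>b\<in>UNIV. W (e i) s (e a) (e b) * W (e b) (e i)
      y (e a)))"
      unfolding w_endo_def e_def[symmetric] h_def[symmetric] act sum_distrib_left[symmetric]
      by (simp add: weyl_act_def e_def W_def)
    also have "\<dots> = ?Q s y"
      unfolding w_form_def triple_def p[symmetric]
      by (rule sum.cong[OF refl], rule half) (rule curvlikeD(3)[OF W])
    finally show ?thesis .
  qed
  have rhs: "(\<lambda>y. \<Sum>i\<in>UNIV. weyl_act A g q (\<lambda>u v. delta_W A g q u v (onb g q i)) (onb g q i) y) = (\<lambda>y. ?t y / 2)"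
  proof
    fix y
    have "2 * (\<Sum>i\<in>UNIV. weyl_act A g q (\<lambda>u v. D u v (e i)) (e i) y) = (\<Sum>i\<in>UNIV. 2 * (\<Sum>a\<in>UNIV. \<Sum>b\<in>UNIV. D (e
      a) (e b) (e i) * W (e b) (e i) y (e a)))"
      unfolding sum_distrib_left[symmetric] by (simp add: weyl_act_def e_def W_def)
    also have "\<dots> = ?t y"
      unfolding triple_def
      by (rule sum.cong[OF refl], rule half[of "\<lambda>u v. D u v (e _)"]) (rule assms(4)[folded D_def])
    finally show "(\<Sum>i\<in>UNIV. weyl_act A g q (\<lambda>u v. delta_W A g q u v (onb g q i)) (onb g q i) y) = ?t y / 2"
      by (simp add: D_def e_def)
  qed
  have ex: "\<exists>s. \<theta> = h s" if "linear \<theta>" for \<theta> :: "'n covec"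
  proof -
    have "\<theta> = h (sharp (\<lambda>_. h) () \<theta>)" by (rule ext) (rule metric_sharp[of "\<lambda>_. h", OF h that, symmetric])
    then show ?thesis by blast
  qed
  define V where "V = {s. \<forall>\<nu>\<in>?E. h s \<nu> = 0}"
  have sV: "subspace V" unfolding V_def by (rule subspaceI) (simp_all add: C.h_simps)
  have V0: "s = 0" if "s \<in> V" "s \<in> ?E" for s using that C.perp_null_eq_0[of s] by (auto simp: V_def)
  have wV: "?w s \<in> V" for s by (simp add: V_def C.w_op_perp)
  have "?w ` V = V"
  \<comment> \<open>\<open>w_op\<close> maps into \<open>V\<close>, and its kernel, the nullity,
    meets \<open>V\<close> only in 0; so it is injective on \<open>V\<close>, and onto by
    dimension.\<close>
  proof (rule subspace_dim_equal[OF linear_subspace_image[OF C.linear_w_op sV] sV])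
    show "?w ` V \<subseteq> V" using wV by auto
    have "inj_on ?w (span V)" unfolding span_eq_iff[THEN iffD2, OF sV]
    proof (rule inj_onI)
      fix a b assume ab: "a \<in> V" "b \<in> V" "?w a = ?w b"
      then have "a - b \<in> ?E" using C.w_op_kernel[of "a - b"] by (simp add: linear_diff[OF C.linear_w_op])
      then show "a = b" using V0[of "a - b"] ab sV by (simp add: subspace_diff)
    qed
    then show "dim V \<le> dim (?w ` V)" using dim_image_eq[OF C.linear_w_op] by simp
  qed
  then have onto: "\<exists>r\<in>V. ?w r = s" if "s \<in> V" for s using that by (metis imageE)
  have lt: "linear ?t" by (rule linearI) (simp_all add: C.W_lin triple_linear)
  obtain \<tau> where \<tau>0: "?t = h \<tau>" using ex[OF lt] by blast
  have \<tau>: "h \<tau> y = ?t y" for y using fun_cong[OF \<tau>0, of y] by simp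
  have "\<tau> \<in> V" by (simp add: V_def \<tau> C.triple_null)
  then obtain s0 where s0: "s0 \<in> V" "?w s0 = \<tau>" using onto by blast
  have Qs0: "?Q s0 y = ?t y" for y using C.metric_w_op[of s0 y] s0(2) \<tau> by simp
  have "moore_penrose (w_endo A g q) (\<lambda>y. ?t y / 2) = h s0"
    unfolding moore_penrose_def
  proof (rule the_equality)
    have "h 0 = (\<lambda>_. 0)" by (simp add: C.h_simps fun_eq_iff)
    then have "w_endo A g q (\<lambda>_. 0) y = 0" for y
      using endo[of 0 y] linear_0[OF C.w_form_bilinear(2)] by simp
    then have ker: "(\<lambda>_. 0) \<in> endo_ker (w_endo A g q)" by (auto simp: endo_ker_def intro: linear_zero)
    obtain r where "?w r = 2 *\<^sub>R s0" using onto[of "2 *\<^sub>R s0"] s0(1) sV by (auto simp: subspace_scale)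
    then have "h s0 y = w_endo A g q (h r) y" for y
      using C.metric_w_op[of r y] endo[of r y] by (simp add: C.h_simps)
    then have im: "h s0 \<in> endo_im (w_endo A g q)"
      unfolding endo_im_def using metric_form_linear(1)[OF h] by (intro image_eqI[of _ _ "h r"]) auto
    \<comment> \<open>The component in the kernel is 0, because the right-hand side is orthogonal to
      the nullity.\<close>
    have eq: "?t x / 2 = w_endo A g q (h s0) x + 0" for x using endo[of s0 x] Qs0[of x] by simp
    show "h s0 \<in> endo_im (w_endo A g q) \<and> (\<exists>\<kappa>\<in>endo_ker (w_endo A g q). \<forall>x. ?t x / 2 = w_endo A g q (h s0) x + \<kappa> x)"
      by (intro conjI im bexI[OF _ ker] allI eq)
  next
    fix \<alpha> assume a: "\<alpha> \<in> endo_im (w_endo A g q) \<and> (\<exists>\<kappa>\<in>endo_ker (w_endo A g q). \<forall>x. ?t x / 2 = w_endo A g q \<alpha>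
      x + \<kappa> x)"
    then obtain \<kappa> where k: "linear \<kappa>" "w_endo A g q \<kappa> = (\<lambda>_. 0)" "\<And>x. ?t x / 2 = w_endo A g q \<alpha> x + \<kappa> x"
      by (auto simp: endo_ker_def)
    from a obtain r where r: "\<alpha> = w_endo A g q (h r)" using ex by (auto simp: endo_im_def)
    obtain k' where k': "\<kappa> = h k'" using ex k(1) by blast
    define s where "s = (1/2) *\<^sub>R ?w r"
    have "h s y = w_endo A g q (h r) y" for y
      using C.metric_w_op[of r y] endo[of r y] by (simp add: s_def C.h_simps)
    then have as: "\<alpha> = h s" using r by auto
    have sVs: "s \<in> V" using wV sV by (simp add: s_def subspace_scale)
    have "?Q k' k' = 0" using endo[of k' k'] k(2) k' by simp
    then have kE: "k' \<in> ?E" by (rule C.w_form_eq_0)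
    \<comment> \<open>The decomposition is evaluated at \<open>k'\<close> itself: the left side and
      the image part vanish on the nullity, which leaves the squared norm.\<close>
    have "h k' k' = 0"
      using k(3)[of k'] endo[of s k'] C.w_form_null[OF kE, of s] C.triple_null[OF kE, of D] as k' by simp
    then have "k' = 0" using h by (metis less_irrefl metric_form_def)
    then have "?Q s y = ?Q s0 y" for y
      using k(3)[of y] endo[of s y] Qs0[of y] as k' by (simp add: C.h_simps)
    then have "?Q (s - s0) (s - s0) = 0" by (simp add: linear_diff[OF C.w_form_bilinear(2)])
    then have "s - s0 \<in> ?E" by (rule C.w_form_eq_0)
    then have "s - s0 = 0" using V0[of "s - s0"] subspace_diff[OF sV sVs s0(1)] by blast
    then show "\<alpha> = h s0" using as by simp
  qed
  then have "T_field A g q = (1 / (real CARD('n) - 3)) *\<^sub>R s0"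
    unfolding T_field_def rhs by (intro sharp_eqI[of g q, OF assms(1)]) (simp add: h_def[symmetric] C.h_simps)
  then show ?thesis
    unfolding T_cond_def e_def[symmetric] W_def[symmetric] D_def[symmetric] h_def[symmetric]
    using s0(1) n3 Qs0 by (simp add: V_def C.h_simps linear_cmul[OF C.w_form_bilinear(2)])
qed

section \<open>Curvature tensors in charts\<close>

context riemannian
begin

lemma onb_to_chart:
  assumes c: "c \<in> A" and q: "q \<in> fst c"
  shows "is_onb (metric_rep A g c (snd c q)) (\<lambda>j. to_chart c q (onb g q j))"
  using is_onb_onb[of g q, OF metric_form_g[OF c q]] metric_rep_at[OF c q] by (simp add: is_onb_def)

lemma onb_sum_rep:
  assumes c: "c \<in> A" and q: "q \<in> fst c" and b: "\<And>u. linear (b u)" "\<And>v. linear (\<lambda>u. b u v)"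
  shows "(\<Sum>j\<in>UNIV. b (to_chart c q (onb g q j)) (to_chart c q (onb g q j))) =
    (\<Sum>j\<in>UNIV. b (onb (metric_rep A g c) (snd c q) j) (onb (metric_rep A g c) (snd c q) j) :: real)"
proof -
  interpret L: local_metric "snd c ` fst c" "metric_rep A g c" by (rule local_metric_rep[OF c])
  have x: "snd c q \<in> snd c ` fst c" using q by auto
  show ?thesis by (rule onb_sum_indep[OF L.metric[OF x] onb_to_chart[OF c q] L.onb_at[OF x] b])
qed

lemma Riem_rep:
  assumes c: "c \<in> A" and q: "q \<in> fst c"
  shows "Riem A g q a b d t = lRiem (metric_rep A g c) (snd c q) (to_chart c q a) (to_chart c q b) (to_chart
    c q d) (to_chart c q t)"
  unfolding Riem_def lRiem_def metric_rep_at[OF c q, symmetric] curv_op_rep[OF c q] ..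

lemma Ric_rep:
  assumes c: "c \<in> A" and q: "q \<in> fst c"
  shows "Ric A g q a b = lRic (metric_rep A g c) (snd c q) (to_chart c q a) (to_chart c q b)"
proof -
  interpret L: local_metric "snd c ` fst c" "metric_rep A g c" by (rule local_metric_rep[OF c])
  have x: "snd c q \<in> snd c ` fst c" using q by auto
  note h = metric_form_g[OF c q]
  have e: "curv_op A g q v a b = coord_field A c (lcurv (metric_rep A g c) (snd c q) (to_chart c q v)
    (to_chart c q a) (to_chart c q b)) q" for v
    using to_chart(4)[OF c q] curv_op_rep[OF c q] by metis
  have "linear (\<lambda>v. curv_op A g q v a b)" unfolding e
    by (rule linearI; simp add: linear_rules[OF to_chart(1)[OF c q]] linear_rules[OF to_chart(2)[OF c q]]
      L.lcurv_simps[OF x])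
  then have "Ric A g q a b = (\<Sum>j\<in>UNIV. Riem A g q (onb g q j) a b (onb g q j))"
    unfolding Ric_def Riem_def by (rule trace_eq_onb_sum[OF h is_onb_onb[of g q, OF h]])
  also have "\<dots> = lRic (metric_rep A g c) (snd c q) (to_chart c q a) (to_chart c q b)"
    unfolding Riem_rep[OF c q] lRic_def
    by (rule onb_sum_rep[OF c q mlin4_linear(1)[OF L.mlin4_lRiem[OF x]] mlin4_linear(4)[OF L.mlin4_lRiem[OF x]]])
  finally show ?thesis .
qed

lemma scal_rep:
  assumes c: "c \<in> A" and q: "q \<in> fst c"
  shows "scal A g q = lscal (metric_rep A g c) (snd c q)"
proof -
  interpret L: local_metric "snd c ` fst c" "metric_rep A g c" by (rule local_metric_rep[OF c])
  have x: "snd c q \<in> snd c ` fst c" using q by auto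
  show ?thesis unfolding scal_def lscal_def Ric_rep[OF c q]
    by (rule onb_sum_rep[OF c q bilinear_linear[OF tensor2D(1)[OF L.tensor2_lRic x]]])
qed

lemma schouten_rep:
  assumes c: "c \<in> A" and q: "q \<in> fst c"
  shows "schouten A g q a b = lschouten (metric_rep A g c) (snd c q) (to_chart c q a) (to_chart c q b)"
  unfolding schouten_def lschouten_def Ric_rep[OF c q] scal_rep[OF c q] metric_rep_at[OF c q] ..

lemma weyl_rep:
  assumes c: "c \<in> A" and q: "q \<in> fst c"
  shows "weyl A g q a b d t = lweyl (metric_rep A g c) (snd c q) (to_chart c q a) (to_chart c q b) (to_chart
    c q d) (to_chart c q t)"
  unfolding weyl_def lweyl_def kulkarni_nomizu_def Riem_rep[OF c q] schouten_rep[OF c q] metric_rep_at[OF c q] ..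

text \<open>The derivatives of the extended arguments, produced by the product rule, cancel against
  those inside the four correction terms.\<close>

lemma nabla4_rep:
  assumes c: "c \<in> A" and q: "q \<in> fst c" and b: "tensor4 (snd c ` fst c) b"
    and B: "\<And>q u v w t. q \<in> fst c \<Longrightarrow> B q u v w t = b (snd c q) (to_chart c q u) (to_chart c q v) (to_chart c
      q w) (to_chart c q t)"
  shows "nabla4 A g B q p u v w t = lcov4 (metric_rep A g c) b (snd c q) (to_chart c q p) (to_chart c q u)
    (to_chart c q v) (to_chart c q w) (to_chart c q t)"
proof -
  let ?x = "snd c q" and ?S = "snd c ` fst c" and ?V = "\<lambda>u. vrep c (vf_ext A q u)"
  interpret L: local_metric ?S "metric_rep A g c" by (rule local_metric_rep[OF c])
  have x: "?x \<in> ?S" using q by auto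
  note d = vf_ext_smooth(5)[OF c q] and v = vf_ext_smooth(6)[OF c q]
  have e: "((\<lambda>q'. B q' (vf_ext A q u q') (vf_ext A q v q') (vf_ext A q w q') (vf_ext A q t q')) \<circ> chart_inv
    c) y = b y (?V u y) (?V v y) (?V w y) (?V t y)"
    if "y \<in> ?S" for y
    using B[OF chart(4)[OF c that]] chart(5)[OF c that] by (simp add: vrep_def)
  note td = tensor4_differentiable[OF L.open_S x b d d d d]
  note cd = chart_deriv_eq[OF c q differentiable_transfer_open[OF L.open_S x td(1) e]]
  have "dird ((\<lambda>q'. B q' (vf_ext A q u q') (vf_ext A q v q') (vf_ext A q w q') (vf_ext A q t q')) \<circ>
    chart_inv c) ?x = dird (\<lambda>y. b y (?V u y) (?V v y) (?V w y) (?V t y)) ?x"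
    by (rule dird_cong_open[OF L.open_S x e])
  then have vd: "vf_deriv A (vf_ext A q p) (\<lambda>q'. B q' (vf_ext A q u q') (vf_ext A q v q') (vf_ext A q w q')
    (vf_ext A q t q')) q
     = dird (\<lambda>y. b y (?V u y) (?V v y) (?V w y) (?V t y)) ?x (?V p ?x)"
    by (simp only: vf_deriv_def cd vrep_at[OF c q])
  have nb: "to_chart c q (nabla A g (vf_ext A q p) (vf_ext A q z) q) = dird (?V z) ?x (?V p ?x) +
    christoffel (metric_rep A g c) ?x (?V p ?x) (?V z ?x)" for z
    by (rule nabla_rep[OF c q d d])
  show ?thesis
    unfolding nabla4_def Let_def vd td(2) B[OF q] nb unfolding lcov4_def v
    by (simp add: mlin4_simps[OF tensor4D(1)[OF b x]])
qed

lemma delta_W_rep: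
  assumes c: "c \<in> A" and q: "q \<in> fst c"
  shows "delta_W A g q u v w = ldelta4 (metric_rep A g c) (lweyl (metric_rep A g c)) (snd c q) (to_chart c q
    u) (to_chart c q v) (to_chart c q w)"
proof -
  interpret L: local_metric "snd c ` fst c" "metric_rep A g c" by (rule local_metric_rep[OF c])
  have x: "snd c q \<in> snd c ` fst c" using q by auto
  note l = L.mlin4_lcov4[OF L.tensor4_lweyl x]
  have nb: "nabla4 A g (weyl A g) q p u v w t = lcov4 (metric_rep A g c) (lweyl (metric_rep A g c)) (snd c q)
      (to_chart c q p) (to_chart c q u) (to_chart c q v) (to_chart c q w) (to_chart c q t)" for p t
    by (rule nabla4_rep[OF c q L.tensor4_lweyl weyl_rep[OF c]])
  show ?thesis unfolding delta_W_def delta4_def ldelta4_def nb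
    by (rule onb_sum_rep[OF c q mlin4_linear(1)[OF l(1)] l(2)])
qed

lemma weyl_nullity_rep:
  assumes c: "c \<in> A" and q: "q \<in> fst c"
  shows "dim (weyl_nullity A g q) = dim (nullity (lweyl (metric_rep A g c) (snd c q)))"
proof -
  let ?J = "to_chart c q" and ?I = "\<lambda>u. coord_field A c u q"
  have "?J ` weyl_nullity A g q = nullity (lweyl (metric_rep A g c) (snd c q))"
  proof (intro set_eqI iffI)
    fix \<nu> assume "\<nu> \<in> ?J ` weyl_nullity A g q"
    then obtain u where u: "u \<in> weyl_nullity A g q" "\<nu> = ?J u" by blast
    have "lweyl (metric_rep A g c) (snd c q) \<nu> a b d = 0" for a b d
      using u(1) weyl_rep[OF c q, of u "?I a" "?I b" "?I d"] to_chart(3)[OF c q] by (simp add: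
        weyl_nullity_def u(2))
    then show "\<nu> \<in> nullity (lweyl (metric_rep A g c) (snd c q))" by (simp add: nullity_def)
  next
    fix \<nu> assume "\<nu> \<in> nullity (lweyl (metric_rep A g c) (snd c q))"
    then have "?I \<nu> \<in> weyl_nullity A g q" by (simp add: weyl_nullity_def nullity_def weyl_rep[OF c q]
      to_chart(3)[OF c q])
    then show "\<nu> \<in> ?J ` weyl_nullity A g q" using to_chart(3)[OF c q] by (metis image_eqI)
  qed
  moreover have "inj_on ?J (span (weyl_nullity A g q))" by (rule inj_on_inverseI[of _ ?I]) (rule
    to_chart(4)[OF c q])
  ultimately show ?thesis using dim_image_eq[OF to_chart(1)[OF c q]] by metis
qed

lemma T_field_rep:
  assumes n: "CARD('n) \<ge> 4" and c: "c \<in> A" and q: "q \<in> fst c"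
  shows "T_cond (metric_rep A g c (snd c q)) (onb (metric_rep A g c) (snd c q)) (lweyl (metric_rep A g c)
    (snd c q))
    (ldelta4 (metric_rep A g c) (lweyl (metric_rep A g c)) (snd c q)) (to_chart c q (T_field A g q))"
proof -
  let ?J = "to_chart c q" and ?x = "snd c q" and ?G = "metric_rep A g c"
  interpret L: local_metric "snd c ` fst c" "metric_rep A g c" by (rule local_metric_rep[OF c])
  have x: "?x \<in> snd c ` fst c" using q by auto
  note h = metric_form_g[OF c q] and J = linear_rules[OF to_chart(1)[OF c q]]
  note cW = L.curvlike_lweyl[OF x]
  have mD: "mlin3 (ldelta4 ?G (lweyl ?G) ?x)" by (rule tensor3D(1)[OF L.tensor3_ldelta4[OF L.tensor4_lweyl] x])
  have W: "curvlike (weyl A g q)"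
    unfolding curvlike_def
  proof (intro conjI allI)
    show "mlin4 (weyl A g q)"
      by (rule mlin4I; rule linearI; simp add: weyl_rep[OF c q] J mlin4_simps[OF curvlikeD(1)[OF cW]])
    fix u v w t
    show "weyl A g q u v w t = - weyl A g q v u w t" unfolding weyl_rep[OF c q] by (rule curvlikeD(2)[OF cW])
    show "weyl A g q u v w t = - weyl A g q u v t w" unfolding weyl_rep[OF c q] by (rule curvlikeD(3)[OF cW])
    show "weyl A g q u v w t + weyl A g q v w u t + weyl A g q w u v t = 0"
      unfolding weyl_rep[OF c q] by (rule curvlikeD(4)[OF cW])
  qed
  have D: "mlin3 (delta_W A g q)"
    by (rule mlin3I; rule linearI; simp add: delta_W_rep[OF c q] J mlin3_simps[OF mD])
  have "delta_W A g q u v w = - delta_W A g q v u w" for u v w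
    unfolding delta_W_rep[OF c q] by (rule L.ldelta4_curvlike(1)[OF L.tensor4_lweyl L.curvlike_lweyl x])
  note T = T_field_T_cond[of g q A, OF h W D this n]
  have "surj ?J" by (rule surjI[of _ "\<lambda>u. coord_field A c u q"]) (rule to_chart(3)[OF c q])
  then show ?thesis
    by (rule T_cond_transport[OF L.metric[OF x] L.onb_at[OF x] is_onb_onb[of g q, OF h] to_chart(1)[OF c q] _
        metric_rep_at[OF c q, symmetric] weyl_rep[OF c q] delta_W_rep[OF c q] curvlikeD(1)[OF cW] mD T])
qed

text \<open>In the chart selected for p itself, vectors at p are their own representatives and the
  extensions have constant components. At the neighbouring points, which matter for derivatives,
  other charts may be selected; there the representation lemmas for an arbitrary chart are
  used.\<close>

lemma gen_bach_rep:
  assumes n: "CARD('n) \<ge> 4" and p: "p \<in> points A"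
  defines "c \<equiv> chart_at A p"
  assumes T: "vrep c (T_field A g) differentiable (at (snd c p))"
  shows "gen_bach A g p u v = lbach (metric_rep A g c) (vrep c (T_field A g)) (snd c p) u v"
proof -
  let ?G = "metric_rep A g c" and ?x = "snd c p" and ?T = "vrep c (T_field A g)"
  have c: "c \<in> A" "p \<in> fst c" using p chart_at unfolding points_def c_def by blast+
  interpret L: local_metric "snd c ` fst c" ?G by (rule local_metric_rep[OF c(1)])
  have x: "?x \<in> snd c ` fst c" using c by auto
  have J: "to_chart c p a = a" for a unfolding c_def by (rule to_chart_at(1)[OF c])
  have gp: "g p = ?G ?x" using metric_rep_at[OF c] by (intro ext) (simp add: J)
  have onb: "onb g p = onb ?G ?x" unfolding onb_def gp ..
  have weyl: "weyl A g p = lweyl ?G ?x" using weyl_rep[OF c] by (auto simp: J fun_eq_iff)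
  have act: "weyl_act A g p = lact ?G ?x" unfolding weyl_act_def[abs_def] lact_def[abs_def] onb weyl ..
  have Ric: "Ric A g p = lRic ?G ?x" using Ric_rep[OF c] by (auto simp: J fun_eq_iff)
  have vext: "vrep c (vf_ext A p a) y = a" if "y \<in> snd c ` fst c" for a y
    unfolding vf_ext_def c_def[symmetric] by (rule vrep_coord_field[OF c(1) that])
  have dext: "dird (vrep c (vf_ext A p a)) ?x w = 0" for a w
    using dird_cong_open[OF L.open_S x, of "vrep c (vf_ext A p a)" "\<lambda>_. a"] vext by (simp add: dird_const)
  note ed = vf_ext_smooth(5)[OF c] and ev = vf_ext_smooth(6)[OF c, unfolded J]
  have nab: "nabla A g (vf_ext A p a) (vf_ext A p b) p = christoffel ?G ?x a b" for a b
    using nabla_rep[OF c ed ed] unfolding J ev dext by simp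
  have nabT: "nabla A g (vf_ext A p a) (T_field A g) p = lnabla ?G ?T ?x a" for a
    using nabla_rep[OF c ed T] unfolding J ev lnabla_def .
  have vd: "vf_deriv A (vf_ext A p a) F p = dird F' ?x a"
    if "\<And>y. y \<in> snd c ` fst c \<Longrightarrow> (F \<circ> chart_inv c) y = F' y" for F :: "'a \<Rightarrow> real" and F' a
  proof -
    have "vf_ext A p a p = a" using to_chart_at(2)[OF c] by (simp add: vf_ext_def)
    then have "vf_deriv A (vf_ext A p a) F p = dird (F \<circ> chart_inv c) ?x a"
      by (simp add: vf_deriv_def chart_deriv_def dird_def c_def)
    then show ?thesis using dird_cong_open[OF L.open_S x that] by simp
  qed
  have vrep: "to_chart c (chart_inv c y) (vf_ext A p a (chart_inv c y)) = a" if "y \<in> snd c ` fst c" for y a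
    using vext[OF that] by (simp add: vrep_def)
  have n2: "nabla2 A g (schouten A g) p a b d = lcov2 ?G (lschouten ?G) ?x a b d" for a b d
    unfolding nabla2_def Let_def lcov2_def nab schouten_rep[OF c] J
    by (subst vd[of _ "\<lambda>y. lschouten ?G y b d"]) (simp_all add: schouten_rep[OF c(1) chart(4)[OF c(1)]]
      chart(5)[OF c(1)] vrep)
  have n3: "nabla3 A g (delta_W A g) p a b d t = lcov3 ?G (ldelta4 ?G (lweyl ?G)) ?x a b d t" for a b d t
    unfolding nabla3_def Let_def lcov3_def nab delta_W_rep[OF c] J
    by (subst vd[of _ "\<lambda>y. ldelta4 ?G (lweyl ?G) y b d t"]) (simp_all add: delta_W_rep[OF c(1) chart(4)[OF
      c(1)]] chart(5)[OF c(1)] vrep)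
  have Tp: "T_field A g p = ?T ?x" by (simp add: vrep_at[OF c] J)
  define m where "m = real CARD('n)"
  \<comment> \<open>The multiples of the metric in E, from the trace-free part of the Ricci tensor
    and from the divergence; the Weyl action removes them.\<close>
  define k where "k = - scal A g p / m - (m - 2) * (1 / m * (divergence A g (T_field A g) p + g p (T_field A
    g p) (T_field A g p)))"
  define M where "M = (\<lambda>a b. lRic ?G ?x a b + (m - 2) * (?G ?x (lnabla ?G ?T ?x a) b + ?G ?x (?T ?x) a * ?G
    ?x (?T ?x) b))"
  have "E_T A g p a b = M a b + k * ?G ?x a b" for a b
    unfolding E_T_def Let_def Ric0_def nabla_dual_def nabT Ric k_def m_def[symmetric] M_def Tp gp
    by (simp add: algebra_simps)
  then have "E_T A g p = (\<lambda>a b. M a b + k * ?G ?x a b)" by (intro ext)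
  then have E: "weyl_act A g p (sym2 (E_T A g p)) u v = lact ?G ?x (sym2 M) u v" for u v
    unfolding act L.lact_sym2[OF x] using n by (simp add: lact_add lact_cmult L.lact_metric[OF x])
  have C: "C_T A g p a b d = lcotton ?G ?x a b d - lweyl ?G ?x a b d (?T ?x)" for a b d
    unfolding C_T_def d_nabla_def n2 weyl Tp lcotton_def ..
  have d1: "delta1 A g (delta_W A g) p u v = ldelta1 ?G (ldelta4 ?G (lweyl ?G)) ?x u v"
    unfolding delta1_def ldelta1_def n3 onb ..
  show ?thesis
    unfolding gen_bach_def lbach_def Let_def d1 E Tp
    unfolding Ric act gp sym2_def[of "C_T A g p _"] C
    unfolding M_def m_def sym2_def ..
qed

lemma nullity_dim_locally_constant:
  assumes p: "p \<in> M_E A g" and c: "c \<in> A" "p \<in> fst c"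
  obtains N where "open N" "snd c p \<in> N" "N \<subseteq> snd c ` fst c"
    "\<And>x. x \<in> N \<Longrightarrow> dim (nullity (lweyl (metric_rep A g c) x)) = dim (nullity (lweyl (metric_rep A g c) (snd c p)))"
proof -
  obtain U where U: "open U" "p \<in> U" "\<And>q. q \<in> U \<Longrightarrow> dim (weyl_nullity A g q) = dim (weyl_nullity A g p)"
    using p unfolding M_E_def by blast
  show thesis
  proof (rule that[of "snd c ` (fst c \<inter> U)"])
    show "open (snd c ` (fst c \<inter> U))" by (rule open_chart_image[OF c(1) U(1)])
    fix x assume "x \<in> snd c ` (fst c \<inter> U)"
    then obtain q where q: "q \<in> fst c" "q \<in> U" "x = snd c q" by blast
    show "dim (nullity (lweyl (metric_rep A g c) x)) = dim (nullity (lweyl (metric_rep A g c) (snd c p)))"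
      using U(3)[OF q(2)] unfolding weyl_nullity_rep[OF c(1) q(1)] weyl_nullity_rep[OF c] q(3) .
  qed (use U(2) c in auto)
qed

lemma vrep_T_cond:
  assumes "CARD('n) \<ge> 4" and c: "c \<in> A" and x: "x \<in> snd c ` fst c"
  shows "T_cond (metric_rep A g c x) (onb (metric_rep A g c) x) (lweyl (metric_rep A g c) x)
    (ldelta4 (metric_rep A g c) (lweyl (metric_rep A g c)) x) (vrep c (T_field A g) x)"
  using T_field_rep[OF assms(1) c chart(4)[OF c x]] chart(5)[OF c x] by (simp add: vrep_def)

end

section \<open>Conformal invariance on the manifold\<close>

lemma riemannian_metric_conformal:
  assumes A: "smooth_atlas A" and g: "riemannian_metric A g" and \<psi>: "smooth_fun A \<psi>" "\<forall>p\<in>points A. \<psi> p > 0"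
  shows "riemannian_metric A (\<lambda>q u v. g q u v / (\<psi> q)\<^sup>2)"
  unfolding riemannian_metric_def
proof (intro conjI ballI allI impI)
  interpret riemannian A g by unfold_locales (rule A g)+
  fix p assume p: "p \<in> points A"
  then have h: "metric_form (g p)" using metric_form_g by (auto simp: points_def)
  show "bilinear (\<lambda>u v. g p u v / (\<psi> p)\<^sup>2)"
    by (rule bilinearI2; rule linearI; simp add: metric_form_simps[OF h] add_divide_distrib)
  show "g p u v / (\<psi> p)\<^sup>2 = g p v u / (\<psi> p)\<^sup>2" for u v using metric_form_sym[OF h, of u v] by simp
  show "0 < g p u u / (\<psi> p)\<^sup>2" if "u \<noteq> 0" for u using h that \<psi>(2) p by (auto simp: metric_form_def)
next
  interpret riemannian A g by unfold_locales (rule A g)+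
  fix c u v assume c: "c \<in> A"
  have s: "smooth_on (\<psi> \<circ> chart_inv c) (snd c ` fst c)" using \<psi>(1) c by (auto simp: smooth_fun_def)
  have G: "smooth_on ((\<lambda>q. g q (coord_field A c u q) (coord_field A c v q)) \<circ> chart_inv c) (snd c ` fst c)"
    using g c unfolding riemannian_metric_def by blast
  have "\<psi> (chart_inv c x) > 0" if "x \<in> snd c ` fst c" for x
    using chart(4)[OF c that] \<psi>(2) c by (auto simp: points_def)
  then have "smooth_on (\<lambda>x. ((\<lambda>q. g q (coord_field A c u q) (coord_field A c v q)) \<circ> chart_inv c) x / ((\<psi> \<circ>
    chart_inv c) x * (\<psi> \<circ> chart_inv c) x)) (snd c ` fst c)"
    by (intro smooth_on_divide smooth_on_mult chart(2)[OF c] s G) force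
  then show "smooth_on ((\<lambda>q. g q (coord_field A c u q) (coord_field A c v q) / (\<psi> q)\<^sup>2) \<circ> chart_inv c) (snd
    c ` fst c)"
    by (simp add: comp_def power2_eq_square)
qed

theorem proposition3:
  fixes A :: "('a::{t2_space, second_countable_topology}, 'n::finite) chart set"
    and g :: "'a \<Rightarrow> real ^ 'n \<Rightarrow> real ^ 'n \<Rightarrow> real"
    and \<psi> :: "'a \<Rightarrow> real"
  assumes "CARD('n) \<ge> 4"
    and "smooth_atlas A"
    and "riemannian_metric A g"
    and "smooth_fun A \<psi>"
    and "\<forall>p\<in>points A. \<psi> p > 0"
  shows "\<forall>p\<in>M_E A g. \<forall>X Y.
           gen_bach A (\<lambda>q u v. g q u v / (\<psi> q)\<^sup>2) p X Y = (\<psi> p)\<^sup>2 * gen_bach A g p X Y"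
proof (intro ballI allI)
  fix p X Y assume p: "p \<in> M_E A g"
  define g' where "g' = (\<lambda>q u v. g q u v / (\<psi> q)\<^sup>2)"
  interpret M: riemannian A g by unfold_locales (rule assms)+
  interpret M': riemannian A g'
    by unfold_locales (unfold g'_def, rule riemannian_metric_conformal[OF assms(2-5)])
  have pA: "p \<in> points A" using p by (simp add: M_E_def)
  define c where "c = chart_at A p"
  have c: "c \<in> A" "p \<in> fst c" using pA M.chart_at unfolding points_def c_def by blast+
  let ?S = "snd c ` fst c" and ?G = "metric_rep A g c" and ?x = "snd c p"
  let ?T = "M.vrep c (T_field A g)" and ?T' = "M.vrep c (T_field A g')"
  define f where "f = (\<lambda>x. - ln (\<psi> (chart_inv c x)))"
  have pos: "\<psi> (chart_inv c x) > 0" if "x \<in> ?S" for x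
    using M.chart(4)[OF c(1) that] assms(5) c(1) by (auto simp: points_def)
  have f2: "exp (2 * f x) = 1 / (\<psi> (chart_inv c x))\<^sup>2" if "x \<in> ?S" for x
  proof -
    have "exp (f x) = 1 / \<psi> (chart_inv c x)" using pos[OF that] by (simp add: f_def exp_minus inverse_eq_divide)
    then show ?thesis by (simp add: exp_double power_one_over power_divide)
  qed
  interpret L: local_metric ?S ?G by (rule M.local_metric_rep[OF c(1)])
  interpret conformal ?S ?G f
  proof
    have "smooth_on (\<lambda>x. \<psi> (chart_inv c x)) ?S"
      using assms(4) c(1) unfolding smooth_fun_def comp_def by blast
    then show "smooth_on f ?S" unfolding f_def
      by (intro smooth_on_minus smooth_on_ln L.open_S pos)
  qed (rule assms(1))
  have G': "metric_rep A g' c = conf f ?G"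
    by (intro ext) (simp add: metric_rep_def conf_def g'_def f2)
  have x: "?x \<in> ?S" using c by auto
  obtain N where N: "open N" "?x \<in> N" "N \<subseteq> ?S"
      "\<And>y. y \<in> N \<Longrightarrow> dim (L.lnull y) = dim (L.lnull ?x)"
    using M.nullity_dim_locally_constant[OF p c] by blast
  have T: "L.lT_cond y (?T y)" if "y \<in> ?S" for y by (rule M.vrep_T_cond[OF assms(1) c(1) that])
  have T': "cf.lT_cond y (?T' y)" if "y \<in> ?S" for y
    using M'.vrep_T_cond[OF assms(1) c(1) that] unfolding G' .
  obtain N1 where N1: "open N1" "?x \<in> N1" "N1 \<subseteq> N" "smooth_on ?T N1"
    using L.T_smooth[OF assms(1) N(1,3,2,4) T] N(3) by blast
  \<comment> \<open>The nullity is common to both metrics, so the neighbourhood \<open>N\<close>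
    serves for both vector fields.\<close>
  have dim': "dim (cf.lnull y) = dim (cf.lnull ?x)" if "y \<in> N" for y
    using N(4)[OF that] lnull_conf[OF x] lnull_conf[of y] N(3) that by auto
  obtain N2 where N2: "open N2" "?x \<in> N2" "N2 \<subseteq> N" "smooth_on ?T' N2"
    using cf.T_smooth[OF assms(1) N(1,3,2) dim' T'] N(3) by blast
  have dT: "?T differentiable (at ?x)" by (rule smooth_on_differentiable[OF N1(1,4,2)])
  have dT': "?T' differentiable (at ?x)" by (rule smooth_on_differentiable[OF N2(1,4,2)])
  let ?U = "\<lambda>y. exp (- 2 * f y) *\<^sub>R (?T y + gradf y)"
  have dU: "?U differentiable (at ?x)"
    by (intro differentiable_scaleR differentiable_add dT L.smooth_diff[OF _ x] smooth_gradf smooth_on_exp L.open_S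
        smooth_on_mult smooth_on_const smooth_f)
  define \<nu> where "\<nu> = (\<lambda>y. ?T' y - ?U y)"
  have d\<nu>: "\<nu> differentiable (at ?x)" unfolding \<nu>_def by (rule differentiable_diff[OF dT' dU])
  have null: "lweyl (conf f ?G) y (\<nu> y) u v w = 0" if "y \<in> ?S" for y u v w
    using T_cond_conf[OF that T[OF that] T'[OF that]] unfolding lnull_conf[OF that, symmetric]
    by (simp add: \<nu>_def nullity_def)
  \<comment> \<open>Invariance under the nullity is used for the new metric with base field
    \<open>?U\<close>, the field for which \<open>lbach_conf\<close> gives the exact law.\<close>
  have "lbach (conf f ?G) (\<lambda>y. ?U y + \<nu> y) ?x X Y = lbach (conf f ?G) ?U ?x X Y"
    by (rule cf.lbach_add_nullity[OF x L.open_S order_refl assms(1) dU d\<nu> null])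
  then have "lbach (conf f ?G) ?T' ?x X Y = exp (- 2 * f ?x) * lbach ?G ?T ?x X Y"
    using lbach_conf[OF x dT, of X Y] by (simp add: \<nu>_def)
  moreover have "exp (- 2 * f ?x) = (\<psi> p)\<^sup>2"
    using f2[OF x] M.chart(3)[OF c] by (simp add: exp_minus)
  ultimately show "gen_bach A (\<lambda>q u v. g q u v / (\<psi> q)\<^sup>2) p X Y = (\<psi> p)\<^sup>2 * gen_bach A g p X Y"
    using M.gen_bach_rep[OF assms(1) pA, folded c_def, OF dT] M'.gen_bach_rep[OF assms(1) pA, folded c_def, OF dT']
    unfolding G' g'_def[symmetric] by simp
qed

end
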